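(* Let $Q$ be a finite symmetric quiver with vertex set $I$ and $a_{ij}=a_{ji}$ arrows from $i$ to $j$ for all $i,j\in I$. Let $\mathcal{R}$ be the K-theoretical Hall algebra of $Q$, let $\hat{\mathcal{H}}$ be the completed cohomological Hall algebra of $Q$, let $\sigma,\tilde\sigma:\mathbb{Z}^I\to \mathrm{Aut}(\hat{\mathcal{H}})$ be the group homomorphisms defined in the context, and let $\hat{\mathcal{H}}^{\sigma}$ (right Zhang twist by $\sigma$) and ${}^{\tilde\sigma}\hat{\mathcal{H}}$ (left Zhang twist by $\tilde\sigma$) be the corresponding twisted algebras. Then there exist injective degree preserving homomorphisms of $\mathbb{Z}^I$-graded algebras $$h^{\sigma}:\mathcal{R}\to\hat{\mathcal{H}}^{\sigma},\qquad {}^{\tilde\sigma}h:\mathcal{R}\to{}^{\tilde\sigma}\hat{\mathcal{H}},$$ given by twists of the Chern character map $ch$: for $f\in\mathcal{R}_\gamma$, $h^\sigma(f)=\eta_\gamma\, ch(f)$ and ${}^{\tilde\sigma}h(f)=\tilde\eta_\gamma\, ch(f)$.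
   Context: Notation. For $\gamma=(\gamma^i)_{i\in I}\in\mathbb{Z}_{\ge0}^I$ put $S_\gamma=\prod_{i\in I}S_{\gamma^i}$, acting by permuting, for each $i$, the variables $x_{i,1},\dots,x_{i,\gamma^i}$ (resp. $z_{i,1},\dots,z_{i,\gamma^i}$). Completed CoHA. $\hat{\mathcal{H}}=\bigoplus_{\gamma\in\mathbb{Z}^I}\hat{\mathcal{H}}_\gamma$ with $\hat{\mathcal{H}}_\gamma=\mathbb{Q}[[x_{i,\alpha}: i\in I,1\le\alpha\le\gamma^i]]^{S_\gamma}$ for $\gamma\in\mathbb{Z}^I_{\ge0}$ and $\hat{\mathcal{H}}_\gamma=0$ otherwise. For $f_1\in\hat{\mathcal{H}}_{\gamma_1}$, $f_2\in\hat{\mathcal{H}}_{\gamma_2}$, the product $f_1\cdot f_2\in\hat{\mathcal{H}}_{\gamma_1+\gamma_2}$ is $$\sum_{\text{shuffles}} f_1(x')f_2(x'')\frac{\prod_{i,j\in I}\prod_{\alpha_1=1}^{\gamma_1^i}\prod_{\alpha_2=1}^{\gamma_2^j}(x''_{j,\alpha_2}-x'_{i,\alpha_1})^{a_{ij}}}{\prod_{i\in I}\prod_{\alpha_1=1}^{\gamma_1^i}\prod_{\alpha_2=1}^{\gamma_2^i}(x''_{i,\alpha_2}-x'_{i,\alpha_1})},$$ where the sum runs over all families of $(\gamma_1^i,\gamma_2^i)$-shuffles, one for each $i\in I$, i.e. over all ways to split, for every $i$, the variables $x_{i,1},\dots,x_{i,\gamma_1^i+\gamma_2^i}$ into $\gamma_1^i$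 variables $x'_{i,\cdot}$ and $\gamma_2^i$ variables $x''_{i,\cdot}$ (each in increasing order of index). This is an associative $\mathbb{Z}^I$-graded algebra. KHA. $\mathcal{R}=\bigoplus_\gamma\mathcal{R}_\gamma$ with $\mathcal{R}_\gamma=K_0^{G_\gamma}(M_\gamma)=\mathbb{Z}[z_{i,\alpha}^{\pm1}]^{S_\gamma}$ for $\gamma\in\mathbb{Z}_{\ge0}^I$ ($M_\gamma$ the space of representations of $Q$ of dimension $\gamma$, $G_\gamma=\prod_i GL(\gamma^i,\mathbb{C})$), and $\mathcal{R}_\gamma=0$ otherwise. The product of $f_1\in\mathcal{R}_{\gamma_1}$ and $f_2\in\mathcal{R}_{\gamma_2}$ is $$\sum_{\text{shuffles}} f_1(z')f_2(z'')\frac{\prod_{i,j}\prod_{\alpha_1=1}^{\gamma_1^i}\prod_{\alpha_2=1}^{\gamma_2^j}(1-z'_{i,\alpha_1}(z''_{j,\alpha_2})^{-1})^{a_{ij}}}{\prod_{i}\prod_{\alpha_1=1}^{\gamma_1^i}\prod_{\alpha_2=1}^{\gamma_2^i}(1-z'_{i,\alpha_1}(z''_{i,\alpha_2})^{-1})}.$$ The Chern character $ch:\mathcal{R}\to\hat{\mathcal{H}}$ is the additive graded injection given by the substitution $z_{i,\alpha}\mapsto e^{x_{i,\alpha}}$. Zhang twists. For a $\mathbb{Z}^I$-graded algebra $A$ and a group homomorphism $\rho:\mathbb{Z}^I\to\mathrm{Aut}(A)$ (degree preserving algebra automorphisms), the right twist $A^\rho$ is $A$ as a graded space with product $y\bullet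 z=y\,\rho_s(z)$ for $y\in A_s$; the left twist ${}^\rho A$ is $A$ as a graded space with product $x\circ y=\rho_s(x)\,y$ for $y\in A_s$. The homomorphisms $\sigma,\tilde\sigma$. For $\tau\in\mathbb{Z}^I$, $\gamma\in\mathbb{Z}^I_{\ge0}$, put $$a_\tau^\gamma=\prod_{i\in I}\exp(x_{i,1}+\dots+x_{i,\gamma^i})^{\tau^i-\sum_{j}a_{ij}\tau^j}\in\hat{\mathcal{H}}_\gamma,\qquad \tilde b_\tau^\gamma=(-1)^{\sum_i\gamma^i\tau^i+\sum_{i,j}a_{ij}\gamma^i\tau^j}(a_\tau^\gamma)^{-1}.$$ For $f\in\hat{\mathcal{H}}_\gamma$: $\sigma_\tau(f)=a_\tau^\gamma f$, $\tilde\sigma_\tau(f)=\tilde b_\tau^\gamma f$ (ordinary multiplication of power series). The twisting series. Fix a linear order on $I$ and order pairs $(i,\alpha)\in I\times\mathbb{Z}_{>0}$ lexicographically. Put $$k_\gamma(x)=\frac{\prod_{(i,\alpha)<(j,\beta)}(x_{j,\beta}-x_{i,\alpha})^{a_{ij}}}{\prod_{i}\prod_{\alpha<\beta}(x_{i,\beta}-x_{i,\alpha})},\quad \eta_\gamma(x)=\frac{k_\gamma((x_{i,\alpha}))}{k_\gamma((e^{x_{i,\alpha}}))},\quad \tilde\eta_\gamma(x)=\frac{k_\gamma((x_{i,\alpha}))}{k_\gamma((e^{-x_{i,\alpha}}))},$$ where $1\le\alpha\le\gamma^i$, $1\le\beta\le\gamma^j$ (resp. $\gamma^i$). These $\eta_\gamma,\tilde\eta_\gamma$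 are elements of $\hat{\mathcal{H}}_\gamma$. *)

theory Defs
  imports
    "HOL-Analysis.Finite_Cartesian_Product"
    "HOL-Library.Poly_Mapping"
    "HOL-Library.Product_Lexorder"
    "HOL-Combinatorics.Permutations"
    "HOL-Computational_Algebra.Polynomial_Factorial"
    "HOL-Algebra.Ring"
    "Graph_Theory.Digraph"
begin

unbundle vec_syntax

section \<open>Formal power series in arbitrarily many variables\<close>

text \<open>
  A monomial is an exponent vector of type \<^typ>\<open>'v \<Rightarrow>\<^sub>0 nat\<close>; a series is an
  arbitrary family of coefficients indexed by monomials.
\<close>

typedef ('v, 'a) mfps = "UNIV :: (('v \<Rightarrow>\<^sub>0 nat) \<Rightarrow> 'a) set"
  morphisms mcoeff Abs_mfps ..

setup_lifting type_definition_mfps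

lemma mfps_eqI: "(\<And>m. mcoeff f m = mcoeff g m) \<Longrightarrow> f = g"
  by (metis mcoeff_inverse ext)

lemma finite_monomial_splits:
  fixes m :: "'v \<Rightarrow>\<^sub>0 nat"
  shows "finite {(k, l). k + l = m}"
proof -
  let ?S = "{f. \<forall>v. (v \<in> Poly_Mapping.keys m \<longrightarrow> f v \<in> {..Max (Poly_Mapping.lookup m ` Poly_Mapping.keys m)})
                 \<and> (v \<notin> Poly_Mapping.keys m \<longrightarrow> f v = (0::nat))}"
  have fS: "finite ?S"
    by (rule finite_set_of_finite_funs) auto
  have *: "Poly_Mapping.lookup k \<in> ?S" if "k + l = m" for k l
  proof -
    have le: "Poly_Mapping.lookup k v \<le> Poly_Mapping.lookup m v" for v
      using that by (auto simp: lookup_add)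
    have "Poly_Mapping.lookup m v \<le> Max (Poly_Mapping.lookup m ` Poly_Mapping.keys m)" if "v \<in> Poly_Mapping.keys m" for v
      using that by (intro Max_ge) auto
    then have "Poly_Mapping.lookup k v \<le> Max (Poly_Mapping.lookup m ` Poly_Mapping.keys m)"
      if "v \<in> Poly_Mapping.keys m" for v
      using le that by (meson order_trans)
    moreover have "Poly_Mapping.lookup k v = 0" if "v \<notin> Poly_Mapping.keys m" for v
      using le[of v] that by (simp add: in_keys_iff)
    ultimately show ?thesis by simp
  qed
  have inj: "inj_on (\<lambda>(k, l). Poly_Mapping.lookup k) {(k, l). k + l = m}"
    by (auto simp: inj_on_def poly_mapping.lookup_inject)
  have "(\<lambda>(k, l). Poly_Mapping.lookup k) ` {(k, l). k + l = m} \<subseteq> ?S"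
    using * by auto
  with fS inj show ?thesis
    by (meson finite_imageD finite_subset)
qed

instantiation mfps :: (type, comm_ring_1) comm_ring_1
begin

lift_definition zero_mfps :: "('a, 'b) mfps" is "\<lambda>_. 0" .
lift_definition one_mfps :: "('a, 'b) mfps" is "\<lambda>m. if m = 0 then 1 else 0" .
lift_definition plus_mfps :: "('a, 'b) mfps \<Rightarrow> ('a, 'b) mfps \<Rightarrow> ('a, 'b) mfps"
  is "\<lambda>f g m. f m + g m" .
lift_definition minus_mfps :: "('a, 'b) mfps \<Rightarrow> ('a, 'b) mfps \<Rightarrow> ('a, 'b) mfps"
  is "\<lambda>f g m. f m - g m" .
lift_definition uminus_mfps :: "('a, 'b) mfps \<Rightarrow> ('a, 'b) mfps"
  is "\<lambda>f m. - f m" .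
lift_definition times_mfps :: "('a, 'b) mfps \<Rightarrow> ('a, 'b) mfps \<Rightarrow> ('a, 'b) mfps"
  is "\<lambda>f g m. \<Sum>(k, l) | k + l = m. f k * g l" .

instance
proof
  fix f g h :: "('a, 'b) mfps"
  show "f * g * h = f * (g * h)"
  proof transfer
    fix f g h :: "('a \<Rightarrow>\<^sub>0 nat) \<Rightarrow> 'b"
    show "(\<lambda>m. \<Sum>(k, l) | k + l = m. (\<Sum>(p, q) | p + q = k. f p * g q) * h l) =
          (\<lambda>m. \<Sum>(k, l) | k + l = m. f k * (\<Sum>(p, q) | p + q = l. g p * h q))"
    proof
      fix m :: "'a \<Rightarrow>\<^sub>0 nat"
      let ?D = "\<lambda>m::'a \<Rightarrow>\<^sub>0 nat. {(k, l). k + l = m}"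
      have "(\<Sum>(k, l) | k + l = m. (\<Sum>(p, q) | p + q = k. f p * g q) * h l)
          = (\<Sum>x\<in>?D m. \<Sum>y\<in>?D (fst x). f (fst y) * g (snd y) * h (snd x))"
        by (simp add: sum_distrib_right case_prod_beta)
      also have "\<dots> = (\<Sum>(x, y)\<in>Sigma (?D m) (\<lambda>x. ?D (fst x)). f (fst y) * g (snd y) * h (snd x))"
        by (rule sum.Sigma) (auto simp: finite_monomial_splits)
      also have "\<dots> = (\<Sum>(x, y)\<in>Sigma (?D m) (\<lambda>x. ?D (snd x)). f (fst x) * (g (fst y) * h (snd y)))"
        by (rule sum.reindex_bij_witness[
              where i = "\<lambda>((k, l), (p, q)). ((k + p, q), (k, p))"
                and j = "\<lambda>((k, l), (p, q)). ((p, q + l), (q, l))"])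
           (auto simp: ac_simps)
      also have "\<dots> = (\<Sum>x\<in>?D m. \<Sum>y\<in>?D (snd x). f (fst x) * (g (fst y) * h (snd y)))"
        by (rule sum.Sigma[symmetric]) (auto simp: finite_monomial_splits)
      also have "\<dots> = (\<Sum>(k, l) | k + l = m. f k * (\<Sum>(p, q) | p + q = l. g p * h q))"
        by (simp add: sum_distrib_left case_prod_beta)
      finally show "(\<Sum>(k, l) | k + l = m. (\<Sum>(p, q) | p + q = k. f p * g q) * h l) =
          (\<Sum>(k, l) | k + l = m. f k * (\<Sum>(p, q) | p + q = l. g p * h q))" .
    qed
  qed
  show "f * g = g * f"
    by transfer
       (rule ext, rule sum.reindex_bij_witness[where i = prod.swap and j = prod.swap],
        auto simp: ac_simps)
  show "1 * f = f"
  proof transfer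
    fix f :: "('a \<Rightarrow>\<^sub>0 nat) \<Rightarrow> 'b"
    show "(\<lambda>m. \<Sum>(k, l) | k + l = m. (if k = 0 then 1 else 0) * f l) = f"
    proof
      fix m :: "'a \<Rightarrow>\<^sub>0 nat"
      have "(\<Sum>(k, l) | k + l = m. (if k = 0 then 1 else 0) * f l)
          = (\<Sum>(k, l)\<in>{(0 :: 'a \<Rightarrow>\<^sub>0 nat, m)}. (if k = 0 then 1 else 0) * f l)"
        by (rule sum.mono_neutral_right) (auto simp: finite_monomial_splits split: if_splits)
      then show "(\<Sum>(k, l) | k + l = m. (if k = 0 then 1 else 0) * f l) = f m"
        by simp
    qed
  qed
  show "(f + g) * h = f * h + g * h"
    by transfer (auto simp: fun_eq_iff algebra_simps sum.distrib case_prod_beta)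
  show "(0 :: ('a, 'b) mfps) \<noteq> 1"
    by transfer (auto simp: fun_eq_iff)
qed (transfer; simp add: fun_eq_iff algebra_simps)+

end

abbreviation monomial_degree :: "('v \<Rightarrow>\<^sub>0 nat) \<Rightarrow> nat" where
  "monomial_degree m \<equiv> \<Sum>v\<in>Poly_Mapping.keys m. Poly_Mapping.lookup m v"

lemma monomial_degree_add:
  "monomial_degree (k + l) = monomial_degree k + monomial_degree l"
proof -
  let ?V = "Poly_Mapping.keys k \<union> Poly_Mapping.keys l"
  have eq: "monomial_degree m = (\<Sum>v\<in>?V. Poly_Mapping.lookup m v)" if "Poly_Mapping.keys m \<subseteq> ?V" for m
    by (rule sum.mono_neutral_left) (use that in \<open>auto simp: in_keys_iff\<close>)
  have "Poly_Mapping.keys (k + l) \<subseteq> ?V"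
    by (rule Poly_Mapping.keys_add)
  then have "monomial_degree (k + l) = (\<Sum>v\<in>?V. Poly_Mapping.lookup (k + l) v)"
    by (rule eq)
  also have "\<dots> = (\<Sum>v\<in>?V. Poly_Mapping.lookup k v) + (\<Sum>v\<in>?V. Poly_Mapping.lookup l v)"
    by (simp only: lookup_add sum.distrib)
  also have "\<dots> = monomial_degree k + monomial_degree l"
    by (simp only: eq[of k] eq[of l] Un_upper1 Un_upper2)
  finally show ?thesis .
qed

lemma keys_add_nat:
  fixes k l :: "'v \<Rightarrow>\<^sub>0 nat"
  shows "Poly_Mapping.keys (k + l) = Poly_Mapping.keys k \<union> Poly_Mapping.keys l"
  by (auto simp: in_keys_iff lookup_add)

lemma finite_bounded_monomials:
  assumes "finite V"
  shows "finite {m :: 'v \<Rightarrow>\<^sub>0 nat. Poly_Mapping.keys m \<subseteq> V \<and> monomial_degree m = d}"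
proof -
  let ?M = "{m :: 'v \<Rightarrow>\<^sub>0 nat. Poly_Mapping.keys m \<subseteq> V \<and> monomial_degree m = d}"
  let ?S = "{f. \<forall>v. (v \<in> V \<longrightarrow> f v \<in> {..d}) \<and> (v \<notin> V \<longrightarrow> f v = (0::nat))}"
  have "finite ?S"
    using assms by (rule finite_set_of_finite_funs) auto
  moreover have "Poly_Mapping.lookup m \<in> ?S" if "m \<in> ?M" for m
  proof -
    have "Poly_Mapping.lookup m v \<le> d" for v
    proof (cases "v \<in> Poly_Mapping.keys m")
      case True
      then have "Poly_Mapping.lookup m v \<le> monomial_degree m"
        by (intro member_le_sum) auto
      then show ?thesis using that by simp
    qed (simp add: in_keys_iff)
    moreover have "Poly_Mapping.lookup m v = 0" if "v \<notin> V" for v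
      using \<open>m \<in> ?M\<close> that by (auto simp: in_keys_iff)
    ultimately show ?thesis by simp
  qed
  then have "Poly_Mapping.lookup ` ?M \<subseteq> ?S" by auto
  moreover have "inj_on Poly_Mapping.lookup ?M"
    by (auto simp: inj_on_def poly_mapping.lookup_inject)
  ultimately show ?thesis
    by (meson finite_imageD finite_subset)
qed

instance mfps :: (linorder, idom) idom
proof
  fix f g :: "('a, 'b) mfps"
  assume "f \<noteq> 0" "g \<noteq> 0"
  then obtain m n where m: "mcoeff f m \<noteq> 0" and n: "mcoeff g n \<noteq> 0"
    by (metis mfps_eqI zero_mfps.rep_eq)
  define V where "V = Poly_Mapping.keys m \<union> Poly_Mapping.keys n"
  have finV: "finite V" by (simp add: V_def)
  have lead: "\<exists>k. mcoeff h k \<noteq> 0 \<and> Poly_Mapping.keys k \<subseteq> V \<and>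
      (\<forall>p. mcoeff h p \<noteq> 0 \<longrightarrow> Poly_Mapping.keys p \<subseteq> V \<longrightarrow>
        monomial_degree k < monomial_degree p \<or> monomial_degree k = monomial_degree p \<and> k \<le> p)"
    if "mcoeff h r \<noteq> 0" "Poly_Mapping.keys r \<subseteq> V" for h :: "('a, 'b) mfps" and r
  proof -
    let ?P = "\<lambda>d. \<exists>p. mcoeff h p \<noteq> 0 \<and> Poly_Mapping.keys p \<subseteq> V \<and> monomial_degree p = d"
    define d where "d = (LEAST d. ?P d)"
    have "?P d"
      unfolding d_def by (rule LeastI_ex) (use that in blast)
    have dle: "d \<le> monomial_degree p" if "mcoeff h p \<noteq> 0" "Poly_Mapping.keys p \<subseteq> V" for p
      unfolding d_def by (rule Least_le) (use that in blast)
    let ?F = "{p. mcoeff h p \<noteq> 0 \<and> Poly_Mapping.keys p \<subseteq> V \<and> monomial_degree p = d}"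
    have finF: "finite ?F"
      by (rule finite_subset[OF _ finite_bounded_monomials[OF finV, of d]]) auto
    have "?F \<noteq> {}" using \<open>?P d\<close> by auto
    with finF have "Min ?F \<in> ?F"
      by (rule Min_in)
    moreover have "Min ?F \<le> p" if "p \<in> ?F" for p
      using finF that by (rule Min_le)
    ultimately show ?thesis
      using dle by (intro exI[of _ "Min ?F"]) (auto simp: order_le_less)
  qed
  obtain k where k: "mcoeff f k \<noteq> 0" "Poly_Mapping.keys k \<subseteq> V"
    "\<And>p. mcoeff f p \<noteq> 0 \<Longrightarrow> Poly_Mapping.keys p \<subseteq> V \<Longrightarrow>
        monomial_degree k < monomial_degree p \<or> monomial_degree k = monomial_degree p \<and> k \<le> p"
    using lead[OF m] by (auto simp: V_def)
  obtain l where l: "mcoeff g l \<noteq> 0" "Poly_Mapping.keys l \<subseteq> V"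
    "\<And>p. mcoeff g p \<noteq> 0 \<Longrightarrow> Poly_Mapping.keys p \<subseteq> V \<Longrightarrow>
        monomial_degree l < monomial_degree p \<or> monomial_degree l = monomial_degree p \<and> l \<le> p"
    using lead[OF n] by (auto simp: V_def)
  have uniq: "p = k \<and> q = l" if "p + q = k + l" "mcoeff f p \<noteq> 0" "mcoeff g q \<noteq> 0" for p q
  proof -
    have "Poly_Mapping.keys p \<union> Poly_Mapping.keys q \<subseteq> V"
      using that(1) k(2) l(2) by (metis keys_add_nat Un_least)
    then have kp: "monomial_degree k < monomial_degree p \<or> monomial_degree k = monomial_degree p \<and> k \<le> p"
      and lq: "monomial_degree l < monomial_degree q \<or> monomial_degree l = monomial_degree q \<and> l \<le> q"
      using k(3) l(3) that by auto
    have "monomial_degree p + monomial_degree q = monomial_degree k + monomial_degree l"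
      using that(1) by (metis monomial_degree_add)
    with kp lq have "k \<le> p" "l \<le> q" by auto
    show ?thesis
    proof (rule ccontr)
      assume "\<not> ?thesis"
      with \<open>k \<le> p\<close> \<open>l \<le> q\<close> have "k + l < p + q"
        by (metis add_le_less_mono add_less_le_mono order_le_less)
      with that(1) show False by simp
    qed
  qed
  have "mcoeff (f * g) (k + l) = (\<Sum>(p, q) | p + q = k + l. mcoeff f p * mcoeff g q)"
    by (simp add: times_mfps.rep_eq)
  also have "\<dots> = (\<Sum>(p, q)\<in>{(k, l)}. mcoeff f p * mcoeff g q)"
    by (rule sum.mono_neutral_right) (use uniq in \<open>auto simp: finite_monomial_splits\<close>)
  finally have "mcoeff (f * g) (k + l) \<noteq> 0"
    using k(1) l(1) by simp
  then show "f * g \<noteq> 0"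
    by (auto simp: zero_mfps.rep_eq)
qed

lift_definition mfps_var :: "'v \<Rightarrow> ('v, 'a :: zero_neq_one) mfps"
  is "\<lambda>v m. if m = Poly_Mapping.single v 1 then 1 else 0" .

text \<open>
  The exponential \<open>\<Sum>n. f ^ n / n!\<close>, for \<open>f\<close> without constant term: then \<open>f ^ n\<close> has no
  coefficients in degrees below \<open>n\<close>, so truncating the sum at the degree of the monomial
  loses nothing.
\<close>

definition mfps_exp :: "('v, 'a :: field_char_0) mfps \<Rightarrow> ('v, 'a) mfps" where
  "mfps_exp f = Abs_mfps (\<lambda>m. \<Sum>n\<le>monomial_degree m. mcoeff (f ^ n) m / fact n)"

text \<open>
  The substitution \<open>x\<^sub>v \<mapsto> x\<^bsub>\<phi> v\<^esub>\<close>; meaningful for injective \<open>\<phi>\<close> only.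
\<close>

definition mfps_rename :: "('v \<Rightarrow> 'v) \<Rightarrow> ('v, 'a :: zero) mfps \<Rightarrow> ('v, 'a) mfps" where
  "mfps_rename \<phi> f = Abs_mfps (\<lambda>m.
     if Poly_Mapping.keys m \<subseteq> \<phi> ` UNIV then mcoeff f (Poly_Mapping.map_key \<phi> m) else 0)"

section \<open>Laurent polynomials\<close>

text \<open>
  Integral Laurent polynomials are the group ring of the group \<^typ>\<open>'v \<Rightarrow>\<^sub>0 int\<close> of Laurent
  monomials, with the convolution product of \<^typ>\<open>'m \<Rightarrow>\<^sub>0 int\<close>.
\<close>

type_synonym 'v laurent = "('v \<Rightarrow>\<^sub>0 int) \<Rightarrow>\<^sub>0 int"

definition laurent_var :: "'v \<Rightarrow> 'v laurent" where
  "laurent_var v = Poly_Mapping.single (Poly_Mapping.single v 1) 1"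

definition laurent_eval :: "('v \<Rightarrow> 'k :: field) \<Rightarrow> 'v laurent \<Rightarrow> 'k" where
  "laurent_eval u f =
     (\<Sum>m\<in>Poly_Mapping.keys f. of_int (Poly_Mapping.lookup f m) * (\<Prod>v\<in>Poly_Mapping.keys m. u v powi Poly_Mapping.lookup m v))"

section \<open>Dimension vectors, variables and shuffles\<close>

text \<open>
  The variable \<open>x\<^bsub>i,\<alpha>\<^esub>\<close> (or \<open>z\<^bsub>i,\<alpha>\<^esub>\<close>) is the pair \<open>(i, \<alpha>)\<close> with \<open>\<alpha> \<ge> 1\<close>; pairs are ordered
  lexicographically.
\<close>

type_synonym 'i var = "'i \<times> nat"

type_synonym 'i dimvec = "int ^ 'i"

type_synonym 'i series = "('i var, rat) mfps"

abbreviation nonneg :: "'i :: finite dimvec \<Rightarrow> bool" where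
  "nonneg \<gamma> \<equiv> \<forall>i. 0 \<le> \<gamma> $ i"

definition vars :: "'i :: finite dimvec \<Rightarrow> 'i var set" where
  "vars \<gamma> = {(i, \<alpha>). 1 \<le> \<alpha> \<and> \<alpha> \<le> nat (\<gamma> $ i)}"

definition sym_group :: "'i :: finite dimvec \<Rightarrow> ('i var \<Rightarrow> 'i var) set" where
  "sym_group \<gamma> = {\<pi>. \<pi> permutes vars \<gamma> \<and> (\<forall>i \<alpha>. fst (\<pi> (i, \<alpha>)) = i)}"

text \<open>
  A shuffle \<open>\<pi>\<close> encodes the splitting \<open>x'\<^bsub>i,\<alpha>\<^esub> = x\<^bsub>\<pi> (i, \<alpha>)\<^esub>\<close> and
  \<open>x''\<^bsub>i,\<alpha>\<^esub> = x\<^bsub>\<pi> (i, \<gamma>\<^sub>1\<^sup>i + \<alpha>)\<^esub>\<close>.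
\<close>

definition shuffle_perms :: "'i :: finite dimvec \<Rightarrow> 'i dimvec \<Rightarrow> ('i var \<Rightarrow> 'i var) set" where
  "shuffle_perms \<gamma>\<^sub>1 \<gamma>\<^sub>2 = {\<pi> \<in> sym_group (\<gamma>\<^sub>1 + \<gamma>\<^sub>2). \<forall>i.
     strict_mono_on {1..nat (\<gamma>\<^sub>1 $ i)} (\<lambda>\<alpha>. snd (\<pi> (i, \<alpha>))) \<and>
     strict_mono_on {nat (\<gamma>\<^sub>1 $ i) + 1..nat (\<gamma>\<^sub>1 $ i) + nat (\<gamma>\<^sub>2 $ i)} (\<lambda>\<alpha>. snd (\<pi> (i, \<alpha>)))}"

definition shift :: "'i :: finite dimvec \<Rightarrow> 'i var \<Rightarrow> 'i var" where
  "shift \<gamma> = (\<lambda>(i, \<alpha>). (i, nat (\<gamma> $ i) + \<alpha>))"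

text \<open>
  Rational expressions are formed in the fraction field; the value below is unspecified for
  fractions that do not lie in the integral domain itself.
\<close>

definition from_fract :: "'a :: idom fract \<Rightarrow> 'a" where
  "from_fract q = (THE f. to_fract f = q)"

section \<open>The two Hall algebras\<close>

definition arrow_count :: "('i, 'e) pre_digraph \<Rightarrow> 'i \<Rightarrow> 'i \<Rightarrow> nat" where
  "arrow_count Q i j = card {e \<in> arcs Q. tail Q e = i \<and> head Q e = j}"

text \<open>
  An element of the direct sum of components indexed by \<open>\<gamma>\<close> in \<open>\<int>\<^sup>I\<close> is a finitely
  supported family; a graded product is the biadditive extension of its restrictions to pairs
  of components.
\<close>

definition graded_mult ::
  "('g \<Rightarrow> 'g \<Rightarrow> 'b \<Rightarrow> 'b \<Rightarrow> 'b) \<Rightarrow> ('g :: plus \<Rightarrow>\<^sub>0 'b :: comm_monoid_add) \<Rightarrow> ('g \<Rightarrow>\<^sub>0 'b) \<Rightarrow> ('g \<Rightarrow>\<^sub>0 'b)" where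
  "graded_mult M f g = (\<Sum>\<gamma>\<^sub>1\<in>Poly_Mapping.keys f. \<Sum>\<gamma>\<^sub>2\<in>Poly_Mapping.keys g.
     Poly_Mapping.single (\<gamma>\<^sub>1 + \<gamma>\<^sub>2) (M \<gamma>\<^sub>1 \<gamma>\<^sub>2 (Poly_Mapping.lookup f \<gamma>\<^sub>1) (Poly_Mapping.lookup g \<gamma>\<^sub>2)))"

definition graded_ring ::
  "('g \<Rightarrow> 'b set) \<Rightarrow> ('g \<Rightarrow> 'g \<Rightarrow> 'b \<Rightarrow> 'b \<Rightarrow> 'b) \<Rightarrow> ('g :: monoid_add \<Rightarrow>\<^sub>0 'b :: comm_ring_1) ring" where
  "graded_ring C M =
     \<lparr>carrier = {f. \<forall>\<gamma>. Poly_Mapping.lookup f \<gamma> \<in> C \<gamma>},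
      mult = graded_mult M,
      one = Poly_Mapping.single 0 1,
      zero = 0,
      add = (+)\<rparr>"

definition coha_comp :: "'i :: finite dimvec \<Rightarrow> 'i series set" where
  "coha_comp \<gamma> = (if nonneg \<gamma> then
     {f. (\<forall>m. mcoeff f m \<noteq> 0 \<longrightarrow> Poly_Mapping.keys m \<subseteq> vars \<gamma>) \<and>
         (\<forall>\<pi>\<in>sym_group \<gamma>. mfps_rename \<pi> f = f)} else {0})"

definition coha_kernel ::
  "('i :: finite \<Rightarrow> 'i \<Rightarrow> nat) \<Rightarrow> 'i dimvec \<Rightarrow> 'i dimvec \<Rightarrow> ('i var \<Rightarrow> 'k) \<Rightarrow> ('i var \<Rightarrow> 'k) \<Rightarrow> 'k :: field" where
  "coha_kernel a \<gamma>\<^sub>1 \<gamma>\<^sub>2 x' x'' =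
     (\<Prod>i\<in>UNIV. \<Prod>j\<in>UNIV. \<Prod>\<alpha>\<^sub>1=1..nat (\<gamma>\<^sub>1 $ i). \<Prod>\<alpha>\<^sub>2=1..nat (\<gamma>\<^sub>2 $ j).
        (x'' (j, \<alpha>\<^sub>2) - x' (i, \<alpha>\<^sub>1)) ^ a i j)
     / (\<Prod>i\<in>UNIV. \<Prod>\<alpha>\<^sub>1=1..nat (\<gamma>\<^sub>1 $ i). \<Prod>\<alpha>\<^sub>2=1..nat (\<gamma>\<^sub>2 $ i). x'' (i, \<alpha>\<^sub>2) - x' (i, \<alpha>\<^sub>1))"

definition coha_mult ::
  "('i :: {finite, linorder} \<Rightarrow> 'i \<Rightarrow> nat) \<Rightarrow> 'i dimvec \<Rightarrow> 'i dimvec \<Rightarrow> 'i series \<Rightarrow> 'i series \<Rightarrow> 'i series" where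
  "coha_mult a \<gamma>\<^sub>1 \<gamma>\<^sub>2 f\<^sub>1 f\<^sub>2 = from_fract (\<Sum>\<pi>\<in>shuffle_perms \<gamma>\<^sub>1 \<gamma>\<^sub>2.
     let \<pi>' = \<pi>; \<pi>'' = \<pi> \<circ> shift \<gamma>\<^sub>1; x = (\<lambda>v. to_fract (mfps_var v)) in
     to_fract (mfps_rename \<pi>' f\<^sub>1) * to_fract (mfps_rename \<pi>'' f\<^sub>2)
       * coha_kernel a \<gamma>\<^sub>1 \<gamma>\<^sub>2 (x \<circ> \<pi>') (x \<circ> \<pi>''))"

definition completed_coha ::
  "('i :: {finite, linorder} \<Rightarrow> 'i \<Rightarrow> nat) \<Rightarrow> ('i dimvec \<Rightarrow>\<^sub>0 'i series) ring" where
  "completed_coha a = graded_ring coha_comp (coha_mult a)"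

definition kha_comp :: "'i :: finite dimvec \<Rightarrow> 'i var laurent set" where
  "kha_comp \<gamma> = (if nonneg \<gamma> then
     {f. (\<forall>m\<in>Poly_Mapping.keys f. Poly_Mapping.keys m \<subseteq> vars \<gamma>) \<and>
         (\<forall>\<pi>\<in>sym_group \<gamma>. \<forall>m. Poly_Mapping.lookup f (Poly_Mapping.map_key \<pi> m) = Poly_Mapping.lookup f m)} else {0})"

definition kha_kernel ::
  "('i :: finite \<Rightarrow> 'i \<Rightarrow> nat) \<Rightarrow> 'i dimvec \<Rightarrow> 'i dimvec \<Rightarrow> ('i var \<Rightarrow> 'k) \<Rightarrow> ('i var \<Rightarrow> 'k) \<Rightarrow> 'k :: field" where
  "kha_kernel a \<gamma>\<^sub>1 \<gamma>\<^sub>2 z' z'' =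
     (\<Prod>i\<in>UNIV. \<Prod>j\<in>UNIV. \<Prod>\<alpha>\<^sub>1=1..nat (\<gamma>\<^sub>1 $ i). \<Prod>\<alpha>\<^sub>2=1..nat (\<gamma>\<^sub>2 $ j).
        (1 - z' (i, \<alpha>\<^sub>1) * inverse (z'' (j, \<alpha>\<^sub>2))) ^ a i j)
     / (\<Prod>i\<in>UNIV. \<Prod>\<alpha>\<^sub>1=1..nat (\<gamma>\<^sub>1 $ i). \<Prod>\<alpha>\<^sub>2=1..nat (\<gamma>\<^sub>2 $ i).
        1 - z' (i, \<alpha>\<^sub>1) * inverse (z'' (i, \<alpha>\<^sub>2)))"

definition kha_mult ::
  "('i :: {finite, linorder} \<Rightarrow> 'i \<Rightarrow> nat) \<Rightarrow> 'i dimvec \<Rightarrow> 'i dimvec \<Rightarrow>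
    'i var laurent \<Rightarrow> 'i var laurent \<Rightarrow> 'i var laurent" where
  "kha_mult a \<gamma>\<^sub>1 \<gamma>\<^sub>2 f\<^sub>1 f\<^sub>2 = from_fract (\<Sum>\<pi>\<in>shuffle_perms \<gamma>\<^sub>1 \<gamma>\<^sub>2.
     let z = (\<lambda>v. to_fract (laurent_var v)); z' = z \<circ> \<pi>; z'' = z \<circ> (\<pi> \<circ> shift \<gamma>\<^sub>1) in
     laurent_eval z' f\<^sub>1 * laurent_eval z'' f\<^sub>2 * kha_kernel a \<gamma>\<^sub>1 \<gamma>\<^sub>2 z' z'')"

definition kha ::
  "('i :: {finite, linorder} \<Rightarrow> 'i \<Rightarrow> nat) \<Rightarrow> ('i dimvec \<Rightarrow>\<^sub>0 'i var laurent) ring" where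
  "kha a = graded_ring kha_comp (kha_mult a)"

definition chern :: "'i :: {finite, linorder} var laurent \<Rightarrow> 'i series" where
  "chern f = from_fract (laurent_eval (\<lambda>v. to_fract (mfps_exp (mfps_var v))) f)"

section \<open>Graded homomorphisms and Zhang twists\<close>

definition homogeneous :: "('g \<Rightarrow>\<^sub>0 'b :: zero, 'm) ring_scheme \<Rightarrow> 'g \<Rightarrow> ('g \<Rightarrow>\<^sub>0 'b) set" where
  "homogeneous A \<gamma> = {f \<in> carrier A. Poly_Mapping.keys f \<subseteq> {\<gamma>}}"

definition graded_hom ::
  "('g \<Rightarrow>\<^sub>0 'b :: zero, 'm) ring_scheme \<Rightarrow> ('g \<Rightarrow>\<^sub>0 'c :: zero, 'n) ring_scheme
    \<Rightarrow> (('g \<Rightarrow>\<^sub>0 'b) \<Rightarrow> ('g \<Rightarrow>\<^sub>0 'c)) set" where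
  "graded_hom A B = {h \<in> ring_hom A B. \<forall>\<gamma>. h ` homogeneous A \<gamma> \<subseteq> homogeneous B \<gamma>}"

text \<open>
  The twisting map \<open>\<rho> s\<close> depends on the degree of one factor, which is therefore split into its
  homogeneous components \<open>single s (lookup y s)\<close>.
\<close>

definition right_twist ::
  "('g \<Rightarrow>\<^sub>0 'b :: comm_monoid_add, 'm) ring_scheme \<Rightarrow> ('g \<Rightarrow> ('g \<Rightarrow>\<^sub>0 'b) \<Rightarrow> ('g \<Rightarrow>\<^sub>0 'b))
    \<Rightarrow> ('g \<Rightarrow>\<^sub>0 'b, 'm) ring_scheme" where
  "right_twist A \<rho> = A\<lparr>mult := \<lambda>y z.
     \<Sum>s\<in>Poly_Mapping.keys y. Poly_Mapping.single s (Poly_Mapping.lookup y s) \<otimes>\<^bsub>A\<^esub> \<rho> s z\<rparr>"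

definition left_twist ::
  "('g \<Rightarrow>\<^sub>0 'b :: comm_monoid_add, 'm) ring_scheme \<Rightarrow> ('g \<Rightarrow> ('g \<Rightarrow>\<^sub>0 'b) \<Rightarrow> ('g \<Rightarrow>\<^sub>0 'b))
    \<Rightarrow> ('g \<Rightarrow>\<^sub>0 'b, 'm) ring_scheme" where
  "left_twist A \<rho> = A\<lparr>mult := \<lambda>x y.
     \<Sum>s\<in>Poly_Mapping.keys y. \<rho> s x \<otimes>\<^bsub>A\<^esub> Poly_Mapping.single s (Poly_Mapping.lookup y s)\<rparr>"

definition a_series ::
  "('i :: {finite, linorder} \<Rightarrow> 'i \<Rightarrow> nat) \<Rightarrow> 'i dimvec \<Rightarrow> 'i dimvec \<Rightarrow> 'i series" where
  "a_series a \<tau> \<gamma> = from_fract (\<Prod>i\<in>UNIV.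
     to_fract (mfps_exp (\<Sum>\<alpha>=1..nat (\<gamma> $ i). mfps_var (i, \<alpha>)))
       powi (\<tau> $ i - (\<Sum>j\<in>UNIV. int (a i j) * \<tau> $ j)))"

definition b_series ::
  "('i :: {finite, linorder} \<Rightarrow> 'i \<Rightarrow> nat) \<Rightarrow> 'i dimvec \<Rightarrow> 'i dimvec \<Rightarrow> 'i series" where
  "b_series a \<tau> \<gamma> = from_fract (
     (-1) powi ((\<Sum>i\<in>UNIV. \<gamma> $ i * \<tau> $ i) + (\<Sum>i\<in>UNIV. \<Sum>j\<in>UNIV. int (a i j) * \<gamma> $ i * \<tau> $ j))
       * inverse (to_fract (a_series a \<tau> \<gamma>)))"

definition sigma ::
  "('i :: {finite, linorder} \<Rightarrow> 'i \<Rightarrow> nat) \<Rightarrow> 'i dimvec \<Rightarrow>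
    ('i dimvec \<Rightarrow>\<^sub>0 'i series) \<Rightarrow> ('i dimvec \<Rightarrow>\<^sub>0 'i series)" where
  "sigma a \<tau> = Poly_Mapping.mapp (\<lambda>\<gamma> f. a_series a \<tau> \<gamma> * f)"

definition sigma_tilde ::
  "('i :: {finite, linorder} \<Rightarrow> 'i \<Rightarrow> nat) \<Rightarrow> 'i dimvec \<Rightarrow>
    ('i dimvec \<Rightarrow>\<^sub>0 'i series) \<Rightarrow> ('i dimvec \<Rightarrow>\<^sub>0 'i series)" where
  "sigma_tilde a \<tau> = Poly_Mapping.mapp (\<lambda>\<gamma> f. b_series a \<tau> \<gamma> * f)"

section \<open>The twisting series\<close>

definition k_expr ::
  "('i :: {finite, linorder} \<Rightarrow> 'i \<Rightarrow> nat) \<Rightarrow> 'i dimvec \<Rightarrow> ('i var \<Rightarrow> 'k) \<Rightarrow> 'k :: field" where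
  "k_expr a \<gamma> x =
     (\<Prod>(v, w) | v \<in> vars \<gamma> \<and> w \<in> vars \<gamma> \<and> v < w. (x w - x v) ^ a (fst v) (fst w))
     / (\<Prod>i\<in>UNIV. \<Prod>(\<alpha>, \<beta>) | 1 \<le> \<alpha> \<and> \<alpha> < \<beta> \<and> \<beta> \<le> nat (\<gamma> $ i). x (i, \<beta>) - x (i, \<alpha>))"

definition eta ::
  "('i :: {finite, linorder} \<Rightarrow> 'i \<Rightarrow> nat) \<Rightarrow> 'i dimvec \<Rightarrow> 'i series" where
  "eta a \<gamma> = from_fract (
     k_expr a \<gamma> (\<lambda>v. to_fract (mfps_var v)) / k_expr a \<gamma> (\<lambda>v. to_fract (mfps_exp (mfps_var v))))"

definition eta_tilde ::
  "('i :: {finite, linorder} \<Rightarrow> 'i \<Rightarrow> nat) \<Rightarrow> 'i dimvec \<Rightarrow> 'i series" where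
  "eta_tilde a \<gamma> = from_fract (
     k_expr a \<gamma> (\<lambda>v. to_fract (mfps_var v)) / k_expr a \<gamma> (\<lambda>v. to_fract (mfps_exp (- mfps_var v))))"

end

theory Submission
  imports Defs
begin

text \<open>
  Both products are sums over shuffles, and the theorem holds summand by summand. Write
  \<open>K(x', x'')\<close> for the kernel of the cohomological product, \<open>z = e\<^sup>x\<close>, and \<open>k\<close> for the quotient that
  defines the twisting series. Two identities carry the proof.

  \<^item> A summand of the product splits the variables \<open>x\<close> into \<open>x'\<close> and \<open>x''\<close>, and the unordered pairs of
    variables accordingly into pairs inside \<open>x'\<close>, pairs inside \<open>x''\<close> and mixed pairs. As the quiver is
    symmetric, a pair contributes the same factor, up to sign, in whichever order it is taken.
    Hence \<open>k(x') k(x'') K(x', x'') = \<plusminus> k(x)\<close> (\<open>pair_prod_split\<close>, \<open>k_expr_split\<close>). The sign depends on the splitting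
    only and is therefore the same after the substitution \<open>x \<mapsto> e\<^sup>x\<close>; dividing the two equations gives
    \<open>\<eta>(x') \<eta>(x'') K(x', x'') = \<eta>(x) K(z', z'')\<close>. The same argument works for \<open>x \<mapsto> exp (- x)\<close>.

  \<^item> \<open>K(z', z'')\<close> and the kernel of the K-theoretical product differ by replacing \<open>z'' - z'\<close> by
    \<open>1 - z' / z''\<close>, that is, by a monomial in the \<open>z''\<close>, and this monomial is exactly what
    \<open>\<sigma>\<close> multiplies the second factor by (\<open>right_kernel_identity\<close>). With inverted variables one
    extracts \<open>- 1 / z'\<close> instead, and obtains the monomial and the sign in the twist of the first factor
    by \<open>\<sigma>\<close> with tilde (\<open>left_kernel_identity\<close>).

  These are identities of rational functions. To read them in the two algebras, quotients have to be
  recognised as elements of the underlying rings.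

  \<^item> The twisting series is a power series, since \<open>e\<^sup>x - e\<^sup>y\<close> is \<open>x - y\<close> times a unit
    (\<open>mfps_exp_diff\<close>, \<open>to_fract_twist_series\<close>).

  \<^item> The product of two symmetric Laurent polynomials is a Laurent polynomial over the integers
    (\<open>to_fract_kha_mult\<close>). The sum over all shuffles is symmetric, because shuffles represent the cosets of
    \<open>S\<^bsub>\<mu>\<^esub> \<times> S\<^bsub>\<nu>\<^esub>\<close>, where \<open>\<mu>\<close> and \<open>\<nu>\<close> are the degrees of the factors, so its product with
    the Vandermonde determinants of all vertices is an antisymmetric Laurent polynomial. It vanishes at
    \<open>z\<^sub>v = z\<^sub>w\<close> for variables \<open>v\<close> and \<open>w\<close> of the same vertex and is thus divisible by each of the pairwise
    non-associated primes \<open>z\<^sub>v - z\<^sub>w\<close>, hence by the determinants.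

  That the cohomological product of two elements of the image is a power series then follows from the
  comparison of the summands.

  Injectivity reduces to that of the Chern character, which says that exponentials of distinct linear
  forms are linearly independent (\<open>exponentials_independent\<close>).
\<close>

section \<open>Power series without constant term and their exponentials\<close>

lemma mcoeff_simps [simp]:
  "mcoeff 0 m = 0" "mcoeff 1 m = (if m = 0 then 1 else 0)"
  "mcoeff (f + g) m = mcoeff f m + mcoeff g m"
  "mcoeff (f - g) m = mcoeff f m - mcoeff g m"
  "mcoeff (- f) m = - mcoeff f m"
  by (simp_all add: zero_mfps.rep_eq one_mfps.rep_eq plus_mfps.rep_eq minus_mfps.rep_eq
      uminus_mfps.rep_eq)

lemma mcoeff_var: "mcoeff (mfps_var v) m = (if m = Poly_Mapping.single v 1 then 1 else 0)"
  by (simp add: mfps_var.rep_eq)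

lemma single_Suc_0_eq_iff [simp]:
  "Poly_Mapping.single v (Suc 0) = Poly_Mapping.single w (Suc 0) \<longleftrightarrow> v = w"
proof
  assume "Poly_Mapping.single v (Suc 0) = Poly_Mapping.single w (Suc 0)"
  then have "Poly_Mapping.lookup (Poly_Mapping.single v (Suc 0)) v
      = Poly_Mapping.lookup (Poly_Mapping.single w (Suc 0)) v"
    by (rule arg_cong)
  then show "v = w" by (simp add: lookup_single when_def split: if_splits)
qed simp

lemma mcoeff_mult: "mcoeff (f * g) m = (\<Sum>(k, l) | k + l = m. mcoeff f k * mcoeff g l)"
  by (simp add: times_mfps.rep_eq)

lemma mcoeff_sum: "mcoeff (sum f A) m = (\<Sum>a\<in>A. mcoeff (f a) m)"
  by (induction A rule: infinite_finite_induct) auto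

lemma mcoeff_of_nat_mult: "mcoeff (of_nat n * f) m = of_nat n * mcoeff f m"
  by (induction n) (auto simp: algebra_simps)

lemma mcoeff_of_int_mult: "mcoeff (of_int n * f) m = of_int n * mcoeff f m"
  by (cases n rule: int_diff_cases) (simp add: left_diff_distrib mcoeff_of_nat_mult)

lemma monomial_degree_eq_0_iff [simp]: "monomial_degree m = 0 \<longleftrightarrow> m = 0"
  by (auto simp: in_keys_iff intro!: poly_mapping_eqI)

definition vanishes_below :: "nat \<Rightarrow> ('v, 'a :: comm_ring_1) mfps \<Rightarrow> bool" where
  "vanishes_below n f \<longleftrightarrow> (\<forall>m. monomial_degree m < n \<longrightarrow> mcoeff f m = 0)"

lemma vanishes_below_1: "vanishes_below (Suc 0) f \<longleftrightarrow> mcoeff f 0 = 0"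
  by (auto simp: vanishes_below_def simp del: sum_eq_0_iff)

lemma vanishes_below_mult:
  assumes "vanishes_below p f" "vanishes_below q g"
  shows "vanishes_below (p + q) (f * g)"
  unfolding vanishes_below_def
proof safe
  fix m :: "'a \<Rightarrow>\<^sub>0 nat"
  assume m: "monomial_degree m < p + q"
  have "mcoeff f k * mcoeff g l = 0" if "k + l = m" for k l
  proof -
    have "monomial_degree k < p \<or> monomial_degree l < q"
      using m monomial_degree_add[of k l] unfolding that by linarith
    then show ?thesis
      using assms by (auto simp: vanishes_below_def)
  qed
  then show "mcoeff (f * g) m = 0"
    by (auto simp: mcoeff_mult intro!: sum.neutral)
qed

lemma vanishes_below_power:
  assumes "mcoeff f 0 = 0"
  shows "vanishes_below n (f ^ n)"
proof (induction n)
  case (Suc n)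
  then show ?case
    using vanishes_below_mult[of "Suc 0" f n "f ^ n"] assms by (simp add: vanishes_below_1)
qed (simp add: vanishes_below_def)

text \<open>
  The series \<open>\<Sum>n. c n * t ^ n\<close> at \<open>t = f\<close>, under the same proviso on the constant term of \<open>f\<close> as for the
  exponential. Besides the exponential, the geometric series and \<open>(e\<^sup>t - 1) / t\<close> are needed.
\<close>

definition mfps_compose :: "(nat \<Rightarrow> 'a :: comm_ring_1) \<Rightarrow> ('v, 'a) mfps \<Rightarrow> ('v, 'a) mfps" where
  "mfps_compose c f = Abs_mfps (\<lambda>m. \<Sum>n\<le>monomial_degree m. c n * mcoeff (f ^ n) m)"

lemma mfps_exp_conv_compose: "mfps_exp f = mfps_compose (\<lambda>n. 1 / fact n) f"
  by (simp add: mfps_exp_def mfps_compose_def)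

text \<open>
  Any bound beyond the degree of the monomial is as good as the degree itself. This gives a common
  range of summation when several monomials are involved, as in products.
\<close>

lemma mcoeff_compose:
  assumes "mcoeff f 0 = 0" "monomial_degree m \<le> N"
  shows "mcoeff (mfps_compose c f) m = (\<Sum>n\<le>N. c n * mcoeff (f ^ n) m)"
proof -
  have "mcoeff (mfps_compose c f) m = (\<Sum>n\<le>monomial_degree m. c n * mcoeff (f ^ n) m)"
    by (simp add: mfps_compose_def Abs_mfps_inverse)
  also have "\<dots> = (\<Sum>n\<le>N. c n * mcoeff (f ^ n) m)"
    by (rule sum.mono_neutral_left)
       (use assms vanishes_below_power[OF assms(1)] in \<open>auto simp: vanishes_below_def\<close>)
  finally show ?thesis .
qed

lemma mcoeff_mult_compose:
  assumes "mcoeff f 0 = 0" "monomial_degree m \<le> N"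
  shows "mcoeff (g * mfps_compose c f) m = (\<Sum>n\<le>N. c n * mcoeff (g * f ^ n) m)"
proof -
  have "mcoeff (g * mfps_compose c f) m
      = (\<Sum>(k, l) | k + l = m. mcoeff g k * (\<Sum>n\<le>N. c n * mcoeff (f ^ n) l))"
    unfolding mcoeff_mult
  proof (rule sum.cong[OF refl], clarify)
    fix k l assume "m = k + l"
    then have "monomial_degree l \<le> N"
      using assms(2) monomial_degree_add[of k l] by simp
    then show "mcoeff g k * mcoeff (mfps_compose c f) l
        = mcoeff g k * (\<Sum>n\<le>N. c n * mcoeff (f ^ n) l)"
      by (simp add: mcoeff_compose[OF assms(1)])
  qed
  also have "\<dots> = (\<Sum>n\<le>N. \<Sum>(k, l) | k + l = m. c n * (mcoeff g k * mcoeff (f ^ n) l))"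
    by (subst sum.swap) (simp add: sum_distrib_left case_prod_beta mult_ac)
  also have "\<dots> = (\<Sum>n\<le>N. c n * mcoeff (g * f ^ n) m)"
    by (simp add: mcoeff_mult sum_distrib_left case_prod_beta)
  finally show ?thesis .
qed

lemma mfps_compose_Suc:
  fixes f :: "('v, 'a :: comm_ring_1) mfps"
  assumes "mcoeff f 0 = 0" "c 0 = 1"
  shows "mfps_compose c f = 1 + f * mfps_compose (\<lambda>n. c (Suc n)) f"
proof (rule mfps_eqI)
  fix m :: "'v \<Rightarrow>\<^sub>0 nat"
  let ?N = "monomial_degree m"
  have "mcoeff (mfps_compose c f) m = (\<Sum>n\<le>Suc ?N. c n * mcoeff (f ^ n) m)"
    by (rule mcoeff_compose) (use assms in auto)
  also have "\<dots> = mcoeff 1 m + (\<Sum>n\<le>?N. c (Suc n) * mcoeff (f * f ^ n) m)"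
    using assms(2) by (simp only: sum.atMost_Suc_shift power_0 power_Suc) simp
  also have "(\<Sum>n\<le>?N. c (Suc n) * mcoeff (f * f ^ n) m)
      = mcoeff (f * mfps_compose (\<lambda>n. c (Suc n)) f) m"
    by (rule mcoeff_mult_compose[symmetric]) (use assms in auto)
  finally show "mcoeff (mfps_compose c f) m = mcoeff (1 + f * mfps_compose (\<lambda>n. c (Suc n)) f) m"
    by simp
qed

lemma mcoeff_compose_0: "mcoeff (mfps_compose c f) 0 = c 0"
  by (simp add: mfps_compose_def Abs_mfps_inverse)

lemma mcoeff_mult_0:
  fixes f g :: "('v, 'a :: comm_ring_1) mfps"
  shows "mcoeff (f * g) 0 = mcoeff f 0 * mcoeff g 0"
proof -
  have "mcoeff (f * g) 0 = (\<Sum>(k, l) | k + l = 0. mcoeff f k * mcoeff g l)"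
    by (rule mcoeff_mult)
  also have "{(k, l). k + l = (0 :: 'v \<Rightarrow>\<^sub>0 nat)} = {(0, 0)}"
    by (auto intro!: poly_mapping_eqI simp: poly_mapping_eq_iff fun_eq_iff lookup_add)
  finally show ?thesis by simp
qed

text \<open>
  The geometric series in \<open>1 - f\<close> is an inverse.
\<close>

lemma mfps_unit:
  fixes f :: "('v, 'a :: comm_ring_1) mfps"
  assumes "mcoeff f 0 = 1"
  shows "f dvd 1"
proof -
  have "mfps_compose (\<lambda>_. 1) (1 - f) = 1 + (1 - f) * mfps_compose (\<lambda>_. 1) (1 - f)"
    by (rule mfps_compose_Suc) (use assms in auto)
  then have "f * mfps_compose (\<lambda>_. 1) (1 - f) = 1"
    by (simp add: algebra_simps)
  then show ?thesis by (metis dvd_triv_left)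
qed

lemma mfps_exp_0 [simp]: "mfps_exp 0 = 1"
  unfolding mfps_exp_conv_compose by (subst mfps_compose_Suc) auto

lemma mcoeff_exp_0 [simp]: "mcoeff (mfps_exp f) 0 = 1"
  by (simp add: mfps_exp_conv_compose mcoeff_compose_0)

text \<open>
  The binomial theorem turns the double sum for the product into the sum for the exponential
  of \<open>f + g\<close>; comparing coefficients of one monomial at a time keeps all sums finite.
\<close>

lemma mfps_exp_add:
  fixes f g :: "('v, 'a :: field_char_0) mfps"
  assumes "mcoeff f 0 = 0" "mcoeff g 0 = 0"
  shows "mfps_exp (f + g) = mfps_exp f * mfps_exp g"
proof (rule mfps_eqI)
  fix m :: "'v \<Rightarrow>\<^sub>0 nat"
  define N where "N = monomial_degree m"
  have *: "mcoeff ((f + g) ^ n) m / fact n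
      = (\<Sum>p\<le>n. mcoeff (f ^ p * g ^ (n - p)) m / (fact p * fact (n - p)))" for n
    by (auto simp: binomial_ring mcoeff_sum mult.assoc mcoeff_of_nat_mult sum_divide_distrib
        binomial_fact intro!: sum.cong)
  have "mcoeff (mfps_exp f * mfps_exp g) m
      = (\<Sum>q\<le>N. 1 / fact q * mcoeff (g ^ q * mfps_exp f) m)"
    unfolding mfps_exp_conv_compose[of g]
    by (subst mcoeff_mult_compose[OF assms(2)]) (auto simp: N_def mult.commute)
  also have "\<dots> = (\<Sum>q\<le>N. \<Sum>p\<le>N. mcoeff (f ^ p * g ^ q) m / (fact p * fact q))"
    unfolding mfps_exp_conv_compose[of f]
    by (subst mcoeff_mult_compose[OF assms(1)]) (auto simp: N_def sum_divide_distrib mult.commute)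
  also have "\<dots> = (\<Sum>(q, p)\<in>{..N} \<times> {..N}. mcoeff (f ^ p * g ^ q) m / (fact p * fact q))"
    by (simp add: sum.cartesian_product)
  \<comment> \<open>The square may be cut down to a triangle: beyond it \<open>f ^ p * g ^ q\<close> has no term of degree \<open>N\<close>.\<close>
  also have "\<dots> = (\<Sum>(q, p)\<in>{(q, p). q + p \<le> N}. mcoeff (f ^ p * g ^ q) m / (fact p * fact q))"
  proof (rule sum.mono_neutral_right)
    show "\<forall>i\<in>{..N} \<times> {..N} - {(q, p). q + p \<le> N}.
        (case i of (q, p) \<Rightarrow> mcoeff (f ^ p * g ^ q) m / (fact p * fact q)) = 0"
    proof
      fix i assume i: "i \<in> {..N} \<times> {..N} - {(q, p). q + p \<le> N}"
      obtain q p where qp: "i = (q, p)" by (cases i)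
      with i have "\<not> q + p \<le> N" by blast
      moreover have "vanishes_below (p + q) (f ^ p * g ^ q)"
        by (intro vanishes_below_mult vanishes_below_power assms)
      ultimately have "mcoeff (f ^ p * g ^ q) m = 0"
        unfolding vanishes_below_def N_def by (simp add: add.commute)
      then show "(case i of (q, p) \<Rightarrow> mcoeff (f ^ p * g ^ q) m / (fact p * fact q)) = 0"
        by (simp add: qp)
    qed
  qed auto
  also have "\<dots> = (\<Sum>(n, p)\<in>Sigma {..N} (\<lambda>n. {..n}).
      mcoeff (f ^ p * g ^ (n - p)) m / (fact p * fact (n - p)))"
    by (rule sum.reindex_bij_witness[where i = "\<lambda>(n, p). (n - p, p)" and j = "\<lambda>(q, p). (q + p, p)"])
      auto
  also have "\<dots> = (\<Sum>n\<le>N. \<Sum>p\<le>n. mcoeff (f ^ p * g ^ (n - p)) m / (fact p * fact (n - p)))"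
    by (simp add: sum.Sigma)
  also have "\<dots> = mcoeff (mfps_exp (f + g)) m"
    unfolding mfps_exp_conv_compose
    by (subst mcoeff_compose[where N = N]) (use assms in \<open>auto simp: N_def *[symmetric]\<close>)
  finally show "mcoeff (mfps_exp (f + g)) m = mcoeff (mfps_exp f * mfps_exp g) m" ..
qed

lemma mfps_exp_minus:
  fixes f :: "('v, 'a :: field_char_0) mfps"
  assumes "mcoeff f 0 = 0"
  shows "mfps_exp f * mfps_exp (- f) = 1"
  using mfps_exp_add[of f "- f"] assms by simp

lemma mcoeff_sum_0: "(\<And>a. a \<in> A \<Longrightarrow> mcoeff (f a) 0 = 0) \<Longrightarrow> mcoeff (sum f A) 0 = 0"
  by (simp add: mcoeff_sum)

lemma mcoeff_var_0 [simp]: "mcoeff (mfps_var v) 0 = 0"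
proof -
  have "0 \<noteq> Poly_Mapping.single v (1 :: nat)"
    by (metis lookup_single_eq lookup_zero zero_neq_one)
  then show ?thesis by (simp add: mcoeff_var)
qed

lemma mfps_exp_sum:
  fixes f :: "'b \<Rightarrow> ('v, 'a :: field_char_0) mfps"
  assumes "\<And>a. a \<in> A \<Longrightarrow> mcoeff (f a) 0 = 0"
  shows "mfps_exp (sum f A) = (\<Prod>a\<in>A. mfps_exp (f a))"
  using assms
  by (induction A rule: infinite_finite_induct) (auto simp: mfps_exp_add mcoeff_sum_0)

text \<open>
  Factor out \<open>e\<^sup>g\<close>; what remains is \<open>(e\<^sup>t - 1) / t\<close> at \<open>t = f - g\<close>, a series with constant term \<open>1\<close>.
\<close>

lemma mfps_exp_diff:
  fixes f g :: "('v, 'a :: field_char_0) mfps"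
  assumes "mcoeff f 0 = 0" "mcoeff g 0 = 0"
  obtains u where "mfps_exp f - mfps_exp g = (f - g) * u" "mcoeff u 0 = 1"
proof
  let ?c = "\<lambda>n. 1 / fact (Suc n) :: 'a"
  have "mfps_exp (g + (f - g)) = mfps_exp g * mfps_exp (f - g)"
    by (rule mfps_exp_add) (use assms in auto)
  moreover have "mfps_exp (f - g) = 1 + (f - g) * mfps_compose ?c (f - g)"
    unfolding mfps_exp_conv_compose by (rule mfps_compose_Suc) (use assms in auto)
  ultimately show "mfps_exp f - mfps_exp g = (f - g) * (mfps_exp g * mfps_compose ?c (f - g))"
    by (simp add: algebra_simps)
  show "mcoeff (mfps_exp g * mfps_compose ?c (f - g)) 0 = 1"
    by (simp add: mcoeff_mult_0 mcoeff_compose_0)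
qed

section \<open>Substitutions of variables\<close>

text \<open>
  Renaming variables injectively and setting some of them to zero have the same shape: the
  coefficient at \<open>m\<close> is the old one at \<open>\<kappa> m\<close>, or zero outside \<open>A\<close>. Multiplicativity amounts to the
  correspondence between the splittings of \<open>m\<close> and of \<open>\<kappa> m\<close>, and compatibility with the exponential,
  which is truncated at the degree, to the preservation of degrees.
\<close>

locale monomial_pullback =
  fixes A :: "('v \<Rightarrow>\<^sub>0 nat) set" and \<kappa> :: "('v \<Rightarrow>\<^sub>0 nat) \<Rightarrow> ('v \<Rightarrow>\<^sub>0 nat)"
  assumes add_mem_iff: "k + l \<in> A \<longleftrightarrow> k \<in> A \<and> l \<in> A"
    and bij_splits: "m \<in> A \<Longrightarrow> bij_betw (\<lambda>(k, l). (\<kappa> k, \<kappa> l)) {(k, l). k + l = m} {(k, l). k + l = \<kappa> m}"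
    and zero_mem: "0 \<in> A"
    and degree: "m \<in> A \<Longrightarrow> monomial_degree (\<kappa> m) = monomial_degree m"
begin

definition pullback :: "('v, 'a :: comm_ring_1) mfps \<Rightarrow> ('v, 'a) mfps" where
  "pullback f = Abs_mfps (\<lambda>m. if m \<in> A then mcoeff f (\<kappa> m) else 0)"

lemma mcoeff_pullback: "mcoeff (pullback f) m = (if m \<in> A then mcoeff f (\<kappa> m) else 0)"
  by (simp add: pullback_def Abs_mfps_inverse)

lemma pullback_add: "pullback (f + g) = pullback f + pullback g"
  by (rule mfps_eqI) (simp add: mcoeff_pullback)

lemma pullback_1: "pullback 1 = 1"
proof (rule mfps_eqI)
  fix m :: "'v \<Rightarrow>\<^sub>0 nat"
  show "mcoeff (pullback 1) m = mcoeff 1 m"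
    using degree[of m] degree[of 0] zero_mem
    by (simp add: mcoeff_pullback) (metis monomial_degree_eq_0_iff)
qed

lemma pullback_mult: "pullback (f * g) = pullback f * pullback g"
proof (rule mfps_eqI)
  fix m :: "'v \<Rightarrow>\<^sub>0 nat"
  show "mcoeff (pullback (f * g)) m = mcoeff (pullback f * pullback g) m"
  proof (cases "m \<in> A")
    case True
    have "mcoeff (pullback (f * g)) m = (\<Sum>(k, l) | k + l = \<kappa> m. mcoeff f k * mcoeff g l)"
      using True by (simp add: mcoeff_pullback mcoeff_mult)
    also have "\<dots> = (\<Sum>x | (case x of (k, l) \<Rightarrow> k + l = m).
        (\<lambda>(k, l). mcoeff f k * mcoeff g l) ((\<lambda>(k, l). (\<kappa> k, \<kappa> l)) x))"
      using sum.reindex_bij_betw[OF bij_splits[OF True], of "\<lambda>(k, l). mcoeff f k * mcoeff g l"]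
      by simp
    also have "\<dots> = mcoeff (pullback f * pullback g) m"
      unfolding mcoeff_mult
      by (rule sum.cong) (use True in \<open>auto simp: mcoeff_pullback add_mem_iff\<close>)
    finally show ?thesis .
  next
    case False
    then have "mcoeff (pullback f) k * mcoeff (pullback g) l = 0" if "k + l = m" for k l
      using that by (auto simp: mcoeff_pullback add_mem_iff)
    then have "mcoeff (pullback f * pullback g) m = 0"
      unfolding mcoeff_mult by (intro sum.neutral) auto
    with False show ?thesis by (simp add: mcoeff_pullback)
  qed
qed

lemma pullback_power: "pullback (f ^ n) = pullback f ^ n"
  by (induction n) (auto simp: pullback_1 pullback_mult)

lemma pullback_exp: "pullback (mfps_exp f) = mfps_exp (pullback f)"
proof (rule mfps_eqI)
  fix m :: "'v \<Rightarrow>\<^sub>0 nat"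
  show "mcoeff (pullback (mfps_exp f)) m = mcoeff (mfps_exp (pullback f)) m"
    using degree[of m]
    by (auto simp: mcoeff_pullback mfps_exp_def Abs_mfps_inverse pullback_power[symmetric])
qed

end

definition exp_hom :: "(('v, 'a :: field_char_0) mfps \<Rightarrow> ('v, 'a) mfps) \<Rightarrow> bool" where
  "exp_hom r \<longleftrightarrow> (\<forall>f g. r (f + g) = r f + r g) \<and> (\<forall>f g. r (f * g) = r f * r g) \<and> r 1 = 1
     \<and> (\<forall>f. r (mfps_exp f) = mfps_exp (r f))"

lemma (in monomial_pullback) exp_hom_pullback: "exp_hom pullback"
  by (simp add: exp_hom_def pullback_add pullback_mult pullback_1 pullback_exp)

context
  fixes r :: "('v, 'a :: field_char_0) mfps \<Rightarrow> ('v, 'a) mfps"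
  assumes r: "exp_hom r"
begin

lemma exp_hom_add: "r (f + g) = r f + r g" and exp_hom_mult: "r (f * g) = r f * r g"
  and exp_hom_1: "r 1 = 1" and exp_hom_exp: "r (mfps_exp f) = mfps_exp (r f)"
  using r by (auto simp: exp_hom_def)

lemma exp_hom_0: "r 0 = 0"
  using exp_hom_add[of 0 0] by simp

lemma exp_hom_diff: "r (f - g) = r f - r g"
  using exp_hom_add[of "f - g" g] by (simp add: algebra_simps)

lemma exp_hom_minus: "r (- f) = - r f"
  using exp_hom_diff[of 0 f] by (simp add: exp_hom_0)

lemma exp_hom_power: "r (f ^ n) = r f ^ n"
  by (induction n) (auto simp: exp_hom_1 exp_hom_mult)

lemma exp_hom_sum: "r (sum F A) = (\<Sum>a\<in>A. r (F a))"
  by (induction A rule: infinite_finite_induct) (auto simp: exp_hom_0 exp_hom_add)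

lemma exp_hom_prod: "r (prod F A) = (\<Prod>a\<in>A. r (F a))"
  by (induction A rule: infinite_finite_induct) (auto simp: exp_hom_1 exp_hom_mult)

lemma exp_hom_of_nat: "r (of_nat n) = of_nat n"
  by (induction n) (auto simp: exp_hom_1 exp_hom_0 exp_hom_add)

lemma exp_hom_of_int: "r (of_int n) = of_int n"
  by (cases n rule: int_diff_cases) (simp add: exp_hom_diff exp_hom_of_nat)

lemmas exp_hom_simps = exp_hom_add exp_hom_mult exp_hom_1 exp_hom_exp exp_hom_0 exp_hom_diff
  exp_hom_minus exp_hom_power exp_hom_sum exp_hom_prod exp_hom_of_nat exp_hom_of_int

end

text \<open>
  Setting the variables outside \<open>V\<close> to zero. Being a series in the variables of \<open>V\<close> means being fixed by
  this ring homomorphism, which makes the condition easy to check for quotients.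
\<close>

definition mfps_restrict :: "'v set \<Rightarrow> ('v, 'a :: zero) mfps \<Rightarrow> ('v, 'a) mfps" where
  "mfps_restrict V f = Abs_mfps (\<lambda>m. if Poly_Mapping.keys m \<subseteq> V then mcoeff f m else 0)"

lemma exp_hom_restrict: "exp_hom (mfps_restrict V)"
proof -
  interpret monomial_pullback "{m. Poly_Mapping.keys m \<subseteq> V}" "\<lambda>m. m"
    by unfold_locales (auto simp: keys_add_nat bij_betw_def inj_on_def)
  have "mfps_restrict V = (pullback :: ('a, 'b) mfps \<Rightarrow> _)"
    by (simp add: fun_eq_iff mfps_restrict_def pullback_def)
  then show ?thesis using exp_hom_pullback by simp
qed

lemma mcoeff_restrict:
  "mcoeff (mfps_restrict V f) m = (if Poly_Mapping.keys m \<subseteq> V then mcoeff f m else 0)"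
  by (simp add: mfps_restrict_def Abs_mfps_inverse)

lemma mfps_restrict_eq_iff:
  "mfps_restrict V f = f \<longleftrightarrow> (\<forall>m. mcoeff f m \<noteq> 0 \<longrightarrow> Poly_Mapping.keys m \<subseteq> V)"
  by (metis mcoeff_restrict mfps_eqI)

lemma mfps_restrict_var: "v \<in> V \<Longrightarrow> mfps_restrict V (mfps_var v) = mfps_var v"
  by (auto simp: mfps_restrict_eq_iff mcoeff_var split: if_splits)

lemma lookup_map_key: "inj \<phi> \<Longrightarrow> Poly_Mapping.lookup (Poly_Mapping.map_key \<phi> m) v = Poly_Mapping.lookup m (\<phi> v)"
  by (simp add: map_key.rep_eq)

lemma exp_hom_rename:
  assumes "inj \<phi>"
  shows "exp_hom (mfps_rename \<phi>)"
proof -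
  note lk = lookup_map_key[OF assms]
  have eqI: "k = l" if "Poly_Mapping.map_key \<phi> k = Poly_Mapping.map_key \<phi> l"
    "Poly_Mapping.keys k \<subseteq> range \<phi>" "Poly_Mapping.keys l \<subseteq> range \<phi>" for k l :: "'a \<Rightarrow>\<^sub>0 nat"
  proof (rule poly_mapping_eqI)
    fix v
    show "Poly_Mapping.lookup k v = Poly_Mapping.lookup l v"
    proof (cases "v \<in> range \<phi>")
      case True
      then show ?thesis using that(1) by (metis lk rangeE)
    next
      case False
      then show ?thesis using that(2,3) by (metis in_keys_iff subsetD)
    qed
  qed
  \<comment> \<open>Every monomial is pulled back from its transport along \<open>\<phi>\<close>, which is supported in the range.\<close>
  have lift: "\<exists>k. Poly_Mapping.keys k \<subseteq> range \<phi> \<and> Poly_Mapping.map_key \<phi> k = p" for p :: "'a \<Rightarrow>\<^sub>0 nat"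
  proof -
    let ?f = "\<lambda>v. if v \<in> range \<phi> then Poly_Mapping.lookup p (inv_into UNIV \<phi> v) else 0"
    have "finite {v. ?f v \<noteq> 0}"
      by (rule finite_subset[of _ "\<phi> ` Poly_Mapping.keys p"])
        (use assms in \<open>auto simp: in_keys_iff inv_f_f split: if_splits\<close>)
    then show ?thesis using assms
      by (intro exI[of _ "Abs_poly_mapping ?f"])
         (auto intro!: poly_mapping_eqI simp: lk in_keys_iff inv_f_f split: if_splits)
  qed
  interpret monomial_pullback "{m. Poly_Mapping.keys m \<subseteq> range \<phi>}" "Poly_Mapping.map_key \<phi>"
  proof unfold_locales
    fix m :: "'a \<Rightarrow>\<^sub>0 nat"
    assume m: "m \<in> {m. Poly_Mapping.keys m \<subseteq> range \<phi>}"
    show "bij_betw (\<lambda>(k, l). (Poly_Mapping.map_key \<phi> k, Poly_Mapping.map_key \<phi> l))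
        {(k, l). k + l = m} {(k, l). k + l = Poly_Mapping.map_key \<phi> m}"
      unfolding bij_betw_def
    proof safe
      show "inj_on (\<lambda>(k, l). (Poly_Mapping.map_key \<phi> k, Poly_Mapping.map_key \<phi> l)) {(k, l). k + l = m}"
      proof (rule inj_onI, clarify)
        fix k l k' l' :: "'a \<Rightarrow>\<^sub>0 nat"
        assume *: "m = k + l" "k' + l' = k + l"
          "Poly_Mapping.map_key \<phi> k = Poly_Mapping.map_key \<phi> k'"
          "Poly_Mapping.map_key \<phi> l = Poly_Mapping.map_key \<phi> l'"
        have "Poly_Mapping.keys (k + l) \<subseteq> range \<phi>" "Poly_Mapping.keys (k' + l') \<subseteq> range \<phi>"
          using * m by auto
        then have "Poly_Mapping.keys k \<subseteq> range \<phi>" "Poly_Mapping.keys l \<subseteq> range \<phi>"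
          "Poly_Mapping.keys k' \<subseteq> range \<phi>" "Poly_Mapping.keys l' \<subseteq> range \<phi>"
          unfolding keys_add_nat by auto
        then show "k = k' \<and> l = l'"
          using *(3,4) by (blast intro: eqI)
      qed
    next
      fix k l :: "'a \<Rightarrow>\<^sub>0 nat"
      assume "m = k + l"
      show "Poly_Mapping.map_key \<phi> k + Poly_Mapping.map_key \<phi> l = Poly_Mapping.map_key \<phi> (k + l)"
        by (simp add: map_key_plus[OF assms])
    next
      fix p q assume pq: "p + q = Poly_Mapping.map_key \<phi> m"
      obtain k where k: "Poly_Mapping.keys k \<subseteq> range \<phi>" "Poly_Mapping.map_key \<phi> k = p"
        using lift by blast
      obtain l where l: "Poly_Mapping.keys l \<subseteq> range \<phi>" "Poly_Mapping.map_key \<phi> l = q"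
        using lift by blast
      have "k + l = m"
        by (rule eqI) (use k l m pq in \<open>auto simp: map_key_plus[OF assms] keys_add_nat\<close>)
      then show "(p, q) \<in> (\<lambda>(k, l). (Poly_Mapping.map_key \<phi> k, Poly_Mapping.map_key \<phi> l)) ` {(k, l). k + l = m}"
        using k l by force
    qed
    have "monomial_degree (Poly_Mapping.map_key \<phi> m)
        = (\<Sum>v\<in>\<phi> -` Poly_Mapping.keys m. Poly_Mapping.lookup m (\<phi> v))"
      by (simp add: keys_map_key[OF assms] lk)
    also have "\<dots> = monomial_degree m"
      by (rule sum.reindex_bij_betw) (use m assms in \<open>auto simp: bij_betw_def inj_on_def inj_def\<close>)
    finally show "monomial_degree (Poly_Mapping.map_key \<phi> m) = monomial_degree m" .
  qed (auto simp: keys_add_nat)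
  have "mfps_rename \<phi> = (pullback :: ('a, 'b) mfps \<Rightarrow> _)"
    by (simp add: fun_eq_iff mfps_rename_def pullback_def)
  then show ?thesis using exp_hom_pullback by simp
qed

lemma mfps_rename_var:
  assumes "inj \<phi>"
  shows "mfps_rename \<phi> (mfps_var v) = mfps_var (\<phi> v)"
proof (rule mfps_eqI)
  fix m
  have "m = (Poly_Mapping.single (\<phi> v) 1 :: _ \<Rightarrow>\<^sub>0 nat) \<longleftrightarrow>
      Poly_Mapping.keys m \<subseteq> range \<phi> \<and> Poly_Mapping.map_key \<phi> m = Poly_Mapping.single v 1"
  proof safe
    assume m: "Poly_Mapping.keys m \<subseteq> range \<phi>" "Poly_Mapping.map_key \<phi> m = Poly_Mapping.single v 1"
    show "m = Poly_Mapping.single (\<phi> v) 1"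
    proof (rule poly_mapping_eqI)
      fix w
      show "Poly_Mapping.lookup m w = Poly_Mapping.lookup (Poly_Mapping.single (\<phi> v) 1) w"
      proof (cases "w \<in> range \<phi>")
        case True
        then obtain w' where w: "w = \<phi> w'" by blast
        have "Poly_Mapping.lookup m w = Poly_Mapping.lookup (Poly_Mapping.single v 1) w'"
          using m(2) w by (metis assms lookup_map_key)
        then show ?thesis using w assms by (auto simp: lookup_single when_def inj_eq)
      next
        case False
        then have "Poly_Mapping.lookup m w = 0" "w \<noteq> \<phi> v" using m(1) by (auto simp: in_keys_iff)
        then show ?thesis by (simp add: lookup_single)
      qed
    qed
  qed (auto simp: map_key_single[OF assms])
  then show "mcoeff (mfps_rename \<phi> (mfps_var v)) m = mcoeff (mfps_var (\<phi> v)) m"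
    by (simp add: mfps_rename_def Abs_mfps_inverse mcoeff_var)
qed

section \<open>Linear independence of exponentials\<close>

text \<open>
  The Euler operator \<open>x\<^sub>v \<partial>/\<partial>x\<^sub>v\<close>. It is preferable to the partial derivative because it acts diagonally
  on monomials, which makes the product rule a termwise identity.
\<close>

definition euler :: "'v \<Rightarrow> ('v, 'a :: comm_ring_1) mfps \<Rightarrow> ('v, 'a) mfps" where
  "euler v f = Abs_mfps (\<lambda>m. of_nat (Poly_Mapping.lookup m v) * mcoeff f m)"

lemma mcoeff_euler: "mcoeff (euler v f) m = of_nat (Poly_Mapping.lookup m v) * mcoeff f m"
  by (simp add: euler_def Abs_mfps_inverse)

lemma euler_add: "euler v (f + g) = euler v f + euler v g"
  by (rule mfps_eqI) (simp add: mcoeff_euler algebra_simps)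

lemma euler_0: "euler v 0 = 0"
  by (rule mfps_eqI) (simp add: mcoeff_euler)

lemma euler_sum: "euler v (sum f A) = (\<Sum>a\<in>A. euler v (f a))"
  by (induction A rule: infinite_finite_induct) (auto simp: euler_add euler_0)

lemma euler_of_int_mult: "euler v (of_int n * f) = of_int n * euler v f"
  by (rule mfps_eqI) (simp add: mcoeff_euler mcoeff_of_int_mult)

lemma euler_mult: "euler v (f * g) = euler v f * g + f * euler v g"
proof (rule mfps_eqI)
  fix m
  show "mcoeff (euler v (f * g)) m = mcoeff (euler v f * g + f * euler v g) m"
    unfolding mcoeff_euler mcoeff_simps mcoeff_mult sum_distrib_left sum.distrib[symmetric]
    by (rule sum.cong) (auto simp: mcoeff_euler lookup_add algebra_simps)
qed

lemma euler_power: "euler v (f ^ Suc n) = of_nat (Suc n) * (euler v f * f ^ n)"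
proof (induction n)
  case (Suc n)
  have "euler v (f ^ Suc (Suc n)) = euler v f * f ^ Suc n + f * euler v (f ^ Suc n)"
    by (subst power_Suc, subst euler_mult) simp
  also have "\<dots> = of_nat (Suc (Suc n)) * (euler v f * f ^ Suc n)"
    unfolding Suc.IH by (simp add: algebra_simps)
  finally show ?case .
qed simp

lemma euler_1: "euler v 1 = 0"
  by (rule mfps_eqI) (simp add: mcoeff_euler)

lemma euler_exp:
  fixes f :: "('v, 'a :: field_char_0) mfps"
  assumes "mcoeff f 0 = 0"
  shows "euler v (mfps_exp f) = euler v f * mfps_exp f"
proof (rule mfps_eqI)
  fix m :: "'v \<Rightarrow>\<^sub>0 nat"
  let ?N = "monomial_degree m"
  have "mcoeff (euler v (mfps_exp f)) m = (\<Sum>n\<le>Suc ?N. mcoeff (euler v (f ^ n)) m / fact n)"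
    unfolding mfps_exp_conv_compose mcoeff_euler
    by (subst mcoeff_compose[where N = "Suc ?N"])
       (use assms in \<open>auto simp: sum_distrib_left distrib_left\<close>)
  also have "\<dots> = (\<Sum>n\<le>?N. 1 / fact n * mcoeff (euler v f * f ^ n) m)"
    unfolding sum.atMost_Suc_shift euler_power mcoeff_of_nat_mult
    by (simp add: euler_1 field_simps del: of_nat_Suc)
  also have "\<dots> = mcoeff (euler v f * mfps_exp f) m"
    unfolding mfps_exp_conv_compose
    by (rule mcoeff_mult_compose[symmetric]) (use assms in auto)
  finally show "mcoeff (euler v (mfps_exp f)) m = mcoeff (euler v f * mfps_exp f) m" .
qed

lemma euler_var: "euler w (mfps_var v) = (if v = w then mfps_var v else 0)"
  by (rule mfps_eqI) (auto simp: mcoeff_euler mcoeff_var lookup_single)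

definition linear_form :: "('v \<Rightarrow>\<^sub>0 int) \<Rightarrow> ('v, 'a :: comm_ring_1) mfps" where
  "linear_form m = (\<Sum>v\<in>Poly_Mapping.keys m. of_int (Poly_Mapping.lookup m v) * mfps_var v)"

lemma mcoeff_linear_form_0 [simp]: "mcoeff (linear_form m) 0 = 0"
  by (simp add: linear_form_def mcoeff_sum mcoeff_of_int_mult)

lemma euler_linear_form: "euler v (linear_form m) = of_int (Poly_Mapping.lookup m v) * mfps_var v"
proof -
  have "euler v (linear_form m)
      = (\<Sum>w\<in>Poly_Mapping.keys m. if w = v then of_int (Poly_Mapping.lookup m v) * mfps_var v else 0)"
    unfolding linear_form_def euler_sum euler_of_int_mult euler_var by (rule sum.cong) auto
  then show ?thesis by (cases "Poly_Mapping.lookup m v = 0") (simp_all add: in_keys_iff)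
qed

lemma mfps_var_nonzero [simp]: "mfps_var v \<noteq> (0 :: ('v, 'a :: comm_ring_1) mfps)"
proof
  assume "mfps_var v = (0 :: ('v, 'a) mfps)"
  then have "mcoeff (mfps_var v :: ('v, 'a) mfps) (Poly_Mapping.single v 1) = 0" by simp
  then show False by (simp add: mcoeff_var)
qed

lemma mfps_var_eq_iff [simp]:
  "mfps_var v = (mfps_var w :: ('v, 'a :: comm_ring_1) mfps) \<longleftrightarrow> v = w"
proof
  assume "mfps_var v = (mfps_var w :: ('v, 'a) mfps)"
  then have "mcoeff (mfps_var w :: ('v, 'a) mfps) (Poly_Mapping.single v 1) = 1"
    by (metis mcoeff_var)
  then show "v = w" by (simp add: mcoeff_var split: if_splits)
qed simp

lemma mfps_exp_nonzero [simp]: "mfps_exp f \<noteq> 0"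
  by (metis mcoeff_exp_0 mcoeff_simps(1) zero_neq_one)

text \<open>
  The exponentials of linear forms are eigenvectors of all Euler operators over the ring of
  series, the eigenvalue at \<open>v\<close> being \<open>m\<^sub>v x\<^sub>v\<close>. As for eigenvectors of an endomorphism, applying
  \<open>euler v\<close> minus the eigenvalue of one member \<open>m0\<close> removes \<open>m0\<close> from a relation and multiplies
  the coefficient of \<open>m1\<close> by \<open>m1\<^sub>v - m0\<^sub>v\<close>, which is nonzero for a suitable \<open>v\<close>, and by the common
  factor \<open>x\<^sub>v\<close>, which can be cancelled.
\<close>

lemma exponentials_independent:
  fixes d :: "('v :: linorder \<Rightarrow>\<^sub>0 int) \<Rightarrow> int"
  assumes "finite S"
    and "(\<Sum>m\<in>S. of_int (d m) * mfps_exp (linear_form m)) = (0 :: ('v, 'a :: field_char_0) mfps)"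
  shows "\<forall>m\<in>S. d m = 0"
  using assms
proof (induction S arbitrary: d rule: finite_induct)
  case (insert m0 S)
  let ?E = "\<lambda>m. mfps_exp (linear_form m) :: ('v, 'a) mfps"
  have S: "d m1 = 0" if "m1 \<in> S" for m1
  proof -
    from that insert.hyps have "m1 \<noteq> m0" by blast
    then obtain v where v: "Poly_Mapping.lookup m1 v \<noteq> Poly_Mapping.lookup m0 v"
      by (metis poly_mapping_eqI)
    let ?ev = "\<lambda>m. of_int (Poly_Mapping.lookup m v) * mfps_var v :: ('v, 'a) mfps"
    have eigen: "euler v (of_int (d m) * ?E m) = ?ev m * (of_int (d m) * ?E m)" for m
      unfolding euler_of_int_mult by (simp add: euler_exp euler_linear_form algebra_simps)
    have "0 = euler v (\<Sum>m\<in>insert m0 S. of_int (d m) * ?E m)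
          - ?ev m0 * (\<Sum>m\<in>insert m0 S. of_int (d m) * ?E m)"
      unfolding insert.prems by (simp add: euler_0)
    also have "\<dots> = (\<Sum>m\<in>insert m0 S. (?ev m - ?ev m0) * (of_int (d m) * ?E m))"
      unfolding euler_sum eigen sum_distrib_left sum_subtractf[symmetric] left_diff_distrib ..
    also have "\<dots> = (\<Sum>m\<in>S. (?ev m - ?ev m0) * (of_int (d m) * ?E m))"
      by (subst sum.insert[OF insert.hyps]) simp
    also have "\<dots> = mfps_var v * (\<Sum>m\<in>S.
        of_int (d m * (Poly_Mapping.lookup m v - Poly_Mapping.lookup m0 v)) * ?E m)"
      unfolding sum_distrib_left of_int_mult of_int_diff
      by (rule sum.cong[OF refl]) (simp only: algebra_simps)
    finally have "mfps_var v * (\<Sum>m\<in>S.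
        of_int (d m * (Poly_Mapping.lookup m v - Poly_Mapping.lookup m0 v)) * ?E m) = 0" by (rule sym)
    then have "(\<Sum>m\<in>S. of_int (d m * (Poly_Mapping.lookup m v - Poly_Mapping.lookup m0 v)) * ?E m) = 0"
      by (simp only: mult_eq_0_iff mfps_var_nonzero simp_thms)
    from insert.IH[OF this] that v show ?thesis by auto
  qed
  have "of_int (d m0) * ?E m0 = (\<Sum>m\<in>insert m0 S. of_int (d m) * ?E m)"
    unfolding sum.insert[OF insert.hyps] by (simp add: S)
  then have "mcoeff (of_int (d m0) * ?E m0) 0 = 0"
    unfolding insert.prems by simp
  then have "d m0 = 0" unfolding mcoeff_of_int_mult by simp
  with S show ?case by blast
qed simp

section \<open>Fraction fields\<close>

lemma from_fract_to_fract [simp]: "from_fract (to_fract f) = f"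
  by (simp add: from_fract_def)

lemma to_fract_prod [simp]: "to_fract (prod f A) = (\<Prod>a\<in>A. to_fract (f a))"
  by (induction A rule: infinite_finite_induct) auto

lemma to_fract_power [simp]: "to_fract (x ^ n) = to_fract x ^ n"
  by (induction n) auto

lemma to_fract_of_nat [simp]: "to_fract (of_nat n) = of_nat n"
  by (induction n) auto

lemma to_fract_of_int [simp]: "to_fract (of_int n) = of_int n"
  by (cases n rule: int_diff_cases) auto

lemma fract_cases_to_fract:
  obtains n d where "q = to_fract n / to_fract d" "d \<noteq> 0"
  by (cases q) (auto simp: Fract_conv_to_fract)

definition field_hom :: "('k :: field \<Rightarrow> 'l :: field) \<Rightarrow> bool" where
  "field_hom F \<longleftrightarrow> (\<forall>x y. F (x + y) = F x + F y) \<and> (\<forall>x y. F (x * y) = F x * F y) \<and> F 1 = 1"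

context
  fixes F :: "'k :: field \<Rightarrow> 'l :: field"
  assumes F: "field_hom F"
begin

lemma field_hom_add: "F (x + y) = F x + F y" and field_hom_mult: "F (x * y) = F x * F y"
  and field_hom_1: "F 1 = 1"
  using F by (auto simp: field_hom_def)

lemma field_hom_0: "F 0 = 0"
  using field_hom_add[of 0 0] by (metis add_0_right add_left_imp_eq)

lemma field_hom_diff: "F (x - y) = F x - F y"
  using field_hom_add[of "x - y" y] by (simp add: algebra_simps)

lemma field_hom_inverse: "F (inverse x) = inverse (F x)"
proof (cases "x = 0")
  case False
  then have "F x * F (inverse x) = 1"
    by (simp add: field_hom_mult[symmetric] field_hom_1)
  then show ?thesis by (metis inverse_unique)
qed (simp add: field_hom_0)

lemma field_hom_divide: "F (x / y) = F x / F y"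
  by (simp add: divide_inverse field_hom_mult field_hom_inverse)

lemma field_hom_power: "F (x ^ n) = F x ^ n"
  by (induction n) (auto simp: field_hom_1 field_hom_mult)

lemma field_hom_power_int: "F (x powi n) = F x powi n"
  by (cases n rule: int_cases4) (auto simp: field_hom_power power_int_minus field_hom_inverse)

lemma field_hom_sum: "F (sum f A) = (\<Sum>a\<in>A. F (f a))"
  by (induction A rule: infinite_finite_induct) (auto simp: field_hom_0 field_hom_add)

lemma field_hom_prod: "F (prod f A) = (\<Prod>a\<in>A. F (f a))"
  by (induction A rule: infinite_finite_induct) (auto simp: field_hom_1 field_hom_mult)

lemma field_hom_of_nat: "F (of_nat n) = of_nat n"
  by (induction n) (auto simp: field_hom_1 field_hom_0 field_hom_add)

lemma field_hom_of_int: "F (of_int n) = of_int n"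
  by (cases n rule: int_diff_cases) (simp add: field_hom_diff field_hom_of_nat)

lemmas field_hom_simps = field_hom_add field_hom_mult field_hom_1 field_hom_0 field_hom_diff
  field_hom_inverse field_hom_divide field_hom_power field_hom_power_int field_hom_sum
  field_hom_prod field_hom_of_nat field_hom_of_int

end

text \<open>
  The universal property of the fraction field.
\<close>

lemma fract_extension:
  fixes h :: "'a :: idom \<Rightarrow> 'k :: field"
  assumes add: "\<And>x y. h (x + y) = h x + h y" and mult: "\<And>x y. h (x * y) = h x * h y"
    and one: "h 1 = 1" and inj: "\<And>x. h x = 0 \<Longrightarrow> x = 0"
  obtains F where "field_hom F" "\<And>x. F (to_fract x) = h x"
proof
  define F where "F q = (SOME y. \<exists>n d. d \<noteq> 0 \<and> q = to_fract n / to_fract d \<and> y = h n / h d)" for q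
  have nz: "h x \<noteq> 0" if "x \<noteq> 0" for x using inj that by blast
  have F: "F (to_fract n / to_fract d) = h n / h d" if d: "d \<noteq> 0" for n d
  proof -
    have "\<exists>y n' d'. d' \<noteq> 0 \<and> to_fract n / to_fract d = to_fract n' / to_fract d' \<and> y = h n' / h d'"
      using d by blast
    from someI_ex[OF this] obtain n' d' where d': "d' \<noteq> 0"
      "to_fract n / to_fract d = to_fract n' / to_fract d'" "F (to_fract n / to_fract d) = h n' / h d'"
      unfolding F_def by blast
    from d d' have "to_fract (n * d') = to_fract (n' * d)"
      by (simp add: frac_eq_eq)
    then have "n * d' = n' * d" by (simp only: to_fract_eq_iff)
    then have "h n * h d' = h n' * h d" by (simp add: mult[symmetric])
    with d d' show ?thesis by (simp add: frac_eq_eq nz)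
  qed
  show to: "F (to_fract x) = h x" for x
    using F[of 1 x] one by simp
  show "field_hom F"
    unfolding field_hom_def
  proof safe
    fix p q :: "'a fract"
    obtain a b c d where p: "p = to_fract a / to_fract b" and q: "q = to_fract c / to_fract d"
      and nz': "b \<noteq> 0" "d \<noteq> 0"
      by (metis fract_cases_to_fract)
    have "p + q = to_fract (a * d + c * b) / to_fract (b * d)"
      using nz' by (simp add: p q add_frac_eq)
    then have "F (p + q) = h (a * d + c * b) / h (b * d)"
      by (simp only:) (rule F, use nz' in simp)
    then show "F (p + q) = F p + F q"
      using nz' by (simp add: p q F add mult add_frac_eq nz)
    have "p * q = to_fract (a * c) / to_fract (b * d)"
      by (simp add: p q)
    then have "F (p * q) = h (a * c) / h (b * d)"
      by (simp only:) (rule F, use nz' in simp)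
    then show "F (p * q) = F p * F q"
      using nz' by (simp add: p q F mult)
    show "F 1 = 1" using to[of 1] one by simp
  qed
qed

section \<open>Evaluation of Laurent polynomials\<close>

definition monomial_eval :: "('v \<Rightarrow> 'k :: field) \<Rightarrow> ('v \<Rightarrow>\<^sub>0 int) \<Rightarrow> 'k" where
  "monomial_eval u m = (\<Prod>v\<in>Poly_Mapping.keys m. u v powi Poly_Mapping.lookup m v)"

lemma laurent_eval_monomials:
  "laurent_eval u f = (\<Sum>m\<in>Poly_Mapping.keys f. of_int (Poly_Mapping.lookup f m) * monomial_eval u m)"
  by (simp add: laurent_eval_def monomial_eval_def)

lemma monomial_eval_superset:
  assumes "Poly_Mapping.keys m \<subseteq> S" "finite S"
  shows "monomial_eval u m = (\<Prod>v\<in>S. u v powi Poly_Mapping.lookup m v)"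
  unfolding monomial_eval_def
  by (rule prod.mono_neutral_left) (use assms in \<open>auto simp: in_keys_iff\<close>)

lemma monomial_eval_add:
  assumes "\<And>v. u v \<noteq> 0"
  shows "monomial_eval u (k + l) = monomial_eval u k * monomial_eval u l"
proof -
  let ?S = "Poly_Mapping.keys k \<union> Poly_Mapping.keys l"
  have "monomial_eval u (k + l) = (\<Prod>v\<in>?S. u v powi Poly_Mapping.lookup (k + l) v)"
    by (rule monomial_eval_superset[OF Poly_Mapping.keys_add]) simp
  also have "\<dots> = monomial_eval u k * monomial_eval u l"
    using assms
    by (simp add: lookup_add power_int_add prod.distrib monomial_eval_superset[where S = ?S])
  finally show ?thesis .
qed

lemma laurent_eval_superset:
  assumes "Poly_Mapping.keys f \<subseteq> S" "finite S"
  shows "laurent_eval u f = (\<Sum>m\<in>S. of_int (Poly_Mapping.lookup f m) * monomial_eval u m)"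
  unfolding laurent_eval_monomials
  by (rule sum.mono_neutral_left) (use assms in \<open>auto simp: in_keys_iff\<close>)

lemma laurent_eval_0 [simp]: "laurent_eval u 0 = 0"
  by (simp add: laurent_eval_def)

lemma laurent_eval_add: "laurent_eval u (f + g) = laurent_eval u f + laurent_eval u g"
proof -
  let ?S = "Poly_Mapping.keys f \<union> Poly_Mapping.keys g"
  have "laurent_eval u (f + g) = (\<Sum>m\<in>?S. of_int (Poly_Mapping.lookup (f + g) m) * monomial_eval u m)"
    by (rule laurent_eval_superset[OF Poly_Mapping.keys_add]) simp
  also have "\<dots> = laurent_eval u f + laurent_eval u g"
    by (simp add: lookup_add sum.distrib distrib_right laurent_eval_superset[where S = ?S])
  finally show ?thesis .
qed

lemma laurent_eval_diff: "laurent_eval u (f - g) = laurent_eval u f - laurent_eval u g"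
  using laurent_eval_add[of u "f - g" g] by (simp add: algebra_simps)

lemma laurent_eval_sum: "laurent_eval u (sum f A) = (\<Sum>a\<in>A. laurent_eval u (f a))"
  by (induction A rule: infinite_finite_induct) (auto simp: laurent_eval_add)

lemma laurent_eval_single: "laurent_eval u (Poly_Mapping.single m c) = of_int c * monomial_eval u m"
  by (simp add: laurent_eval_monomials)

lemma laurent_eval_1: "laurent_eval u 1 = 1"
  by (simp add: laurent_eval_single monomial_eval_def flip: single_one)

lemma poly_mapping_sum_single:
  "f = (\<Sum>k\<in>Poly_Mapping.keys f. Poly_Mapping.single k (Poly_Mapping.lookup f k))"
  by (rule poly_mapping_eqI) (auto simp: lookup_sum lookup_single when_def in_keys_iff)

lemma laurent_eval_mult:
  assumes "\<And>v. u v \<noteq> 0"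
  shows "laurent_eval u (f * g) = laurent_eval u f * laurent_eval u g"
proof -
  have "f * g = (\<Sum>k\<in>Poly_Mapping.keys f. Poly_Mapping.single k (Poly_Mapping.lookup f k)) *
      (\<Sum>l\<in>Poly_Mapping.keys g. Poly_Mapping.single l (Poly_Mapping.lookup g l))"
    using poly_mapping_sum_single[of f] poly_mapping_sum_single[of g] by simp
  also have "laurent_eval u \<dots> = laurent_eval u f * laurent_eval u g"
    unfolding sum_product laurent_eval_sum mult_single laurent_eval_single monomial_eval_add[OF assms]
    by (simp add: laurent_eval_monomials sum_product mult_ac)
  finally show ?thesis .
qed

lemma laurent_eval_var: "laurent_eval u (laurent_var v) = u v"
  by (simp add: laurent_var_def laurent_eval_single monomial_eval_def)

lemma laurent_eval_cong:
  assumes "\<And>m v. m \<in> Poly_Mapping.keys f \<Longrightarrow> v \<in> Poly_Mapping.keys m \<Longrightarrow> u v = u' v"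
  shows "laurent_eval u f = laurent_eval u' f"
  unfolding laurent_eval_def using assms by (auto intro!: sum.cong prod.cong)

lemma field_hom_laurent_eval:
  assumes "field_hom F"
  shows "F (laurent_eval u f) = laurent_eval (\<lambda>v. F (u v)) f"
  by (simp add: laurent_eval_def field_hom_simps[OF assms])

lemma inj_map_key:
  fixes \<phi> :: "'v \<Rightarrow> 'v"
  assumes "bij \<phi>"
  shows "inj (Poly_Mapping.map_key \<phi> :: ('v \<Rightarrow>\<^sub>0 'c :: zero) \<Rightarrow> _)"
proof (rule injI, rule poly_mapping_eqI)
  fix k l :: "'v \<Rightarrow>\<^sub>0 'c" and v
  assume *: "Poly_Mapping.map_key \<phi> k = Poly_Mapping.map_key \<phi> l"
  obtain w where w: "v = \<phi> w" using assms by (metis bij_pointE)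
  show "Poly_Mapping.lookup k v = Poly_Mapping.lookup l v"
    unfolding w using arg_cong[OF *, of "\<lambda>m. Poly_Mapping.lookup m w"] assms
    by (simp add: lookup_map_key bij_is_inj)
qed

lemma surj_map_key:
  fixes \<phi> :: "'v \<Rightarrow> 'v"
  assumes "bij \<phi>"
  shows "surj (Poly_Mapping.map_key \<phi> :: ('v \<Rightarrow>\<^sub>0 'c :: zero) \<Rightarrow> _)"
proof (rule surjI)
  fix m :: "'v \<Rightarrow>\<^sub>0 'c"
  have "inj \<phi>" "inj (inv_into UNIV \<phi>)" "inv_into UNIV \<phi> \<circ> \<phi> = (\<lambda>v. v)"
    using assms by (auto simp: bij_is_inj bij_imp_bij_inv fun_eq_iff)
  then show "Poly_Mapping.map_key \<phi> (Poly_Mapping.map_key (inv_into UNIV \<phi>) m) = m"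
    by (simp add: map_key_compose map_key_id id_def)
qed

lemma monomial_eval_map_key:
  assumes "bij \<phi>"
  shows "monomial_eval (u \<circ> \<phi>) (Poly_Mapping.map_key \<phi> m) = monomial_eval u m"
proof -
  have "monomial_eval (u \<circ> \<phi>) (Poly_Mapping.map_key \<phi> m)
      = (\<Prod>v\<in>\<phi> -` Poly_Mapping.keys m. u (\<phi> v) powi Poly_Mapping.lookup m (\<phi> v))"
    using assms by (simp add: monomial_eval_def keys_map_key bij_is_inj lookup_map_key)
  also have "\<dots> = monomial_eval u m"
    unfolding monomial_eval_def
    by (rule prod.reindex_bij_betw) (use assms in \<open>auto simp: bij_betw_def inj_on_def bij_def inj_def\<close>)
  finally show ?thesis .
qed

text \<open>
  The substitution \<open>z\<^sub>v \<mapsto> z\<^bsub>\<phi> v\<^esub>\<close> for a bijection \<open>\<phi>\<close>. With this definition, the invariance demanded of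
  the elements of the K-theoretical algebra reads \<open>laurent_rename \<pi> f = f\<close>.
\<close>

definition laurent_rename :: "('v \<Rightarrow> 'v) \<Rightarrow> 'v laurent \<Rightarrow> 'v laurent" where
  "laurent_rename \<phi> = Poly_Mapping.map_key (Poly_Mapping.map_key \<phi>)"

lemma lookup_laurent_rename:
  "bij \<phi> \<Longrightarrow> Poly_Mapping.lookup (laurent_rename \<phi> f) m = Poly_Mapping.lookup f (Poly_Mapping.map_key \<phi> m)"
  by (simp add: laurent_rename_def lookup_map_key inj_map_key)

lemma laurent_eval_rename:
  assumes "bij \<phi>"
  shows "laurent_eval u (laurent_rename \<phi> f) = laurent_eval (u \<circ> \<phi>) f"
proof -
  let ?K = "Poly_Mapping.map_key \<phi> :: ('a \<Rightarrow>\<^sub>0 int) \<Rightarrow> _"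
  have "laurent_eval u (laurent_rename \<phi> f)
      = (\<Sum>m\<in>?K -` Poly_Mapping.keys f. of_int (Poly_Mapping.lookup f (?K m)) * monomial_eval (u \<circ> \<phi>) (?K m))"
    by (simp add: laurent_eval_monomials lookup_laurent_rename[OF assms] monomial_eval_map_key[OF assms])
       (simp add: laurent_rename_def keys_map_key inj_map_key[OF assms])
  also have "\<dots> = laurent_eval (u \<circ> \<phi>) f"
    unfolding laurent_eval_monomials
    by (rule sum.reindex_bij_betw)
       (use inj_map_key[OF assms] surj_map_key[OF assms] in \<open>auto simp: bij_betw_def inj_on_def inj_def\<close>)
  finally show ?thesis .
qed

lemma laurent_rename_eq_0:
  fixes f :: "'v laurent"
  assumes "bij \<phi>" "laurent_rename \<phi> f = 0"
  shows "f = 0"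
proof (rule poly_mapping_eqI)
  fix m :: "'v \<Rightarrow>\<^sub>0 int"
  obtain k :: "'v \<Rightarrow>\<^sub>0 int" where "m = Poly_Mapping.map_key \<phi> k"
    using surj_map_key[OF assms(1)] by (metis surjD)
  then show "Poly_Mapping.lookup f m = Poly_Mapping.lookup 0 m"
    using assms lookup_laurent_rename[of \<phi> f k] by simp
qed

section \<open>Divisibility by a difference of two variables\<close>

abbreviation generic_point :: "'v :: linorder \<Rightarrow> 'v laurent fract" where
  "generic_point v \<equiv> to_fract (laurent_var v)"

lemma laurent_var_neq_0 [simp]: "laurent_var v \<noteq> 0"
  unfolding laurent_var_def by (metis lookup_single_eq lookup_zero zero_neq_one)

lemma laurent_var_eq_iff [simp]: "laurent_var v = laurent_var w \<longleftrightarrow> v = w"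
proof
  assume "laurent_var v = laurent_var w"
  then have "laurent_eval (\<lambda>x. if x = v then 1 else 0 :: rat) (laurent_var v)
      = laurent_eval (\<lambda>x. if x = v then 1 else 0) (laurent_var w)"
    by (rule arg_cong)
  then show "v = w" by (simp add: laurent_eval_var split: if_splits)
qed simp

lemma inverse_generic_point:
  "inverse (generic_point v) = to_fract (Poly_Mapping.single (Poly_Mapping.single v (-1)) 1)"
proof -
  have "laurent_var v * Poly_Mapping.single (Poly_Mapping.single v (-1)) 1 = 1"
    by (simp add: laurent_var_def mult_single flip: single_add)
  then have "generic_point v * to_fract (Poly_Mapping.single (Poly_Mapping.single v (-1)) 1) = 1"
    by (metis to_fract_mult to_fract_1)
  then show ?thesis by (rule inverse_unique)
qed

lemma to_fract_single:
  "to_fract (Poly_Mapping.single m c) = of_int c * monomial_eval generic_point m"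
  for m :: "'v :: linorder \<Rightarrow>\<^sub>0 int" and c :: int
proof -
  let ?s = "\<lambda>m. Poly_Mapping.single m 1 :: 'v laurent"
  have s_add: "?s (k + l) = ?s k * ?s l" for k l
    by (simp add: mult_single)
  have s_nat: "?s (Poly_Mapping.single v (int n)) = laurent_var v ^ n" for v n
  proof (induction n)
    case (Suc n)
    have "Poly_Mapping.single v (int (Suc n)) = Poly_Mapping.single v 1 + Poly_Mapping.single v (int n)"
      by (simp flip: single_add)
    then show ?case
      using Suc by (simp add: s_add laurent_var_def)
  qed simp
  have pos: "to_fract (?s (Poly_Mapping.single v k)) = generic_point v powi k" for v k
  proof (cases k rule: int_cases2)
    case (nonneg n)
    then show ?thesis using s_nat by simp
  next
    case (nonpos n)
    have "?s (Poly_Mapping.single v (int n)) * ?s (Poly_Mapping.single v k) = 1"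
      by (simp add: nonpos flip: s_add single_add)
    then have "generic_point v ^ n * to_fract (?s (Poly_Mapping.single v k)) = 1"
      by (metis s_nat to_fract_mult to_fract_1 to_fract_power)
    then show ?thesis
      using nonpos by (metis inverse_unique power_int_minus power_int_of_nat)
  qed
  have "to_fract (?s (\<Sum>v\<in>A. Poly_Mapping.single v (Poly_Mapping.lookup m v)))
      = (\<Prod>v\<in>A. generic_point v powi Poly_Mapping.lookup m v)" if "finite A" for A
    using that
    by (induction A rule: finite_induct) (simp_all add: s_add pos)
  from this[of "Poly_Mapping.keys m"] have "to_fract (?s m) = monomial_eval generic_point m"
    by (simp add: monomial_eval_def flip: poly_mapping_sum_single)
  moreover have "Poly_Mapping.single m c = of_int c * ?s m"
    by (simp add: mult_single flip: single_of_int)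
  ultimately show ?thesis by simp
qed

lemma laurent_eval_generic: "laurent_eval generic_point f = to_fract f"
proof -
  have "laurent_eval generic_point f
      = to_fract (\<Sum>m\<in>Poly_Mapping.keys f. Poly_Mapping.single m (Poly_Mapping.lookup f m))"
    by (simp add: laurent_eval_monomials to_fract_single)
  then show ?thesis by (simp flip: poly_mapping_sum_single)
qed

text \<open>
  Modulo \<open>z\<^sub>v - z\<^sub>w\<close> the points \<open>z\<close> and \<open>z(v := z\<^sub>w)\<close> agree, together with their inverses; hence so do the
  values of \<open>f\<close> at them. The congruence is formed inside the fraction field, where evaluation
  takes its values, but with integral cofactor.
\<close>

lemma laurent_var_diff_dvd:
  assumes "laurent_eval (generic_point(v := generic_point w)) f = 0"
  shows "laurent_var v - laurent_var w dvd f"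
proof -
  define R where "R = range (to_fract :: 'a laurent \<Rightarrow> _)"
  define d where "d = generic_point v - generic_point w"
  define cong where "cong x y \<longleftrightarrow> x \<in> R \<and> y \<in> R \<and> (\<exists>r\<in>R. x - y = d * r)" for x y
  have R_mult: "x * y \<in> R" and R_add: "x + y \<in> R" if "x \<in> R" "y \<in> R" for x y
    using that by (auto simp: R_def simp flip: to_fract_mult to_fract_add)
  have R_of_int: "of_int c \<in> R" for c
    unfolding R_def by (metis rangeI to_fract_of_int)
  have R_1: "1 \<in> R" using R_of_int[of 1] by simp
  have R_var: "generic_point u \<in> R" "inverse (generic_point u) \<in> R" for u
    by (auto simp: R_def inverse_generic_point)
  have refl: "cong x x" if "x \<in> R" for x
    unfolding cong_def using that R_of_int[of 0] by (auto intro!: bexI[of _ 0])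
  have mult: "cong (x * x') (y * y')" if "cong x y" "cong x' y'" for x y x' y'
  proof -
    from that obtain r r' where r: "r \<in> R" "r' \<in> R" "x - y = d * r" "x' - y' = d * r'"
      and m: "x \<in> R" "y \<in> R" "x' \<in> R" "y' \<in> R"
      by (auto simp: cong_def)
    have "x * x' - y * y' = (x - y) * x' + y * (x' - y')" by (simp add: algebra_simps)
    also have "\<dots> = d * (r * x' + y * r')" by (simp add: r(3,4) algebra_simps)
    finally show ?thesis unfolding cong_def
      by (intro conjI bexI[of _ "r * x' + y * r'"]) (simp_all add: R_mult R_add r(1,2) m)
  qed
  have add: "cong (x + x') (y + y')" if "cong x y" "cong x' y'" for x y x' y'
  proof -
    from that obtain r r' where r: "r \<in> R" "r' \<in> R" "x - y = d * r" "x' - y' = d * r'"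
      and m: "x \<in> R" "y \<in> R" "x' \<in> R" "y' \<in> R"
      by (auto simp: cong_def)
    have "(x + x') - (y + y') = (x - y) + (x' - y')" by simp
    also have "\<dots> = d * (r + r')" by (simp add: r(3,4) algebra_simps)
    finally show ?thesis unfolding cong_def
      by (intro conjI bexI[of _ "r + r'"]) (simp_all add: R_add r(1,2) m)
  qed
  let ?z = "generic_point(v := generic_point w)"
  have var: "cong (generic_point u) (?z u)" for u
  proof (cases "u = v")
    case True
    then show ?thesis
      unfolding cong_def d_def by (auto simp: R_var R_1 intro!: bexI[of _ 1])
  next
    case False
    then show ?thesis by (simp add: refl R_var)
  qed
  have inv: "cong (inverse (generic_point u)) (inverse (?z u))" for u
  proof (cases "u = v")
    case True
    have "inverse (generic_point v) - inverse (generic_point w)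
        = d * (of_int (-1) * (inverse (generic_point v) * inverse (generic_point w)))"
      by (simp add: d_def field_simps)
    moreover have "of_int (-1) * (inverse (generic_point v) * inverse (generic_point w)) \<in> R"
      by (intro R_mult R_of_int R_var)
    ultimately show ?thesis
      using True R_var unfolding cong_def by (simp only: fun_upd_same simp_thms) blast
  qed (auto intro: refl R_var)
  have pow: "cong (x ^ n) (y ^ n)" if "cong x y" for x y n
    by (induction n) (auto intro: mult that refl R_1)
  have powi: "cong (generic_point u powi n) (?z u powi n)" for u n
    unfolding power_int_def using pow[OF var] pow[OF inv] by auto
  have prod: "cong (prod F A) (prod G A)" if "\<And>a. cong (F a) (G a)"
    for F G :: "'a \<Rightarrow> 'a laurent fract" and A
    by (induction A rule: infinite_finite_induct) (simp_all add: refl R_1 mult that)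
  have "cong (monomial_eval generic_point m) (monomial_eval ?z m)" for m
    unfolding monomial_eval_def by (rule prod, rule powi)
  then have monomial: "cong (of_int c * monomial_eval generic_point m) (of_int c * monomial_eval ?z m)" for c m
    by (intro mult refl R_of_int)
  have sum: "cong (sum F A) (sum G A)" if "\<And>a. cong (F a) (G a)"
    for F G :: "('a \<Rightarrow>\<^sub>0 int) \<Rightarrow> 'a laurent fract" and A
    using R_of_int[of 0]
    by (induction A rule: infinite_finite_induct) (simp_all add: refl add that)
  have "cong (laurent_eval generic_point f) (laurent_eval ?z f)"
    unfolding laurent_eval_monomials by (rule sum, rule monomial)
  then obtain r where "r \<in> R" "to_fract f - 0 = d * r"
    unfolding cong_def laurent_eval_generic assms by blast
  then obtain q where "to_fract f = to_fract ((laurent_var v - laurent_var w) * q)"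
    by (auto simp: R_def d_def)
  then show ?thesis by (metis dvd_triv_left to_fract_eq_iff)
qed

lemma laurent_var_diff_dvd_iff:
  "laurent_var v - laurent_var w dvd f \<longleftrightarrow> laurent_eval (generic_point(v := generic_point w)) f = 0"
proof
  assume "laurent_var v - laurent_var w dvd f"
  then obtain q where q: "f = (laurent_var v - laurent_var w) * q" by blast
  show "laurent_eval (generic_point(v := generic_point w)) f = 0"
    unfolding q by (subst laurent_eval_mult) (auto simp: laurent_eval_diff laurent_eval_var)
qed (rule laurent_var_diff_dvd)

text \<open>
  Evaluation at \<open>z(v := z\<^sub>w)\<close> is a ring homomorphism to a field with the multiples of \<open>z\<^sub>v - z\<^sub>w\<close> as its
  kernel.
\<close>

lemma prime_elem_laurent_var_diff:
  fixes v w :: "'v :: linorder"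
  assumes "v \<noteq> w"
  shows "prime_elem (laurent_var v - laurent_var w)"
proof (rule prime_elemI)
  show "laurent_var v - laurent_var w \<noteq> 0" using assms by simp
  show "\<not> laurent_var v - laurent_var w dvd 1"
    by (simp add: laurent_var_diff_dvd_iff laurent_eval_1)
  fix f g assume "laurent_var v - laurent_var w dvd f * g"
  moreover have "(generic_point(v := generic_point w)) u \<noteq> 0" for u by simp
  ultimately show "laurent_var v - laurent_var w dvd f \<or> laurent_var v - laurent_var w dvd g"
    by (simp add: laurent_var_diff_dvd_iff laurent_eval_mult)
qed

text \<open>
  A replacement for unique factorisation: split off one prime at a time; it does not divide the
  product of the others and must therefore divide the cofactor.
\<close>

lemma prod_primes_dvd:
  fixes p :: "'b \<Rightarrow> 'a :: idom"
  assumes "finite A" "\<And>a. a \<in> A \<Longrightarrow> prime_elem (p a)" "\<And>a. a \<in> A \<Longrightarrow> p a dvd f"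
    and "\<And>a b. a \<in> A \<Longrightarrow> b \<in> A \<Longrightarrow> a \<noteq> b \<Longrightarrow> \<not> p a dvd p b"
  shows "prod p A dvd f"
  using assms
proof (induction A rule: finite_induct)
  case (insert a A)
  then have "prod p A dvd f" by auto
  then obtain g where g: "f = prod p A * g" by blast
  have "\<not> p a dvd prod p A"
  proof
    have "\<exists>b\<in>B. p a dvd p b" if "finite B" "p a dvd prod p B" for B
      using that
    proof (induction B rule: finite_induct)
      case empty
      with insert.prems(1)[of a] show ?case by (auto simp: prime_elem_def)
    next
      case (insert b B)
      then have "p a dvd p b \<or> p a dvd prod p B"
        using \<open>\<And>a'. a' \<in> Set.insert a A \<Longrightarrow> prime_elem (p a')\<close> by (auto dest: prime_elem_dvd_multD)
      with insert.IH show ?case by blast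
    qed
    moreover assume "p a dvd prod p A"
    ultimately obtain b where "b \<in> A" "p a dvd p b" using insert.hyps by blast
    with insert show False by (metis insertCI)
  qed
  moreover have "p a dvd prod p A * g" "prime_elem (p a)" using insert.prems g by auto
  ultimately have "p a dvd g" by (auto dest: prime_elem_dvd_multD)
  then show ?case using insert.hyps g by (auto simp: mult_ac intro: mult_dvd_mono)
qed simp

section \<open>The Chern character\<close>

abbreviation exp_point :: "'v \<Rightarrow> ('v :: linorder, rat) mfps fract" where
  "exp_point v \<equiv> to_fract (mfps_exp (mfps_var v))"

lemma inverse_to_fract_exp:
  fixes f :: "('v :: linorder, 'a :: field_char_0) mfps"
  assumes "mcoeff f 0 = 0"
  shows "inverse (to_fract (mfps_exp f)) = to_fract (mfps_exp (- f))"
  using mfps_exp_minus[OF assms] by (metis inverse_unique to_fract_1 to_fract_mult)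

lemma to_fract_exp_of_int_mult:
  fixes f :: "('v :: linorder, 'a :: field_char_0) mfps"
  assumes "mcoeff f 0 = 0"
  shows "to_fract (mfps_exp (of_int k * f)) = to_fract (mfps_exp f) powi k"
proof -
  have nat: "mfps_exp (of_nat n * f) = mfps_exp f ^ n" for n
    by (induction n) (auto simp: distrib_right mfps_exp_add assms mcoeff_of_nat_mult)
  show ?thesis
  proof (cases k rule: int_cases2)
    case (nonneg n)
    then show ?thesis by (simp add: nat)
  next
    case (nonpos n)
    have "to_fract (mfps_exp (of_int k * f)) = inverse (to_fract (mfps_exp (of_nat n * f)))"
      by (simp add: inverse_to_fract_exp mcoeff_of_nat_mult assms nonpos)
    then show ?thesis by (simp add: nat nonpos power_int_minus)
  qed
qed

lemma monomial_eval_exp: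
  fixes x :: "'v \<Rightarrow> ('w :: linorder, 'a :: field_char_0) mfps"
  assumes "\<And>v. mcoeff (x v) 0 = 0"
  shows "monomial_eval (\<lambda>v. to_fract (mfps_exp (x v))) m
    = to_fract (mfps_exp (\<Sum>v\<in>Poly_Mapping.keys m. of_int (Poly_Mapping.lookup m v) * x v))"
  by (subst mfps_exp_sum)
     (auto simp: assms mcoeff_of_int_mult monomial_eval_def to_fract_exp_of_int_mult)

text \<open>
  Laurent monomials in the \<open>e\<^sup>x\<close> are exponentials of integral linear forms. Hence the value lies in the ring
  of series and the Chern character is given by an explicit sum.
\<close>

lemma laurent_eval_exp_point:
  "laurent_eval exp_point f = to_fract
    (\<Sum>m\<in>Poly_Mapping.keys f. of_int (Poly_Mapping.lookup f m) * mfps_exp (linear_form m))"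
  by (simp add: laurent_eval_monomials monomial_eval_exp linear_form_def)

lemma chern_eq_sum:
  "chern f = (\<Sum>m\<in>Poly_Mapping.keys f. of_int (Poly_Mapping.lookup f m) * mfps_exp (linear_form m))"
  unfolding chern_def laurent_eval_exp_point by (rule from_fract_to_fract)

lemma to_fract_chern: "to_fract (chern f) = laurent_eval exp_point f"
  unfolding chern_eq_sum laurent_eval_exp_point ..

lemma laurent_eval_exp_point_eq_0:
  assumes "laurent_eval exp_point f = 0"
  shows "f = 0"
proof -
  have "\<forall>m\<in>Poly_Mapping.keys f. Poly_Mapping.lookup f m = 0"
    using assms unfolding laurent_eval_exp_point
    by (intro exponentials_independent) (simp_all only: to_fract_eq_0_iff finite_keys)
  then have "Poly_Mapping.keys f = {}"
    by (metis in_keys_iff equals0I)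
  then show ?thesis by simp
qed

lemma chern_0 [simp]: "chern 0 = 0"
  by (simp add: chern_eq_sum)

lemma chern_add: "chern (f + g) = chern f + chern g"
  by (simp add: to_fract_chern laurent_eval_add flip: to_fract_eq_iff)

lemma chern_1: "chern 1 = 1"
  by (simp add: to_fract_chern laurent_eval_1 flip: to_fract_eq_iff)

lemma inj_chern: "inj (chern :: 'i :: {finite, linorder} var laurent \<Rightarrow> _)"
proof (rule injI)
  fix f g :: "'i var laurent"
  assume "chern f = chern g"
  then have "laurent_eval exp_point f = laurent_eval exp_point g"
    by (simp flip: to_fract_chern)
  then have "laurent_eval exp_point (f - g) = 0"
    by (simp add: laurent_eval_diff)
  then show "f = g" using laurent_eval_exp_point_eq_0[of "f - g"] by simp
qed

text \<open>
  This covers renamings of the variables and, with \<open>\<phi>\<close> the identity, the restriction to a set of variables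
  that contains those of \<open>f\<close>.
\<close>

lemma exp_hom_chern:
  assumes r: "exp_hom r"
    and "\<And>m v. m \<in> Poly_Mapping.keys f \<Longrightarrow> v \<in> Poly_Mapping.keys m \<Longrightarrow> r (mfps_var v) = mfps_var (\<phi> v)"
  shows "to_fract (r (chern f)) = laurent_eval (\<lambda>v. exp_point (\<phi> v)) f"
  by (simp add: chern_eq_sum exp_hom_simps[OF r] assms(2) linear_form_def
      laurent_eval_monomials monomial_eval_exp cong: sum.cong)

section \<open>Products over pairs of variables\<close>

lemma vars_eq_Sigma: "vars \<gamma> = Sigma UNIV (\<lambda>i. {1..nat (\<gamma> $ i)})"
  by (auto simp: vars_def)

lemma finite_vars [simp]: "finite (vars \<gamma>)"
  by (simp add: vars_eq_Sigma)

lemma prod_vars: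
  "(\<Prod>i\<in>UNIV. \<Prod>\<alpha>=1..nat (\<gamma> $ i). F i \<alpha>) = (\<Prod>v\<in>vars \<gamma>. F (fst v) (snd v))"
  by (simp add: vars_eq_Sigma prod.Sigma case_prod_beta)

lemma sum_vars_fst:
  fixes F :: "'i :: finite \<Rightarrow> nat"
  shows "(\<Sum>v\<in>vars \<gamma>. F (fst v)) = (\<Sum>i\<in>UNIV. nat (\<gamma> $ i) * F i)"
proof -
  have "(\<Sum>v\<in>vars \<gamma>. F (fst v)) = (\<Sum>i\<in>UNIV. \<Sum>\<alpha>=1..nat (\<gamma> $ i). F i)"
    unfolding vars_eq_Sigma by (subst sum.Sigma) (auto simp: case_prod_beta)
  then show ?thesis by simp
qed

lemma prod_vars_times_vars:
  "(\<Prod>i\<in>UNIV. \<Prod>j\<in>UNIV. \<Prod>\<alpha>=1..nat (\<mu> $ i). \<Prod>\<beta>=1..nat (\<nu> $ j). F i j \<alpha> \<beta>)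
    = (\<Prod>(v, w)\<in>vars \<mu> \<times> vars \<nu>. F (fst v) (fst w) (snd v) (snd w))"
proof -
  have "(\<Prod>i\<in>UNIV. \<Prod>j\<in>UNIV. \<Prod>\<alpha>=1..nat (\<mu> $ i). \<Prod>\<beta>=1..nat (\<nu> $ j). F i j \<alpha> \<beta>)
      = (\<Prod>i\<in>UNIV. \<Prod>\<alpha>=1..nat (\<mu> $ i). \<Prod>j\<in>UNIV. \<Prod>\<beta>=1..nat (\<nu> $ j). F i j \<alpha> \<beta>)"
    by (intro prod.cong refl prod.swap)
  also have "\<dots> = (\<Prod>v\<in>vars \<mu>. \<Prod>w\<in>vars \<nu>. F (fst v) (fst w) (snd v) (snd w))"
    by (simp only: prod_vars)
  finally show ?thesis by (simp only: prod.cartesian_product)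
qed

definition pair_prod ::
  "('i :: {finite, linorder} \<Rightarrow> 'i \<Rightarrow> nat) \<Rightarrow> 'i dimvec \<Rightarrow> ('i var \<Rightarrow> 'k) \<Rightarrow> 'k :: comm_ring_1" where
  "pair_prod e \<gamma> x = (\<Prod>(v, w) | v \<in> vars \<gamma> \<and> w \<in> vars \<gamma> \<and> v < w. (x w - x v) ^ e (fst v) (fst w))"

definition cross_prod ::
  "('i :: finite \<Rightarrow> 'i \<Rightarrow> nat) \<Rightarrow> 'i dimvec \<Rightarrow> 'i dimvec \<Rightarrow> ('i var \<Rightarrow> 'k) \<Rightarrow> ('i var \<Rightarrow> 'k) \<Rightarrow> 'k :: comm_ring_1" where
  "cross_prod e \<mu> \<nu> x' x'' = (\<Prod>(v, w)\<in>vars \<mu> \<times> vars \<nu>. (x'' w - x' v) ^ e (fst v) (fst w))"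

text \<open>
  The exponents with which the denominators of the kernels and of \<open>k\<close> become products of the same form as
  the numerators.
\<close>

definition same_vertex :: "'i \<Rightarrow> 'i \<Rightarrow> nat" where
  "same_vertex i j = (if i = j then 1 else 0)"

lemma prod_same_vertex:
  fixes F :: "'i :: finite \<Rightarrow> 'i \<Rightarrow> nat \<Rightarrow> nat \<Rightarrow> 'k :: comm_ring_1"
  shows "(\<Prod>i\<in>UNIV. \<Prod>\<alpha>=1..nat (\<mu> $ i). \<Prod>\<beta>=1..nat (\<nu> $ i). F i i \<alpha> \<beta>)
    = (\<Prod>(v, w)\<in>vars \<mu> \<times> vars \<nu>. F (fst v) (fst w) (snd v) (snd w) ^ same_vertex (fst v) (fst w))"
proof -
  have "(\<Prod>j\<in>UNIV. \<Prod>\<alpha>=1..nat (\<mu> $ i). \<Prod>\<beta>=1..nat (\<nu> $ j). F i j \<alpha> \<beta> ^ same_vertex i j)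
      = (\<Prod>j\<in>UNIV. if j = i then \<Prod>\<alpha>=1..nat (\<mu> $ i). \<Prod>\<beta>=1..nat (\<nu> $ i). F i i \<alpha> \<beta> else 1)" for i
    by (rule prod.cong) (auto simp: same_vertex_def)
  then have "(\<Prod>j\<in>UNIV. \<Prod>\<alpha>=1..nat (\<mu> $ i). \<Prod>\<beta>=1..nat (\<nu> $ j). F i j \<alpha> \<beta> ^ same_vertex i j)
      = (\<Prod>\<alpha>=1..nat (\<mu> $ i). \<Prod>\<beta>=1..nat (\<nu> $ i). F i i \<alpha> \<beta>)" for i
    by simp
  then show ?thesis
    unfolding prod_vars_times_vars[symmetric, where F = "\<lambda>i j \<alpha> \<beta>. F i j \<alpha> \<beta> ^ same_vertex i j"]
    by (simp only:)
qed

lemma coha_kernel_eq: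
  "coha_kernel a \<mu> \<nu> x' x'' = cross_prod a \<mu> \<nu> x' x'' / cross_prod same_vertex \<mu> \<nu> x' x''"
  unfolding coha_kernel_def cross_prod_def prod_vars_times_vars
  by (subst prod_same_vertex) simp

text \<open>
  The K-theoretical counterpart of \<open>cross_prod\<close>.
\<close>

definition ratio_cross_prod ::
  "('i :: finite \<Rightarrow> 'i \<Rightarrow> nat) \<Rightarrow> 'i dimvec \<Rightarrow> 'i dimvec \<Rightarrow> ('i var \<Rightarrow> 'k) \<Rightarrow> ('i var \<Rightarrow> 'k) \<Rightarrow> 'k :: field" where
  "ratio_cross_prod e \<mu> \<nu> z' z'' =
     (\<Prod>(v, w)\<in>vars \<mu> \<times> vars \<nu>. (1 - z' v * inverse (z'' w)) ^ e (fst v) (fst w))"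

lemma kha_kernel_eq:
  "kha_kernel a \<mu> \<nu> z' z'' =
    ratio_cross_prod a \<mu> \<nu> z' z'' / ratio_cross_prod same_vertex \<mu> \<nu> z' z''"
  unfolding kha_kernel_def ratio_cross_prod_def prod_vars_times_vars
  by (subst prod_same_vertex) simp

lemma k_expr_eq: "k_expr a \<gamma> x = pair_prod a \<gamma> x / pair_prod same_vertex \<gamma> x"
proof -
  have fin: "finite {(\<alpha>, \<beta>). 1 \<le> \<alpha> \<and> \<alpha> < \<beta> \<and> \<beta> \<le> nat (\<gamma> $ i)}" for i
    by (rule finite_subset[of _ "{..nat (\<gamma> $ i)} \<times> {..nat (\<gamma> $ i)}"]) auto
  have "(\<Prod>(v, w) | v \<in> vars \<gamma> \<and> w \<in> vars \<gamma> \<and> v < w. (x w - x v) ^ same_vertex (fst v) (fst w))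
      = (\<Prod>(v, w) | v \<in> vars \<gamma> \<and> w \<in> vars \<gamma> \<and> v < w \<and> fst v = fst w. x w - x v)"
    by (rule prod.mono_neutral_cong_right)
       (auto simp: same_vertex_def split: if_splits intro: finite_subset[of _ "vars \<gamma> \<times> vars \<gamma>"])
  also have "\<dots> = (\<Prod>(i, \<alpha>, \<beta>)\<in>Sigma UNIV (\<lambda>i. {(\<alpha>, \<beta>). 1 \<le> \<alpha> \<and> \<alpha> < \<beta> \<and> \<beta> \<le> nat (\<gamma> $ i)}).
      x (i, \<beta>) - x (i, \<alpha>))"
    by (rule prod.reindex_bij_witness[where i = "\<lambda>(i, \<alpha>, \<beta>). ((i, \<alpha>), (i, \<beta>))"
          and j = "\<lambda>((i, \<alpha>), (j, \<beta>)). (i, \<alpha>, \<beta>)"]) (auto simp: vars_def)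
  also have "\<dots> = (\<Prod>i\<in>UNIV. \<Prod>(\<alpha>, \<beta>) | 1 \<le> \<alpha> \<and> \<alpha> < \<beta> \<and> \<beta> \<le> nat (\<gamma> $ i). x (i, \<beta>) - x (i, \<alpha>))"
    by (subst prod.Sigma[symmetric]) (use fin in \<open>auto simp: case_prod_beta\<close>)
  finally show ?thesis by (simp add: k_expr_def pair_prod_def)
qed

definition unordered_pairs :: "'v set \<Rightarrow> 'v set set" where
  "unordered_pairs V = {B. B \<subseteq> V \<and> card B = 2}"

text \<open>
  The orientation of the pairs by \<open>Min\<close> and \<open>Max\<close> is an arbitrary choice; it provides a common reference
  for all other ones.
\<close>

definition unordered_prod ::
  "('i :: linorder \<Rightarrow> 'i \<Rightarrow> nat) \<Rightarrow> 'i var set set \<Rightarrow> ('i var \<Rightarrow> 'k) \<Rightarrow> 'k :: comm_ring_1" where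
  "unordered_prod e U x = (\<Prod>B\<in>U. (x (Max B) - x (Min B)) ^ e (fst (Min B)) (fst (Max B)))"

text \<open>
  With symmetric exponents, a product of differences over a set of unordered pairs depends
  only up to sign on how the pairs are ordered. It is essential that \<open>s\<close> is chosen before \<open>x\<close>: the
  same sign has to serve for the variables and for their exponentials.
\<close>

lemma unordered_prod_reorder:
  fixes e :: "'i :: linorder \<Rightarrow> 'i \<Rightarrow> nat"
  assumes "\<And>i j. e i j = e j i" and bij: "bij_betw (\<lambda>r. {h r, t r}) I U"
    and "\<And>r. r \<in> I \<Longrightarrow> h r \<noteq> t r"
  obtains s where "s * s = 1"
    "\<And>x :: 'i var \<Rightarrow> 'k :: comm_ring_1.
      (\<Prod>r\<in>I. (x (t r) - x (h r)) ^ e (fst (h r)) (fst (t r))) = s * unordered_prod e U x"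
proof
  let ?s = "\<lambda>r. (if h r < t r then 1 else (-1) ^ e (fst (h r)) (fst (t r))) :: 'k"
  show "prod ?s I * prod ?s I = 1"
    unfolding prod.distrib[symmetric]
    by (rule prod.neutral) (auto simp: power_mult_distrib[symmetric])
  fix x :: "'i var \<Rightarrow> 'k"
  let ?F = "\<lambda>B. (x (Max B) - x (Min B)) ^ e (fst (Min B)) (fst (Max B))"
  have "(x (t r) - x (h r)) ^ e (fst (h r)) (fst (t r)) = ?s r * ?F {h r, t r}" if "r \<in> I" for r
  proof (cases "h r < t r")
    case True
    then show ?thesis by (auto simp: min_def max_def)
  next
    case False
    then have "t r < h r" using assms(3)[OF that] by auto
    then have "Min {h r, t r} = t r" "Max {h r, t r} = h r" by (auto simp: min_def max_def)
    moreover have "(x (t r) - x (h r)) ^ n = (-1) ^ n * (x (h r) - x (t r)) ^ n" for n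
      by (simp flip: power_mult_distrib)
    ultimately show ?thesis
      using False assms(1)[of "fst (h r)" "fst (t r)"] by simp
  qed
  then have "(\<Prod>r\<in>I. (x (t r) - x (h r)) ^ e (fst (h r)) (fst (t r))) = (\<Prod>r\<in>I. ?s r * ?F {h r, t r})"
    by simp
  also have "\<dots> = prod ?s I * (\<Prod>r\<in>I. ?F {h r, t r})" by (rule prod.distrib)
  also have "(\<Prod>r\<in>I. ?F {h r, t r}) = prod ?F U"
    by (rule prod.reindex_bij_betw[OF bij])
  finally show "(\<Prod>r\<in>I. (x (t r) - x (h r)) ^ e (fst (h r)) (fst (t r))) = prod ?s I * unordered_prod e U x"
    by (simp add: unordered_prod_def)
qed

lemma unordered_pairsE:
  assumes "B \<in> unordered_pairs V"
  obtains v w where "B = {v, w}" "v \<noteq> w" "v \<in> V" "w \<in> V"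
  using assms by (auto simp: unordered_pairs_def card_2_iff)

lemma unordered_pairsI: "v \<noteq> w \<Longrightarrow> v \<in> V \<Longrightarrow> w \<in> V \<Longrightarrow> {v, w} \<in> unordered_pairs V"
  by (auto simp: unordered_pairs_def)

lemma finite_unordered_pairs [simp]: "finite V \<Longrightarrow> finite (unordered_pairs V)"
  by (simp add: unordered_pairs_def)

lemma pair_prod_reorder:
  assumes "\<And>i j. e i j = e j i" and inj: "inj_on \<phi> (vars \<gamma>)"
    and fst: "\<And>v. v \<in> vars \<gamma> \<Longrightarrow> fst (\<phi> v) = fst v"
  obtains s where "s * s = 1"
    "\<And>x :: 'i :: {finite, linorder} var \<Rightarrow> 'k :: comm_ring_1.
      pair_prod e \<gamma> (\<lambda>v. x (\<phi> v)) = s * unordered_prod e (unordered_pairs (\<phi> ` vars \<gamma>)) x"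
proof -
  let ?I = "{(v, w). v \<in> vars \<gamma> \<and> w \<in> vars \<gamma> \<and> v < w}"
  have bij: "bij_betw (\<lambda>r. {\<phi> (fst r), \<phi> (snd r)}) ?I (unordered_pairs (\<phi> ` vars \<gamma>))"
    unfolding bij_betw_def
  proof
    show "inj_on (\<lambda>r. {\<phi> (fst r), \<phi> (snd r)}) ?I"
    proof (rule inj_onI)
      fix r r' assume r: "r \<in> ?I" "r' \<in> ?I" and eq: "{\<phi> (fst r), \<phi> (snd r)} = {\<phi> (fst r'), \<phi> (snd r')}"
      then have "{fst r, snd r} = {fst r', snd r'}"
        using inj_on_image_eq_iff[OF inj, of "{fst r, snd r}" "{fst r', snd r'}"]
        by (simp add: case_prod_beta)
      moreover have "fst r < snd r" "fst r' < snd r'" using r by auto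
      ultimately show "r = r'" by (metis doubleton_eq_iff order_less_asym prod_eqI)
    qed
    show "(\<lambda>r. {\<phi> (fst r), \<phi> (snd r)}) ` ?I = unordered_pairs (\<phi> ` vars \<gamma>)"
    proof
      show "(\<lambda>r. {\<phi> (fst r), \<phi> (snd r)}) ` ?I \<subseteq> unordered_pairs (\<phi> ` vars \<gamma>)"
        using inj by (auto intro!: unordered_pairsI simp: inj_on_eq_iff)
      show "unordered_pairs (\<phi> ` vars \<gamma>) \<subseteq> (\<lambda>r. {\<phi> (fst r), \<phi> (snd r)}) ` ?I"
      proof
        fix B assume "B \<in> unordered_pairs (\<phi> ` vars \<gamma>)"
        then obtain p q where pq: "B = {p, q}" "p \<noteq> q" "p \<in> \<phi> ` vars \<gamma>" "q \<in> \<phi> ` vars \<gamma>"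
          by (elim unordered_pairsE)
        then obtain v w where vw: "p = \<phi> v" "q = \<phi> w" "v \<in> vars \<gamma>" "w \<in> vars \<gamma>" by blast
        with pq have B: "B = {\<phi> v, \<phi> w}" "v \<noteq> w" "v \<in> vars \<gamma>" "w \<in> vars \<gamma>" by auto
        then consider "v < w" | "w < v" by (metis neqE)
        then show "B \<in> (\<lambda>r. {\<phi> (fst r), \<phi> (snd r)}) ` ?I"
        proof cases
          case 1
          then show ?thesis using B by (intro image_eqI[of _ _ "(v, w)"]) auto
        next
          case 2
          then show ?thesis using B by (intro image_eqI[of _ _ "(w, v)"]) auto
        qed
      qed
    qed
  qed
  have neq_I: "\<phi> (fst r) \<noteq> \<phi> (snd r)" if "r \<in> ?I" for r
    using that inj by (auto simp: inj_on_eq_iff)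
  obtain s :: 'k where s: "s * s = 1" "\<And>x. (\<Prod>r\<in>?I. (x (\<phi> (snd r)) - x (\<phi> (fst r))) ^ e (fst (\<phi> (fst r))) (fst (\<phi> (snd r))))
      = s * unordered_prod e (unordered_pairs (\<phi> ` vars \<gamma>)) x"
    by (rule unordered_prod_reorder[of e, OF assms(1) bij neq_I]) (assumption, rule that)
  have "pair_prod e \<gamma> (\<lambda>v. x (\<phi> v)) = s * unordered_prod e (unordered_pairs (\<phi> ` vars \<gamma>)) x" for x
    unfolding s(2)[symmetric] pair_prod_def by (rule prod.cong) (auto simp: fst)
  with s(1) that show ?thesis by blast
qed

lemma cross_prod_reorder:
  assumes "\<And>i j. e i j = e j i" and inj: "inj_on \<phi> (vars \<mu>)" "inj_on \<psi> (vars \<nu>)"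
    and fst: "\<And>v. v \<in> vars \<mu> \<Longrightarrow> fst (\<phi> v) = fst v" "\<And>v. v \<in> vars \<nu> \<Longrightarrow> fst (\<psi> v) = fst v"
    and disj: "\<phi> ` vars \<mu> \<inter> \<psi> ` vars \<nu> = {}"
  obtains s where "s * s = 1"
    "\<And>x :: 'i :: {finite, linorder} var \<Rightarrow> 'k :: comm_ring_1.
      cross_prod e \<mu> \<nu> (\<lambda>v. x (\<phi> v)) (\<lambda>v. x (\<psi> v))
      = s * unordered_prod e ((\<lambda>(v, w). {v, w}) ` (\<phi> ` vars \<mu> \<times> \<psi> ` vars \<nu>)) x"
proof -
  let ?I = "vars \<mu> \<times> vars \<nu>"
  have neq: "\<phi> v \<noteq> \<psi> w" if "v \<in> vars \<mu>" "w \<in> vars \<nu>" for v w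
    using disj that by blast
  have bij: "bij_betw (\<lambda>r. {\<phi> (fst r), \<psi> (snd r)}) ?I ((\<lambda>(v, w). {v, w}) ` (\<phi> ` vars \<mu> \<times> \<psi> ` vars \<nu>))"
    unfolding bij_betw_def
  proof
    show "inj_on (\<lambda>r. {\<phi> (fst r), \<psi> (snd r)}) ?I"
    proof (rule inj_onI, clarify)
      fix v w v' w' assume *: "v \<in> vars \<mu>" "w \<in> vars \<nu>" "v' \<in> vars \<mu>" "w' \<in> vars \<nu>"
        and "{\<phi> (fst (v, w)), \<psi> (snd (v, w))} = {\<phi> (fst (v', w')), \<psi> (snd (v', w'))}"
      then have "\<phi> v = \<phi> v' \<and> \<psi> w = \<psi> w'"
        using neq by (auto simp: doubleton_eq_iff)
      then show "v = v' \<and> w = w'" using * inj by (auto simp: inj_on_eq_iff)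
    qed
    show "(\<lambda>r. {\<phi> (fst r), \<psi> (snd r)}) ` ?I = (\<lambda>(v, w). {v, w}) ` (\<phi> ` vars \<mu> \<times> \<psi> ` vars \<nu>)"
      by force
  qed
  have neq_I: "\<phi> (fst r) \<noteq> \<psi> (snd r)" if "r \<in> ?I" for r
    using that neq by auto
  obtain s :: 'k where s: "s * s = 1" "\<And>x. (\<Prod>r\<in>?I. (x (\<psi> (snd r)) - x (\<phi> (fst r))) ^ e (fst (\<phi> (fst r))) (fst (\<psi> (snd r))))
      = s * unordered_prod e ((\<lambda>(v, w). {v, w}) ` (\<phi> ` vars \<mu> \<times> \<psi> ` vars \<nu>)) x"
    by (rule unordered_prod_reorder[of e, OF assms(1) bij neq_I]) (assumption, rule that)
  have "cross_prod e \<mu> \<nu> (\<lambda>v. x (\<phi> v)) (\<lambda>v. x (\<psi> v))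
      = s * unordered_prod e ((\<lambda>(v, w). {v, w}) ` (\<phi> ` vars \<mu> \<times> \<psi> ` vars \<nu>)) x" for x
    unfolding s(2)[symmetric] cross_prod_def by (rule prod.cong) (auto simp: fst)
  with s(1) that show ?thesis by blast
qed

section \<open>Symmetric groups and shuffles\<close>

lemma sym_groupD:
  assumes "\<pi> \<in> sym_group \<gamma>"
  shows "\<pi> permutes vars \<gamma>" "fst (\<pi> v) = fst v" "bij \<pi>" "inj \<pi>" "\<pi> ` vars \<gamma> = vars \<gamma>"
  using assms by (cases v; auto simp: sym_group_def permutes_bij permutes_inj permutes_image)+

lemma sym_group_comp: "\<pi> \<in> sym_group \<gamma> \<Longrightarrow> \<rho> \<in> sym_group \<gamma> \<Longrightarrow> \<pi> \<circ> \<rho> \<in> sym_group \<gamma>"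
  by (auto simp: sym_group_def intro: permutes_compose) (metis fst_conv prod.collapse)

lemma shift_props:
  "fst (shift \<gamma> v) = fst v" "inj (shift \<gamma>)"
  by (auto simp: shift_def inj_def case_prod_beta prod_eq_iff)

lemma vars_add:
  assumes "nonneg \<mu>" "nonneg \<nu>"
  shows "vars (\<mu> + \<nu>) = vars \<mu> \<union> shift \<mu> ` vars \<nu>"
proof (rule Set.set_eqI)
  fix v :: "'a var"
  obtain i \<alpha> where v: "v = (i, \<alpha>)" by (cases v)
  have n: "nat ((\<mu> + \<nu>) $ i) = nat (\<mu> $ i) + nat (\<nu> $ i)"
    using assms by (simp add: nat_add_distrib)
  have "(i, \<alpha>) \<in> shift \<mu> ` vars \<nu> \<longleftrightarrow> nat (\<mu> $ i) < \<alpha> \<and> \<alpha> \<le> nat (\<mu> $ i) + nat (\<nu> $ i)"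
  proof
    assume "nat (\<mu> $ i) < \<alpha> \<and> \<alpha> \<le> nat (\<mu> $ i) + nat (\<nu> $ i)"
    then show "(i, \<alpha>) \<in> shift \<mu> ` vars \<nu>"
      by (intro image_eqI[of _ _ "(i, \<alpha> - nat (\<mu> $ i))"]) (auto simp: shift_def vars_def)
  qed (auto simp: shift_def vars_def)
  moreover have "(i, \<alpha>) \<in> vars (\<mu> + \<nu>) \<longleftrightarrow> 1 \<le> \<alpha> \<and> \<alpha> \<le> nat (\<mu> $ i) + nat (\<nu> $ i)"
    unfolding n[symmetric] by (simp add: vars_eq_Sigma)
  moreover have "(i, \<alpha>) \<in> vars \<mu> \<longleftrightarrow> 1 \<le> \<alpha> \<and> \<alpha> \<le> nat (\<mu> $ i)"
    by (simp add: vars_eq_Sigma)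
  ultimately show "v \<in> vars (\<mu> + \<nu>) \<longleftrightarrow> v \<in> vars \<mu> \<union> shift \<mu> ` vars \<nu>"
    unfolding v Un_iff by linarith
qed

lemma vars_shift_disjoint: "vars \<mu> \<inter> shift \<mu> ` vars \<nu> = {}"
  by (auto simp: vars_def shift_def)

text \<open>
  The two factors inside the blocks and the mixed one together contain every pair of variables exactly
  once. Applied to the numerator and to the denominator of \<open>k\<close>, this is the identity behind the theorem.
\<close>

lemma pair_prod_split:
  fixes e :: "'i :: {finite, linorder} \<Rightarrow> 'i \<Rightarrow> nat"
  assumes e: "\<And>i j. e i j = e j i" and nonneg: "nonneg \<mu>" "nonneg \<nu>"
    and \<pi>: "\<pi> \<in> sym_group (\<mu> + \<nu>)"
  obtains s where "s * s = 1"
    "\<And>x :: 'i var \<Rightarrow> 'k :: comm_ring_1. pair_prod e \<mu> (\<lambda>v. x (\<pi> v)) * pair_prod e \<nu> (\<lambda>v. x (\<pi> (shift \<mu> v)))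
        * cross_prod e \<mu> \<nu> (\<lambda>v. x (\<pi> v)) (\<lambda>v. x (\<pi> (shift \<mu> v)))
      = s * pair_prod e (\<mu> + \<nu>) x"
proof -
  define A C where "A = \<pi> ` vars \<mu>" and "C = (\<lambda>v. \<pi> (shift \<mu> v)) ` vars \<nu>"
  note \<pi>D = sym_groupD[OF \<pi>]
  have union: "vars (\<mu> + \<nu>) = A \<union> C"
    using \<pi>D(5) unfolding A_def C_def vars_add[OF nonneg] by (simp add: image_Un image_image)
  have disj: "A \<inter> C = {}"
    using vars_shift_disjoint[of \<mu> \<nu>] \<pi>D(4) unfolding A_def C_def
    by (metis image_Int image_empty image_image)
  have fin: "finite A" "finite C" by (simp_all add: A_def C_def)
  \<comment> \<open>The variables in \<open>x'\<close> and \<open>x''\<close> are those indexed by \<open>A\<close> and \<open>C\<close>; \<open>?X\<close> consists of the mixed pairs.\<close>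
  let ?X = "(\<lambda>(v, w). {v, w}) ` (A \<times> C)"
  have pairs: "unordered_pairs (A \<union> C) = unordered_pairs A \<union> unordered_pairs C \<union> ?X"
  proof
    show "unordered_pairs A \<union> unordered_pairs C \<union> ?X \<subseteq> unordered_pairs (A \<union> C)"
      using disj by (auto intro!: unordered_pairsI elim!: unordered_pairsE)
    show "unordered_pairs (A \<union> C) \<subseteq> unordered_pairs A \<union> unordered_pairs C \<union> ?X"
    proof
      fix B assume "B \<in> unordered_pairs (A \<union> C)"
      then obtain v w where B: "B = {v, w}" "v \<noteq> w" "v \<in> A \<union> C" "w \<in> A \<union> C"
        by (elim unordered_pairsE)
      then consider "v \<in> A" "w \<in> A" | "v \<in> C" "w \<in> C" | "v \<in> A" "w \<in> C" | "w \<in> A" "v \<in> C"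
        by blast
      then show "B \<in> unordered_pairs A \<union> unordered_pairs C \<union> ?X"
      proof cases
        case 3
        then show ?thesis using B by (intro UnI2 image_eqI[of _ _ "(v, w)"]) auto
      next
        case 4
        then show ?thesis using B by (intro UnI2 image_eqI[of _ _ "(w, v)"]) auto
      qed (use B in \<open>auto intro: unordered_pairsI\<close>)
    qed
  qed
  have pairs_disj: "unordered_pairs A \<inter> unordered_pairs C = {}"
    "(unordered_pairs A \<union> unordered_pairs C) \<inter> ?X = {}"
  proof -
    have "False" if "B \<in> unordered_pairs A" "B \<in> unordered_pairs C" for B
    proof -
      from that have "B \<subseteq> A \<inter> C" "card B = 2" unfolding unordered_pairs_def by blast+
      then show False using disj by simp
    qed
    then show "unordered_pairs A \<inter> unordered_pairs C = {}" by blast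
    have "\<not> {v, w} \<subseteq> A \<and> \<not> {v, w} \<subseteq> C" if "v \<in> A" "w \<in> C" for v w
      using that disj by blast
    then show "(unordered_pairs A \<union> unordered_pairs C) \<inter> ?X = {}"
      unfolding unordered_pairs_def by blast
  qed
  have inj1: "inj_on \<pi> V" for V
    using \<pi>D(4) by (rule inj_on_subset) simp
  have inj2: "inj_on (\<lambda>v. \<pi> (shift \<mu> v)) V" for V
    using inj_compose[OF \<pi>D(4) shift_props(2)[of \<mu>]] unfolding comp_def by (rule inj_on_subset) simp
  have fst2: "fst (\<pi> (shift \<mu> v)) = fst v" for v
    by (simp add: \<pi>D(2) shift_props(1))
  obtain s1 :: 'k where s1: "s1 * s1 = 1"
    "\<And>x. pair_prod e \<mu> (\<lambda>v. x (\<pi> v)) = s1 * unordered_prod e (unordered_pairs (\<pi> ` vars \<mu>)) x"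
    by (rule pair_prod_reorder[of e \<pi> \<mu>, OF e inj1 \<pi>D(2)]) (rule that)
  obtain s2 :: 'k where s2: "s2 * s2 = 1"
    "\<And>x. pair_prod e \<nu> (\<lambda>v. x (\<pi> (shift \<mu> v)))
      = s2 * unordered_prod e (unordered_pairs ((\<lambda>v. \<pi> (shift \<mu> v)) ` vars \<nu>)) x"
    by (rule pair_prod_reorder[of e "\<lambda>v. \<pi> (shift \<mu> v)" \<nu>, OF e inj2 fst2]) (rule that)
  obtain s3 :: 'k where s3: "s3 * s3 = 1"
    "\<And>x. cross_prod e \<mu> \<nu> (\<lambda>v. x (\<pi> v)) (\<lambda>v. x (\<pi> (shift \<mu> v)))
      = s3 * unordered_prod e
          ((\<lambda>(v, w). {v, w}) ` (\<pi> ` vars \<mu> \<times> (\<lambda>v. \<pi> (shift \<mu> v)) ` vars \<nu>)) x"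
    by (rule cross_prod_reorder[of e \<pi> \<mu> "\<lambda>v. \<pi> (shift \<mu> v)" \<nu>,
          OF e inj1 inj2 \<pi>D(2) fst2 disj[unfolded A_def C_def]]) (rule that)
  obtain s4 :: 'k where s4: "s4 * s4 = 1"
    "\<And>x. pair_prod e (\<mu> + \<nu>) (\<lambda>v. x v)
      = s4 * unordered_prod e (unordered_pairs ((\<lambda>v. v) ` vars (\<mu> + \<nu>))) x"
    by (rule pair_prod_reorder[of e "\<lambda>v. v" "\<mu> + \<nu>", OF e inj_on_id2 refl]) (rule that)
  note s1 = s1[folded A_def] and s2 = s2[folded C_def] and s3 = s3[folded A_def C_def]
    and s4 = s4[unfolded image_ident union]
  have split: "unordered_prod e (unordered_pairs (A \<union> C)) x =
      unordered_prod e (unordered_pairs A) x * unordered_prod e (unordered_pairs C) x * unordered_prod e ?X x"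
    for x :: "'i var \<Rightarrow> 'k"
    unfolding unordered_prod_def pairs
    using fin pairs_disj by (simp add: prod.union_disjoint)
  show ?thesis
  proof
    show "(s1 * s2 * s3 * s4) * (s1 * s2 * s3 * s4) = 1"
      using s1(1) s2(1) s3(1) s4(1) by (metis mult.assoc mult.commute mult.right_neutral)
    fix x :: "'i var \<Rightarrow> 'k"
    have "s1 * s2 * s3 * s4 * pair_prod e (\<mu> + \<nu>) x
        = (s4 * s4) * (s1 * s2 * s3 * unordered_prod e (unordered_pairs (A \<union> C)) x)"
      by (simp add: s4(2) mult_ac)
    then show "pair_prod e \<mu> (\<lambda>v. x (\<pi> v)) * pair_prod e \<nu> (\<lambda>v. x (\<pi> (shift \<mu> v)))
        * cross_prod e \<mu> \<nu> (\<lambda>v. x (\<pi> v)) (\<lambda>v. x (\<pi> (shift \<mu> v)))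
      = (s1 * s2 * s3 * s4) * pair_prod e (\<mu> + \<nu>) x"
      by (simp add: s1(2) s2(2) s3(2) s4(1) split mult_ac)
  qed
qed

lemma pair_prod_permute:
  fixes e :: "'i :: {finite, linorder} \<Rightarrow> 'i \<Rightarrow> nat"
  assumes e: "\<And>i j. e i j = e j i" and \<pi>: "\<pi> \<in> sym_group \<gamma>"
  obtains s where "s * s = 1"
    "\<And>x :: 'i var \<Rightarrow> 'k :: comm_ring_1. pair_prod e \<gamma> (\<lambda>v. x (\<pi> v)) = s * pair_prod e \<gamma> x"
proof -
  note \<pi>D = sym_groupD[OF \<pi>]
  have inj: "inj_on \<pi> (vars \<gamma>)"
    using \<pi>D(4) by (rule inj_on_subset) simp
  obtain s1 :: 'k where s1: "s1 * s1 = 1"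
    "\<And>x. pair_prod e \<gamma> (\<lambda>v. x (\<pi> v)) = s1 * unordered_prod e (unordered_pairs (\<pi> ` vars \<gamma>)) x"
    by (rule pair_prod_reorder[of e \<pi> \<gamma>, OF e inj \<pi>D(2)]) (rule that)
  obtain s2 :: 'k where s2: "s2 * s2 = 1"
    "\<And>x. pair_prod e \<gamma> (\<lambda>v. x v) = s2 * unordered_prod e (unordered_pairs ((\<lambda>v. v) ` vars \<gamma>)) x"
    by (rule pair_prod_reorder[of e "\<lambda>v. v" \<gamma>, OF e inj_on_id2 refl]) (rule that)
  note s1 = s1[unfolded \<pi>D(5)] and s2 = s2[unfolded image_ident]
  show ?thesis
  proof
    show "(s1 * s2) * (s1 * s2) = 1"
      using s1(1) s2(1) by (metis mult.assoc mult.commute mult.right_neutral)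
    fix x :: "'i var \<Rightarrow> 'k"
    have "s1 * s2 * pair_prod e \<gamma> x = (s2 * s2) * (s1 * unordered_prod e (unordered_pairs (vars \<gamma>)) x)"
      by (simp add: s2(2) mult_ac)
    then show "pair_prod e \<gamma> (\<lambda>v. x (\<pi> v)) = (s1 * s2) * pair_prod e \<gamma> x"
      by (simp add: s1(2) s2(1))
  qed
qed

text \<open>
  Enumerate the image increasingly and pull the enumeration back along \<open>f\<close>.
\<close>

lemma sorting_permutation:
  fixes f :: "nat \<Rightarrow> nat"
  assumes "inj_on f {1..n}"
  obtains p where "p permutes {1..n}" "strict_mono_on {1..n} (\<lambda>i. f (p i))"
proof -
  have card: "card (f ` {1..n}) = n" using card_image[OF assms] by simp
  obtain h where h: "bij_betw h {..<n} (f ` {1..n})" "strict_mono_on {..<n} h"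
    using ex_bij_betw_strict_mono_card[of "f ` {1..n}"] card by auto
  define p where "p i = (if i \<in> {1..n} then inv_into {1..n} f (h (i - 1)) else i)" for i
  have mem: "h (i - 1) \<in> f ` {1..n}" if "i \<in> {1..n}" for i
    using h(1) that by (auto simp: bij_betw_def)
  have fp: "f (p i) = h (i - 1)" "p i \<in> {1..n}" if "i \<in> {1..n}" for i
    using f_inv_into_f[OF mem[OF that]] inv_into_into[OF mem[OF that]] that by (simp_all add: p_def)
  have sm: "strict_mono_on {1..n} (\<lambda>i. f (p i))"
  proof (rule strict_mono_onI)
    fix i j assume ij: "i \<in> {1..n}" "j \<in> {1..n}" "i < j"
    then have "h (i - 1) < h (j - 1)" by (intro strict_mono_onD[OF h(2)]) auto
    then show "f (p i) < f (p j)" using ij by (simp add: fp(1))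
  qed
  then have "inj_on p {1..n}"
    by (metis (no_types, lifting) inj_on_def strict_mono_on_imp_inj_on)
  then have "bij_betw p {1..n} {1..n}"
    unfolding bij_betw_def using fp(2) by (intro conjI endo_inj_surj) auto
  then have "p permutes {1..n}"
    by (rule bij_imp_permutes) (auto simp: p_def)
  with sm that show ?thesis by blast
qed

text \<open>
  By induction both functions pick the least element not yet attained.
\<close>

lemma strict_mono_on_unique:
  fixes f g :: "nat \<Rightarrow> nat"
  assumes "strict_mono_on S f" "strict_mono_on S g" "f ` S = g ` S" "i \<in> S"
  shows "f i = g i"
  using assms(4)
proof (induction i rule: less_induct)
  case (less i)
  have le: "g i \<le> f i" if f: "strict_mono_on S f" and g: "strict_mono_on S g" and im: "f ` S = g ` S"
    and IH: "\<And>k. k < i \<Longrightarrow> k \<in> S \<Longrightarrow> f k = g k" for f g :: "nat \<Rightarrow> nat"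
  proof -
    obtain k where k: "k \<in> S" "f i = g k" using im less.prems by blast
    have "\<not> k < i"
    proof
      assume "k < i"
      then have "f k < f i" using f k(1) less.prems by (auto dest: strict_mono_onD)
      with IH[OF \<open>k < i\<close> k(1)] k(2) show False by simp
    qed
    then consider "k = i" | "i < k" by linarith
    then show ?thesis
    proof cases
      case 2
      then have "g i < g k" using g k(1) less.prems by (auto dest: strict_mono_onD)
      with k show ?thesis by simp
    qed (use k in simp)
  qed
  have "g i \<le> f i" by (rule le) (use assms less.IH in auto)
  moreover have "f i \<le> g i" by (rule le) (use assms less.IH in auto)
  ultimately show ?case by simp
qed

lemma fibrewise_sym_group:
  assumes "\<And>i. p i permutes {1..nat (\<gamma> $ i)}"
  shows "(\<lambda>(i, \<alpha>). (i, p i \<alpha>)) \<in> sym_group \<gamma>"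
proof -
  have "bij_betw (\<lambda>(i, \<alpha>). (i, p i \<alpha>)) (vars \<gamma>) (vars \<gamma>)"
    unfolding bij_betw_def
  proof
    show inj: "inj_on (\<lambda>(i, \<alpha>). (i, p i \<alpha>)) (vars \<gamma>)"
      by (rule inj_onI) (use permutes_inj[OF assms] in \<open>auto simp: inj_eq\<close>)
    have "(\<lambda>(i, \<alpha>). (i, p i \<alpha>)) ` vars \<gamma> \<subseteq> vars \<gamma>"
      using permutes_in_image[OF assms] by (auto simp: vars_eq_Sigma)
    then show "(\<lambda>(i, \<alpha>). (i, p i \<alpha>)) ` vars \<gamma> = vars \<gamma>"
      using inj by (intro endo_inj_surj) auto
  qed
  then have "(\<lambda>(i, \<alpha>). (i, p i \<alpha>)) permutes vars \<gamma>"
    by (rule bij_imp_permutes) (use permutes_not_in[OF assms] in \<open>auto simp: vars_eq_Sigma\<close>)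
  then show ?thesis by (simp add: sym_group_def)
qed

text \<open>
  \<open>\<pi>\<close> and \<open>\<pi>'\<close> lie in the same coset of \<open>S\<^bsub>\<mu>\<^esub> \<times> S\<^bsub>\<nu>\<^esub>\<close>. Keeping the two components of the element of
  this group apart suits the summands, in which \<open>x'\<close> and \<open>x''\<close> enter separately.
\<close>

definition same_splitting :: "'i :: finite dimvec \<Rightarrow> 'i dimvec \<Rightarrow> ('i var \<Rightarrow> 'i var) \<Rightarrow> ('i var \<Rightarrow> 'i var) \<Rightarrow> bool" where
  "same_splitting \<mu> \<nu> \<pi>' \<pi> \<longleftrightarrow> (\<exists>\<rho>\<^sub>1\<in>sym_group \<mu>. \<exists>\<rho>\<^sub>2\<in>sym_group \<nu>.
     (\<forall>v\<in>vars \<mu>. \<pi>' v = \<pi> (\<rho>\<^sub>1 v)) \<and> (\<forall>v\<in>vars \<nu>. \<pi>' (shift \<mu> v) = \<pi> (shift \<mu> (\<rho>\<^sub>2 v))))"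

lemma same_splitting_image:
  assumes "same_splitting \<mu> \<nu> \<pi>' \<pi>"
  shows "\<pi>' ` vars \<mu> = \<pi> ` vars \<mu>"
proof -
  from assms obtain \<rho> where \<rho>: "\<rho> \<in> sym_group \<mu>" "\<forall>v\<in>vars \<mu>. \<pi>' v = \<pi> (\<rho> v)"
    by (auto simp: same_splitting_def)
  then have "\<pi>' ` vars \<mu> = \<pi> ` \<rho> ` vars \<mu>" by (auto simp: image_image)
  then show ?thesis using sym_groupD(5)[OF \<rho>(1)] by simp
qed

text \<open>
  Sort the values of \<open>\<pi>\<close>, for each vertex, on the first \<open>\<mu>\<^sup>i\<close> and on the last \<open>\<nu>\<^sup>i\<close> indices separately.
\<close>

lemma shuffle_of_permutation:
  assumes nonneg: "nonneg \<mu>" "nonneg \<nu>" and \<pi>: "\<pi> \<in> sym_group (\<mu> + \<nu>)"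
  shows "\<exists>\<pi>'\<in>shuffle_perms \<mu> \<nu>. same_splitting \<mu> \<nu> \<pi>' \<pi>"
proof -
  note \<pi>D = sym_groupD[OF \<pi>]
  define n1 n2 where "n1 i = nat (\<mu> $ i)" and "n2 i = nat (\<nu> $ i)" for i
  have inj: "inj_on (\<lambda>\<alpha>. snd (\<pi> (i, k + \<alpha>))) S" for i k S
  proof (rule inj_onI)
    fix \<alpha> \<beta> assume "snd (\<pi> (i, k + \<alpha>)) = snd (\<pi> (i, k + \<beta>))"
    then have "\<pi> (i, k + \<alpha>) = \<pi> (i, k + \<beta>)"
      using \<pi>D(2) by (simp add: prod_eq_iff)
    then show "\<alpha> = \<beta>" using \<pi>D(4) by (simp add: inj_eq)
  qed
  have "\<exists>p. p permutes {1..n1 i} \<and> strict_mono_on {1..n1 i} (\<lambda>\<alpha>. snd (\<pi> (i, p \<alpha>)))" for i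
    by (rule sorting_permutation[of "\<lambda>\<alpha>. snd (\<pi> (i, \<alpha>))" "n1 i"]) (use inj[of i 0] in auto)
  then obtain p where p: "\<And>i. p i permutes {1..n1 i}"
    "\<And>i. strict_mono_on {1..n1 i} (\<lambda>\<alpha>. snd (\<pi> (i, p i \<alpha>)))" by metis
  have "\<exists>q. q permutes {1..n2 i} \<and> strict_mono_on {1..n2 i} (\<lambda>\<alpha>. snd (\<pi> (i, n1 i + q \<alpha>)))" for i
    by (rule sorting_permutation[of "\<lambda>\<alpha>. snd (\<pi> (i, n1 i + \<alpha>))" "n2 i"]) (use inj[of i "n1 i"] in auto)
  then obtain q where q: "\<And>i. q i permutes {1..n2 i}"
    "\<And>i. strict_mono_on {1..n2 i} (\<lambda>\<alpha>. snd (\<pi> (i, n1 i + q i \<alpha>)))" by metis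
  define \<rho>\<^sub>1 \<rho>\<^sub>2 where "\<rho>\<^sub>1 = (\<lambda>(i, \<alpha>). (i, p i \<alpha>))" and "\<rho>\<^sub>2 = (\<lambda>(i, \<alpha>). (i, q i \<alpha>))"
  have \<rho>\<^sub>1: "\<rho>\<^sub>1 \<in> sym_group \<mu>" and \<rho>\<^sub>2: "\<rho>\<^sub>2 \<in> sym_group \<nu>"
    unfolding \<rho>\<^sub>1_def \<rho>\<^sub>2_def using p(1) q(1) by (intro fibrewise_sym_group; simp add: n1_def n2_def)+
  \<comment> \<open>\<open>\<rho>\<close> is the permutation of all variables with blocks \<open>\<rho>\<^sub>1\<close> and \<open>\<rho>\<^sub>2\<close>.\<close>
  define \<rho> where "\<rho> v = (if v \<in> vars \<mu> then \<rho>\<^sub>1 v else if v \<in> shift \<mu> ` vars \<nu>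
    then shift \<mu> (\<rho>\<^sub>2 (inv_into UNIV (shift \<mu>) v)) else v)" for v
  have \<rho>1: "\<rho> v = \<rho>\<^sub>1 v" if "v \<in> vars \<mu>" for v using that by (simp add: \<rho>_def)
  have \<rho>2: "\<rho> (shift \<mu> v) = shift \<mu> (\<rho>\<^sub>2 v)" if "v \<in> vars \<nu>" for v
    using that vars_shift_disjoint[of \<mu> \<nu>] by (auto simp: \<rho>_def inv_f_f[OF shift_props(2)])
  have "bij_betw \<rho> (vars \<mu>) (vars \<mu>)"
    using permutes_imp_bij[OF sym_groupD(1)[OF \<rho>\<^sub>1]] \<rho>1 by (simp cong: bij_betw_cong)
  moreover have "bij_betw \<rho> (shift \<mu> ` vars \<nu>) (shift \<mu> ` vars \<nu>)"
  proof -
    have "inj_on \<rho> (shift \<mu> ` vars \<nu>)"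
    proof (rule inj_onI)
      fix x y assume xy: "x \<in> shift \<mu> ` vars \<nu>" "y \<in> shift \<mu> ` vars \<nu>" "\<rho> x = \<rho> y"
      then obtain v w where vw: "x = shift \<mu> v" "y = shift \<mu> w" "v \<in> vars \<nu>" "w \<in> vars \<nu>" by blast
      then have "shift \<mu> (\<rho>\<^sub>2 v) = shift \<mu> (\<rho>\<^sub>2 w)" using xy(3) \<rho>2 by simp
      then have "v = w" using injD[OF shift_props(2)] injD[OF sym_groupD(4)[OF \<rho>\<^sub>2]] by blast
      with vw show "x = y" by simp
    qed
    moreover have "\<rho> ` shift \<mu> ` vars \<nu> = shift \<mu> ` \<rho>\<^sub>2 ` vars \<nu>"
      by (simp add: image_image \<rho>2)
    ultimately show ?thesis using sym_groupD(5)[OF \<rho>\<^sub>2] by (simp add: bij_betw_def)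
  qed
  ultimately have "bij_betw \<rho> (vars (\<mu> + \<nu>)) (vars (\<mu> + \<nu>))"
    unfolding vars_add[OF nonneg] by (rule bij_betw_combine) (rule vars_shift_disjoint)
  then have "\<rho> permutes vars (\<mu> + \<nu>)"
    by (rule bij_imp_permutes) (auto simp: \<rho>_def vars_add[OF nonneg])
  moreover have "fst (\<rho> v) = fst v" for v
  proof -
    consider "v \<in> vars \<mu>" | w where "v = shift \<mu> w" "w \<in> vars \<nu>"
      | "v \<notin> vars \<mu>" "v \<notin> shift \<mu> ` vars \<nu>" by blast
    then show ?thesis
      by cases (auto simp: \<rho>1 \<rho>2 sym_groupD(2)[OF \<rho>\<^sub>1] sym_groupD(2)[OF \<rho>\<^sub>2] shift_props, simp add: \<rho>_def)
  qed
  ultimately have "\<rho> \<in> sym_group (\<mu> + \<nu>)" by (simp add: sym_group_def)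
  then have comp: "\<pi> \<circ> \<rho> \<in> sym_group (\<mu> + \<nu>)" by (rule sym_group_comp[OF \<pi>])
  have "\<pi> \<circ> \<rho> \<in> shuffle_perms \<mu> \<nu>"
    unfolding shuffle_perms_def
  proof (intro CollectI conjI comp allI)
    fix i
    have "(\<pi> \<circ> \<rho>) (i, \<alpha>) = \<pi> (i, p i \<alpha>)" if "\<alpha> \<in> {1..n1 i}" for \<alpha>
      using that by (simp add: \<rho>1 vars_eq_Sigma n1_def) (simp add: \<rho>\<^sub>1_def)
    then show "strict_mono_on {1..nat (\<mu> $ i)} (\<lambda>\<alpha>. snd ((\<pi> \<circ> \<rho>) (i, \<alpha>)))"
      using p(2)[of i] by (auto simp: strict_mono_on_def n1_def)
    have "(\<pi> \<circ> \<rho>) (i, n1 i + \<alpha>) = \<pi> (i, n1 i + q i \<alpha>)" if "\<alpha> \<in> {1..n2 i}" for \<alpha>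
      using \<rho>2[of "(i, \<alpha>)"] that by (simp add: vars_eq_Sigma n2_def) (simp add: \<rho>\<^sub>2_def shift_def n1_def)
    then have *: "snd ((\<pi> \<circ> \<rho>) (i, n1 i + \<alpha>)) < snd ((\<pi> \<circ> \<rho>) (i, n1 i + \<beta>))"
      if "\<alpha> \<in> {1..n2 i}" "\<beta> \<in> {1..n2 i}" "\<alpha> < \<beta>" for \<alpha> \<beta>
      using q(2)[of i] that by (auto simp: strict_mono_on_def)
    show "strict_mono_on {nat (\<mu> $ i) + 1..nat (\<mu> $ i) + nat (\<nu> $ i)} (\<lambda>\<alpha>. snd ((\<pi> \<circ> \<rho>) (i, \<alpha>)))"
    proof (rule strict_mono_onI)
      fix \<alpha> \<beta> assume "\<alpha> \<in> {nat (\<mu> $ i) + 1..nat (\<mu> $ i) + nat (\<nu> $ i)}"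
        "\<beta> \<in> {nat (\<mu> $ i) + 1..nat (\<mu> $ i) + nat (\<nu> $ i)}" "\<alpha> < \<beta>"
      then show "snd ((\<pi> \<circ> \<rho>) (i, \<alpha>)) < snd ((\<pi> \<circ> \<rho>) (i, \<beta>))"
        using *[of "\<alpha> - n1 i" "\<beta> - n1 i"] by (auto simp: n1_def n2_def)
    qed
  qed
  moreover have "same_splitting \<mu> \<nu> (\<pi> \<circ> \<rho>) \<pi>"
    unfolding same_splitting_def
    by (rule bexI[OF _ \<rho>\<^sub>1], rule bexI[OF _ \<rho>\<^sub>2]) (simp add: \<rho>1 \<rho>2)
  ultimately show ?thesis by blast
qed

text \<open>
  A shuffle is increasing on both blocks, and the set of the first ones determines that of the second ones as
  its complement.
\<close>

lemma shuffle_unique: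
  assumes nonneg: "nonneg \<mu>" "nonneg \<nu>" and \<pi>: "\<pi> \<in> shuffle_perms \<mu> \<nu>" "\<pi>' \<in> shuffle_perms \<mu> \<nu>"
    and eq: "\<pi> ` vars \<mu> = \<pi>' ` vars \<mu>"
  shows "\<pi> = \<pi>'"
proof
  fix v :: "'a var"
  define n1 n2 where "n1 i = nat (\<mu> $ i)" and "n2 i = nat (\<nu> $ i)" for i
  have sym: "\<pi> \<in> sym_group (\<mu> + \<nu>)" "\<pi>' \<in> sym_group (\<mu> + \<nu>)"
    using \<pi> by (auto simp: shuffle_perms_def)
  have first: "(\<lambda>\<alpha>. snd (\<pi> (i, \<alpha>))) ` {1..n1 i} = {\<beta>. (i, \<beta>) \<in> \<pi> ` vars \<mu>}"
    if "\<pi> \<in> sym_group (\<mu> + \<nu>)" for \<pi> i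
    using sym_groupD(2)[OF that]
    by (force simp: vars_eq_Sigma n1_def image_iff prod_eq_iff)
  have second: "(\<lambda>\<alpha>. snd (\<pi> (i, \<alpha>))) ` {n1 i + 1..n1 i + n2 i}
      = {\<beta>. (i, \<beta>) \<in> vars (\<mu> + \<nu>) - \<pi> ` vars \<mu>}"
    if "\<pi> \<in> sym_group (\<mu> + \<nu>)" for \<pi> i
  proof -
    have "vars (\<mu> + \<nu>) - \<pi> ` vars \<mu> = \<pi> ` (vars (\<mu> + \<nu>) - vars \<mu>)"
      using sym_groupD(4,5)[OF that] by (metis image_set_diff)
    moreover have "vars (\<mu> + \<nu>) - vars \<mu> = Sigma UNIV (\<lambda>i. {n1 i + 1..n1 i + n2 i})"
      using nonneg by (auto simp: vars_eq_Sigma n1_def n2_def nat_add_distrib)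
    ultimately show ?thesis
      using sym_groupD(2)[OF that] by (force simp: image_iff prod_eq_iff)
  qed
  obtain i \<alpha> where v: "v = (i, \<alpha>)" by (cases v)
  consider "\<alpha> \<in> {1..n1 i}" | "\<alpha> \<in> {n1 i + 1..n1 i + n2 i}" | "v \<notin> vars (\<mu> + \<nu>)"
    using nonneg by (force simp: v vars_eq_Sigma n1_def n2_def nat_add_distrib)
  then have "snd (\<pi> v) = snd (\<pi>' v)"
  proof cases
    case 1
    have "(\<lambda>\<alpha>. snd (\<pi> (i, \<alpha>))) \<alpha> = (\<lambda>\<alpha>. snd (\<pi>' (i, \<alpha>))) \<alpha>"
      by (rule strict_mono_on_unique[of "{1..n1 i}", OF _ _ _ 1], unfold first[OF sym(1)] first[OF sym(2)])
         (use \<pi> eq in \<open>simp_all add: shuffle_perms_def n1_def\<close>)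
    then show ?thesis by (simp add: v)
  next
    case 2
    have "(\<lambda>\<alpha>. snd (\<pi> (i, \<alpha>))) \<alpha> = (\<lambda>\<alpha>. snd (\<pi>' (i, \<alpha>))) \<alpha>"
      by (rule strict_mono_on_unique[of "{n1 i + 1..n1 i + n2 i}", OF _ _ _ 2], unfold second[OF sym(1)] second[OF sym(2)])
         (use \<pi> eq in \<open>simp_all add: shuffle_perms_def n1_def n2_def\<close>)
    then show ?thesis by (simp add: v)
  next
    case 3
    then show ?thesis using sym_groupD(1)[OF sym(1)] sym_groupD(1)[OF sym(2)] by (simp add: permutes_not_in)
  qed
  then show "\<pi> v = \<pi>' v"
    using sym_groupD(2)[OF sym(1)] sym_groupD(2)[OF sym(2)] by (simp add: prod_eq_iff)
qed

lemma finite_shuffle_perms [simp]: "finite (shuffle_perms \<mu> \<nu>)"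
  by (rule finite_subset[OF _ finite_permutations[of "vars (\<mu> + \<nu>)"]])
     (auto simp: shuffle_perms_def sym_group_def)

text \<open>
  Shuffles represent the cosets of \<open>S\<^bsub>\<mu>\<^esub> \<times> S\<^bsub>\<nu>\<^esub>\<close>, so that translation by \<open>\<tau>\<close>, followed by sorting,
  permutes them.
\<close>

lemma sum_shuffles_translate:
  assumes nonneg: "nonneg \<mu>" "nonneg \<nu>" and \<tau>: "\<tau> \<in> sym_group (\<mu> + \<nu>)"
    and T: "\<And>\<pi> \<pi>'. same_splitting \<mu> \<nu> \<pi>' \<pi> \<Longrightarrow> T \<pi>' = T \<pi>"
  shows "(\<Sum>\<pi>\<in>shuffle_perms \<mu> \<nu>. T (\<tau> \<circ> \<pi>)) = (\<Sum>\<pi>\<in>shuffle_perms \<mu> \<nu>. T \<pi>)"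
proof -
  let ?S = "shuffle_perms \<mu> \<nu>"
  have "\<exists>\<pi>'\<in>?S. same_splitting \<mu> \<nu> \<pi>' (\<tau> \<circ> \<pi>)" if "\<pi> \<in> ?S" for \<pi>
    by (rule shuffle_of_permutation[OF nonneg sym_group_comp[OF \<tau>]]) (use that in \<open>simp add: shuffle_perms_def\<close>)
  then obtain \<Phi> where \<Phi>: "\<And>\<pi>. \<pi> \<in> ?S \<Longrightarrow> \<Phi> \<pi> \<in> ?S" "\<And>\<pi>. \<pi> \<in> ?S \<Longrightarrow> same_splitting \<mu> \<nu> (\<Phi> \<pi>) (\<tau> \<circ> \<pi>)"
    by metis
  have inj: "inj_on \<Phi> ?S"
  proof (rule inj_onI)
    fix \<pi> \<pi>' assume *: "\<pi> \<in> ?S" "\<pi>' \<in> ?S" "\<Phi> \<pi> = \<Phi> \<pi>'"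
    then have "(\<tau> \<circ> \<pi>) ` vars \<mu> = (\<tau> \<circ> \<pi>') ` vars \<mu>"
      using same_splitting_image[OF \<Phi>(2)[OF *(1)]] same_splitting_image[OF \<Phi>(2)[OF *(2)]] by simp
    then have "\<pi> ` vars \<mu> = \<pi>' ` vars \<mu>"
      using sym_groupD(4)[OF \<tau>] by (simp only: image_comp[symmetric] inj_image_eq_iff)
    then show "\<pi> = \<pi>'" using shuffle_unique[OF nonneg] * by blast
  qed
  have "bij_betw \<Phi> ?S ?S"
    unfolding bij_betw_def using inj \<Phi>(1) by (intro conjI endo_inj_surj) auto
  have "(\<Sum>\<pi>\<in>?S. T (\<tau> \<circ> \<pi>)) = (\<Sum>\<pi>\<in>?S. T (\<Phi> \<pi>))"
    by (intro sum.cong refl T[symmetric] \<Phi>(2))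
  also have "\<dots> = sum T ?S"
    by (rule sum.reindex_bij_betw) fact
  finally show ?thesis .
qed

section \<open>The product of the K-theoretical Hall algebra is integral\<close>

definition kha_term ::
  "('i :: {finite, linorder} \<Rightarrow> 'i \<Rightarrow> nat) \<Rightarrow> 'i dimvec \<Rightarrow> 'i dimvec \<Rightarrow> 'i var laurent \<Rightarrow> 'i var laurent
    \<Rightarrow> ('i var \<Rightarrow> 'k) \<Rightarrow> ('i var \<Rightarrow> 'k) \<Rightarrow> 'k :: field" where
  "kha_term a \<mu> \<nu> f g z' z'' = laurent_eval z' f * laurent_eval z'' g * kha_kernel a \<mu> \<nu> z' z''"

text \<open>
  The sum that defines the product, at an arbitrary point of an arbitrary field. This makes it possible to
  transport it along field homomorphisms, in particular along permutations of the variables and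
  from Laurent polynomials to power series.
\<close>

definition kha_sum ::
  "('i :: {finite, linorder} \<Rightarrow> 'i \<Rightarrow> nat) \<Rightarrow> 'i dimvec \<Rightarrow> 'i dimvec \<Rightarrow> 'i var laurent \<Rightarrow> 'i var laurent
    \<Rightarrow> ('i var \<Rightarrow> 'k) \<Rightarrow> 'k :: field" where
  "kha_sum a \<mu> \<nu> f g u = (\<Sum>\<pi>\<in>shuffle_perms \<mu> \<nu>.
     kha_term a \<mu> \<nu> f g (\<lambda>v. u (\<pi> v)) (\<lambda>v. u (\<pi> (shift \<mu> v))))"

lemma kha_mult_eq: "kha_mult a \<mu> \<nu> f g = from_fract (kha_sum a \<mu> \<nu> f g generic_point)"
  by (simp add: kha_mult_def kha_sum_def kha_term_def comp_def Let_def)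

lemma field_hom_kha_sum:
  assumes "field_hom F"
  shows "F (kha_sum a \<mu> \<nu> f g u) = kha_sum a \<mu> \<nu> f g (\<lambda>v. F (u v))"
  by (simp add: kha_sum_def kha_term_def kha_kernel_def field_hom_simps[OF assms]
      field_hom_laurent_eval[OF assms])

lemma kha_comp_invariant:
  assumes "f \<in> kha_comp \<gamma>" "nonneg \<gamma>" "\<rho> \<in> sym_group \<gamma>"
  shows "laurent_eval (\<lambda>v. u (\<rho> v)) f = laurent_eval u f"
proof -
  have bij: "bij \<rho>" using sym_groupD[OF assms(3)] by blast
  have "laurent_rename \<rho> f = f"
    using assms by (intro poly_mapping_eqI) (simp add: lookup_laurent_rename[OF bij] kha_comp_def)
  then show ?thesis using laurent_eval_rename[OF bij, of u f] by (simp add: comp_def)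
qed

lemma kha_comp_cong:
  assumes "f \<in> kha_comp \<gamma>" "nonneg \<gamma>" "\<And>v. v \<in> vars \<gamma> \<Longrightarrow> u v = u' v"
  shows "laurent_eval u f = laurent_eval u' f"
proof (rule laurent_eval_cong, rule assms(3))
  fix m v assume "m \<in> Poly_Mapping.keys f" "v \<in> Poly_Mapping.keys m"
  then show "v \<in> vars \<gamma>" using assms(1,2) unfolding kha_comp_def by auto
qed

lemma ratio_cross_prod_permute:
  assumes "\<rho>\<^sub>1 \<in> sym_group \<mu>" "\<rho>\<^sub>2 \<in> sym_group \<nu>"
    and "\<And>v. v \<in> vars \<mu> \<Longrightarrow> y' v = z' (\<rho>\<^sub>1 v)" "\<And>v. v \<in> vars \<nu> \<Longrightarrow> y'' v = z'' (\<rho>\<^sub>2 v)"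
  shows "ratio_cross_prod e \<mu> \<nu> y' y'' = ratio_cross_prod e \<mu> \<nu> z' z''"
proof -
  let ?F = "\<lambda>(v, w). (1 - z' v * inverse (z'' w)) ^ e (fst v) (fst w)"
  have "bij_betw (map_prod \<rho>\<^sub>1 \<rho>\<^sub>2) (vars \<mu> \<times> vars \<nu>) (vars \<mu> \<times> vars \<nu>)"
    by (intro bij_betw_map_prod permutes_imp_bij sym_groupD(1) assms(1,2))
  from prod.reindex_bij_betw[OF this, of ?F]
  have "(\<Prod>r\<in>vars \<mu> \<times> vars \<nu>. ?F (map_prod \<rho>\<^sub>1 \<rho>\<^sub>2 r)) = ratio_cross_prod e \<mu> \<nu> z' z''"
    by (simp add: ratio_cross_prod_def)
  moreover have "ratio_cross_prod e \<mu> \<nu> y' y'' = (\<Prod>r\<in>vars \<mu> \<times> vars \<nu>. ?F (map_prod \<rho>\<^sub>1 \<rho>\<^sub>2 r))"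
    unfolding ratio_cross_prod_def
    by (rule prod.cong) (auto simp: assms(3,4) sym_groupD(2)[OF assms(1)] sym_groupD(2)[OF assms(2)])
  ultimately show ?thesis by simp
qed

lemma kha_term_same_splitting:
  assumes f: "f \<in> kha_comp \<mu>" "g \<in> kha_comp \<nu>" and nonneg: "nonneg \<mu>" "nonneg \<nu>"
    and "same_splitting \<mu> \<nu> \<pi>' \<pi>"
  shows "kha_term a \<mu> \<nu> f g (\<lambda>v. u (\<pi>' v)) (\<lambda>v. u (\<pi>' (shift \<mu> v)))
    = kha_term a \<mu> \<nu> f g (\<lambda>v. u (\<pi> v)) (\<lambda>v. u (\<pi> (shift \<mu> v)))"
proof -
  from assms(5) obtain \<rho>\<^sub>1 \<rho>\<^sub>2 where \<rho>: "\<rho>\<^sub>1 \<in> sym_group \<mu>" "\<rho>\<^sub>2 \<in> sym_group \<nu>"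
    "\<And>v. v \<in> vars \<mu> \<Longrightarrow> \<pi>' v = \<pi> (\<rho>\<^sub>1 v)" "\<And>v. v \<in> vars \<nu> \<Longrightarrow> \<pi>' (shift \<mu> v) = \<pi> (shift \<mu> (\<rho>\<^sub>2 v))"
    by (auto simp: same_splitting_def)
  have "laurent_eval (\<lambda>v. u (\<pi>' v)) f = laurent_eval (\<lambda>v. u (\<pi> (\<rho>\<^sub>1 v))) f"
    by (rule kha_comp_cong[OF f(1) nonneg(1)]) (simp add: \<rho>)
  also have "\<dots> = laurent_eval (\<lambda>v. u (\<pi> v)) f"
    by (rule kha_comp_invariant[OF f(1) nonneg(1) \<rho>(1)])
  finally have 1: "laurent_eval (\<lambda>v. u (\<pi>' v)) f = laurent_eval (\<lambda>v. u (\<pi> v)) f" .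
  have "laurent_eval (\<lambda>v. u (\<pi>' (shift \<mu> v))) g = laurent_eval (\<lambda>v. u (\<pi> (shift \<mu> (\<rho>\<^sub>2 v)))) g"
    by (rule kha_comp_cong[OF f(2) nonneg(2)]) (simp add: \<rho>)
  also have "\<dots> = laurent_eval (\<lambda>v. u (\<pi> (shift \<mu> v))) g"
    by (rule kha_comp_invariant[OF f(2) nonneg(2) \<rho>(2)])
  finally have 2: "laurent_eval (\<lambda>v. u (\<pi>' (shift \<mu> v))) g = laurent_eval (\<lambda>v. u (\<pi> (shift \<mu> v))) g" .
  have "ratio_cross_prod e \<mu> \<nu> (\<lambda>v. u (\<pi>' v)) (\<lambda>v. u (\<pi>' (shift \<mu> v)))
      = ratio_cross_prod e \<mu> \<nu> (\<lambda>v. u (\<pi> v)) (\<lambda>v. u (\<pi> (shift \<mu> v)))" for e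
    by (rule ratio_cross_prod_permute[OF \<rho>(1,2)]) (simp_all add: \<rho>)
  with 1 2 show ?thesis by (simp add: kha_term_def kha_kernel_eq)
qed

lemma kha_sum_permute:
  assumes f: "f \<in> kha_comp \<mu>" "g \<in> kha_comp \<nu>" and nonneg: "nonneg \<mu>" "nonneg \<nu>"
    and \<tau>: "\<tau> \<in> sym_group (\<mu> + \<nu>)"
  shows "kha_sum a \<mu> \<nu> f g (\<lambda>v. u (\<tau> v)) = kha_sum a \<mu> \<nu> f g u"
  using sum_shuffles_translate[OF nonneg \<tau>,
      of "\<lambda>\<pi>. kha_term a \<mu> \<nu> f g (\<lambda>v. u (\<pi> v)) (\<lambda>v. u (\<pi> (shift \<mu> v)))",
      OF kha_term_same_splitting[OF f nonneg]]
  by (simp add: kha_sum_def)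

lemma cross_prod_eq_ratio:
  assumes "\<And>w. z'' w \<noteq> 0"
  shows "cross_prod e \<mu> \<nu> z' z''
    = ratio_cross_prod e \<mu> \<nu> z' z'' * (\<Prod>(v, w)\<in>vars \<mu> \<times> vars \<nu>. z'' w ^ e (fst v) (fst w))"
proof -
  have "z'' w - z' v = (1 - z' v * inverse (z'' w)) * z'' w" for v w
    by (simp add: assms left_diff_distrib)
  then show ?thesis
    by (simp add: cross_prod_def ratio_cross_prod_def case_prod_beta power_mult_distrib prod.distrib)
qed

lemma same_vertex_sym: "same_vertex i j = same_vertex j i"
  by (simp add: same_vertex_def)

abbreviation integral_fract :: "'a :: idom fract \<Rightarrow> bool" where
  "integral_fract q \<equiv> q \<in> range to_fract"

lemma integral_fract_intros:
  "integral_fract (to_fract x)"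
  "integral_fract p \<Longrightarrow> integral_fract q \<Longrightarrow> integral_fract (p + q)"
  "integral_fract p \<Longrightarrow> integral_fract q \<Longrightarrow> integral_fract (p - q)"
  "integral_fract p \<Longrightarrow> integral_fract q \<Longrightarrow> integral_fract (p * q)"
  "integral_fract 0" "integral_fract 1" "integral_fract (of_int n)"
  by (auto simp flip: to_fract_add to_fract_diff to_fract_mult to_fract_0 to_fract_1 to_fract_of_int)

lemma integral_fract_power: "integral_fract p \<Longrightarrow> integral_fract (p ^ n)"
  by (induction n) (auto intro: integral_fract_intros simp del: power_Suc simp add: power_Suc)

lemma integral_fract_prod: "(\<And>a. a \<in> A \<Longrightarrow> integral_fract (f a)) \<Longrightarrow> integral_fract (prod f A)"
  by (induction A rule: infinite_finite_induct) (simp_all add: integral_fract_intros)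

lemma integral_fract_sum: "(\<And>a. a \<in> A \<Longrightarrow> integral_fract (f a)) \<Longrightarrow> integral_fract (sum f A)"
  by (induction A rule: infinite_finite_induct) (simp_all add: integral_fract_intros)

lemma integral_fract_laurent_eval:
  assumes "\<And>v. integral_fract (u v)" "\<And>v. integral_fract (inverse (u v))"
  shows "integral_fract (laurent_eval u f)"
  unfolding laurent_eval_def power_int_def
  using assms by (intro integral_fract_sum integral_fract_intros(4,7) integral_fract_prod)
    (auto intro: integral_fract_power)

lemma integral_fract_pair_prod:
  assumes "\<And>v. integral_fract (u v)"
  shows "integral_fract (pair_prod e \<gamma> u)"
  unfolding pair_prod_def
  by (intro integral_fract_prod) (auto simp: assms intro!: integral_fract_power integral_fract_intros(3))

lemma square_eq_one_cases: "s = 1 \<or> s = -1" if "s * s = 1" for s :: "'k :: idom"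
  using that square_eq_1_iff by blast

text \<open>
  The product of the Vandermonde determinants of all vertices contains the denominator of each summand as a
  factor: up to a monomial, this denominator is the product of the differences over the mixed pairs
  at the same vertex.
\<close>

lemma integral_vandermonde_mult_kha_sum:
  assumes nonneg: "nonneg \<mu>" "nonneg \<nu>"
  shows "integral_fract (pair_prod same_vertex (\<mu> + \<nu>) generic_point * kha_sum a \<mu> \<nu> f g generic_point)"
  unfolding kha_sum_def sum_distrib_left
proof (rule integral_fract_sum)
  fix \<pi> assume "\<pi> \<in> shuffle_perms \<mu> \<nu>"
  then have \<pi>: "\<pi> \<in> sym_group (\<mu> + \<nu>)" by (simp add: shuffle_perms_def)
  let ?z' = "\<lambda>v. generic_point (\<pi> v)" and ?z'' = "\<lambda>v. generic_point (\<pi> (shift \<mu> v))"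
  let ?\<Delta> = "pair_prod same_vertex"
  obtain s :: "'a var laurent fract" where s: "s * s = 1"
    and split: "\<And>x. ?\<Delta> \<mu> (\<lambda>v. x (\<pi> v)) * ?\<Delta> \<nu> (\<lambda>v. x (\<pi> (shift \<mu> v)))
        * cross_prod same_vertex \<mu> \<nu> (\<lambda>v. x (\<pi> v)) (\<lambda>v. x (\<pi> (shift \<mu> v)))
      = s * ?\<Delta> (\<mu> + \<nu>) x"
    by (rule pair_prod_split[of same_vertex, OF same_vertex_sym nonneg \<pi>]) (rule that)
  let ?D = "ratio_cross_prod same_vertex \<mu> \<nu> ?z' ?z''"
  \<comment> \<open>\<open>W\<close> is the quotient of the Vandermonde determinants by the denominator \<open>?D\<close> of the summand.\<close>
  define W where "W = s * (?\<Delta> \<mu> ?z' * ?\<Delta> \<nu> ?z'' *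
    (\<Prod>(v, w)\<in>vars \<mu> \<times> vars \<nu>. ?z'' w ^ same_vertex (fst v) (fst w)))"
  have "?\<Delta> (\<mu> + \<nu>) generic_point = s * (s * ?\<Delta> (\<mu> + \<nu>) generic_point)"
    using s by (simp flip: mult.assoc)
  also have "\<dots> = W * ?D"
    unfolding split[symmetric] W_def by (subst cross_prod_eq_ratio) (simp_all add: mult_ac)
  finally have \<Delta>: "?\<Delta> (\<mu> + \<nu>) generic_point = W * ?D" .
  have int: "integral_fract (generic_point v)" "integral_fract (inverse (generic_point v))" for v :: "'a var"
    by (simp_all add: inverse_generic_point)
  have "integral_fract s" using square_eq_one_cases[OF s] integral_fract_intros(7)[of 1] integral_fract_intros(7)[of "-1"] by auto
  then have W: "integral_fract W"
    unfolding W_def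
    by (intro integral_fract_intros(4) integral_fract_pair_prod integral_fract_prod)
       (auto intro!: integral_fract_power integral_fract_intros(1))
  let ?N = "laurent_eval ?z' f * laurent_eval ?z'' g * ratio_cross_prod a \<mu> \<nu> ?z' ?z''"
  have N: "integral_fract ?N"
    unfolding ratio_cross_prod_def
    by (intro integral_fract_intros(4) integral_fract_laurent_eval integral_fract_prod int)
       (auto intro!: integral_fract_power integral_fract_intros(3,4,6) int)
  \<comment> \<open>For \<open>?D = 0\<close> both sides are zero, as division by zero yields zero.\<close>
  have "?\<Delta> (\<mu> + \<nu>) generic_point * kha_term a \<mu> \<nu> f g ?z' ?z''
      = W * ?N * (if ?D = 0 then 0 else 1)"
    by (simp add: \<Delta> kha_term_def kha_kernel_eq)
  moreover have "integral_fract (W * ?N * (if ?D = 0 then 0 else 1))"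
    by (intro integral_fract_intros(4)[OF integral_fract_intros(4)[OF W N]])
       (simp add: integral_fract_intros(5,6))
  ultimately show "integral_fract (?\<Delta> (\<mu> + \<nu>) generic_point * kha_term a \<mu> \<nu> f g ?z' ?z'')"
    by simp
qed

lemma transpose_sym_group:
  assumes "v \<in> vars \<gamma>" "w \<in> vars \<gamma>" "fst v = fst w"
  shows "transpose v w \<in> sym_group \<gamma>"
proof -
  have "fst (transpose v w x) = fst x" for x
    using assms(3) by (simp add: transpose_def)
  then show ?thesis
    using permutes_swap_id[OF assms(1,2)] by (simp add: sym_group_def)
qed

lemma same_value_iff:
  assumes "v \<noteq> w" "p \<noteq> q"
  shows "(generic_point(v := generic_point w)) p = (generic_point(v := generic_point w)) q \<longleftrightarrow> {p, q} = {v, w}"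
  using assms by (auto simp: doubleton_eq_iff)

text \<open>
  The factor of the pair \<open>{v, w}\<close> changes its sign. The product of the remaining factors is
  preserved up to a sign \<open>s\<close> that does not depend on the point, and \<open>s = 1\<close> is seen at a point fixed by the
  transposition at which none of these factors vanishes, namely \<open>z(v := z\<^sub>w)\<close>.
\<close>

lemma vandermonde_transpose:
  fixes v w :: "'i :: {finite, linorder} var"
  assumes vw: "v \<in> vars \<gamma>" "w \<in> vars \<gamma>" "fst v = fst w" "v \<noteq> w"
  shows "pair_prod same_vertex \<gamma> (\<lambda>x. generic_point (transpose v w x)) = - pair_prod same_vertex \<gamma> generic_point"
proof -
  define V where "V = vars \<gamma>"
  define \<tau> where "\<tau> = transpose v w"
  define B where "B = {v, w}"
  define U where "U = unordered_pairs V - {B}"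
  let ?P = "unordered_prod same_vertex :: _ \<Rightarrow> _ \<Rightarrow> 'i var laurent fract"
  have \<tau>: "\<tau> \<in> sym_group \<gamma>" unfolding \<tau>_def by (rule transpose_sym_group[OF vw(1-3)])
  note \<tau>D = sym_groupD[OF \<tau>]
  have B: "B \<in> unordered_pairs V" unfolding B_def V_def by (rule unordered_pairsI) (use vw in auto)
  have finU: "finite (unordered_pairs V)" by (simp add: V_def)
  have split: "?P (unordered_pairs V) x = (x (Max B) - x (Min B)) * ?P U x" for x
  proof -
    have "same_vertex (fst (Min B)) (fst (Max B)) = 1"
      using vw(3,4) by (auto simp: B_def same_vertex_def min_def max_def)
    then show ?thesis
      unfolding unordered_prod_def U_def by (subst prod.remove[OF finU B]) simp
  qed
  have two: "Min C \<noteq> Max C" "{Min C, Max C} = C" if "C \<in> U" for C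
  proof -
    from that have "C \<in> unordered_pairs V" by (simp add: U_def)
    then obtain p q where "C = {p, q}" "p \<noteq> q" "p \<in> V" "q \<in> V"
      by (elim unordered_pairsE)
    then show "Min C \<noteq> Max C" "{Min C, Max C} = C" by (auto simp: min_def max_def)
  qed
  have \<tau>\<tau>: "\<tau> (\<tau> x) = x" for x by (simp add: \<tau>_def)
  have image: "\<tau> ` C \<in> U" if "C \<in> U" for C
  proof -
    have "\<tau> ` C \<subseteq> V" "card (\<tau> ` C) = 2"
      using that \<tau>D(5) card_image[of \<tau> C] inj_on_subset[OF \<tau>D(4)]
      by (auto simp: U_def unordered_pairs_def V_def)
    moreover have "\<tau> ` C \<noteq> B"
    proof
      assume "\<tau> ` C = B"
      then have "\<tau> ` \<tau> ` C = \<tau> ` B" by simp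
      then have "C = B" by (simp add: image_image \<tau>\<tau>) (auto simp: B_def \<tau>_def)
      with that show False by (simp add: U_def)
    qed
    ultimately show ?thesis by (simp add: U_def unordered_pairs_def)
  qed
  have "bij_betw (\<lambda>C. \<tau> ` C) U U"
    by (rule bij_betw_byWitness[where f' = "\<lambda>C. \<tau> ` C"]) (auto simp: image_image \<tau>\<tau> image)
  moreover have "\<tau> ` C = {\<tau> (Min C), \<tau> (Max C)}" if "C \<in> U" for C
    using arg_cong[OF two(2)[OF that], of "\<lambda>X. \<tau> ` X"] by simp
  ultimately have bij: "bij_betw (\<lambda>C. {\<tau> (Min C), \<tau> (Max C)}) U U"
    by (simp cong: bij_betw_cong)
  have neq: "\<tau> (Min C) \<noteq> \<tau> (Max C)" if "C \<in> U" for C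
    using two(1)[OF that] injD[OF \<tau>D(4)] by blast
  obtain s :: "'i var laurent fract" where s: "s * s = 1"
    "\<And>x. (\<Prod>C\<in>U. (x (\<tau> (Max C)) - x (\<tau> (Min C))) ^ same_vertex (fst (\<tau> (Min C))) (fst (\<tau> (Max C)))) = s * ?P U x"
    by (rule unordered_prod_reorder[of same_vertex, OF same_vertex_sym bij neq]) (assumption, rule that)
  have s2: "?P U (\<lambda>y. x (\<tau> y)) = s * ?P U x" for x
    using s(2)[of x] by (simp add: unordered_prod_def \<tau>D(2))
  let ?u = "generic_point(v := generic_point w)"
  have "?P U ?u \<noteq> 0"
  proof -
    have "?u (Max C) - ?u (Min C) \<noteq> 0" if "C \<in> U" for C
      using same_value_iff[OF vw(4) two(1)[OF that]] two(2)[OF that] that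
      unfolding U_def B_def by auto
    then show ?thesis using finU by (auto simp: unordered_prod_def U_def)
  qed
  moreover have "(\<lambda>y. ?u (\<tau> y)) = ?u"
    by (auto simp: \<tau>_def transpose_def)
  ultimately have "s = 1" using s2[of ?u] by simp
  obtain t :: "'i var laurent fract" where t: "t * t = 1"
    "\<And>x. pair_prod same_vertex \<gamma> (\<lambda>y. x y) = t * ?P (unordered_pairs ((\<lambda>y. y) ` vars \<gamma>)) x"
    by (rule pair_prod_reorder[of same_vertex "\<lambda>y. y" \<gamma>, OF same_vertex_sym inj_on_id2 refl]) (rule that)
  have expand: "pair_prod same_vertex \<gamma> x = t * ((x (Max B) - x (Min B)) * ?P U x)" for x
    using t(2)[of x] unfolding image_ident V_def[symmetric] split .
  have flip: "generic_point (\<tau> (Max B)) - generic_point (\<tau> (Min B))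
      = - (generic_point (Max B) - generic_point (Min B) :: 'i var laurent fract)"
    by (auto simp: B_def \<tau>_def min_def max_def)
  have "pair_prod same_vertex \<gamma> (\<lambda>x. generic_point (\<tau> x)) = - pair_prod same_vertex \<gamma> generic_point"
    unfolding expand flip s2[of generic_point] \<open>s = 1\<close>
    by (simp only: mult_1_left mult_minus_left mult_minus_right)
  then show ?thesis by (simp add: \<tau>_def)
qed

lemma laurent_permutation_hom:
  assumes "bij \<tau>"
  obtains F where "field_hom F" "\<And>f :: 'v :: linorder laurent. F (to_fract f) = to_fract (laurent_rename \<tau> f)"
proof -
  have eval: "to_fract (laurent_rename \<tau> f) = laurent_eval (generic_point \<circ> \<tau>) f" for f :: "'v laurent"
    using laurent_eval_rename[OF assms, of generic_point f] by (simp add: laurent_eval_generic)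
  have nz: "(generic_point \<circ> \<tau>) v \<noteq> 0" for v by simp
  show ?thesis
  proof (rule fract_extension[of "\<lambda>f :: 'v laurent. to_fract (laurent_rename \<tau> f)"])
    fix f g :: "'v laurent"
    show "to_fract (laurent_rename \<tau> (f + g)) = to_fract (laurent_rename \<tau> f) + to_fract (laurent_rename \<tau> g)"
      unfolding eval by (rule laurent_eval_add)
    show "to_fract (laurent_rename \<tau> (f * g)) = to_fract (laurent_rename \<tau> f) * to_fract (laurent_rename \<tau> g)"
      unfolding eval by (rule laurent_eval_mult[OF nz])
    show "to_fract (laurent_rename \<tau> (1 :: 'v laurent)) = 1"
      unfolding eval by (rule laurent_eval_1)
    show "f = 0" if "to_fract (laurent_rename \<tau> f) = 0"
      using that laurent_rename_eq_0[OF assms] by simp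
  qed (rule that)
qed

text \<open>
  The point \<open>z(v := z\<^sub>w)\<close> is fixed by the transposition, so the value of \<open>G\<close> there equals its negative.
\<close>

lemma antisymmetric_vanishes:
  fixes v w :: "'v :: linorder"
  assumes "v \<noteq> w" "laurent_rename (transpose v w) G = - G"
  shows "laurent_var v - laurent_var w dvd G"
proof -
  let ?u = "generic_point(v := generic_point w)"
  have "laurent_eval ?u G = laurent_eval (?u \<circ> transpose v w) G"
    by (rule arg_cong[of _ _ "\<lambda>u. laurent_eval u G"]) (auto simp: transpose_def)
  also have "\<dots> = laurent_eval ?u (- G)"
    using assms(2) by (simp flip: laurent_eval_rename)
  also have "\<dots> = - laurent_eval ?u G"
    using laurent_eval_diff[of ?u 0 G] by simp
  finally have "laurent_eval ?u G + laurent_eval ?u G = 0"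
    by (simp only: eq_neg_iff_add_eq_0)
  then have "to_fract (1 + 1 :: 'v laurent) * laurent_eval ?u G = 0"
    by (simp only: to_fract_add to_fract_1 distrib_right mult_1_left)
  moreover have "to_fract (1 + 1 :: 'v laurent) \<noteq> 0"
    unfolding to_fract_eq_0_iff by simp
  ultimately have "laurent_eval ?u G = 0" by (simp only: mult_eq_0_iff simp_thms)
  then show ?thesis by (rule laurent_var_diff_dvd)
qed

lemma pair_prod_same_vertex:
  "pair_prod same_vertex \<gamma> x = (\<Prod>(v, w) | v \<in> vars \<gamma> \<and> w \<in> vars \<gamma> \<and> v < w \<and> fst v = fst w. x w - x v)"
  unfolding pair_prod_def
  by (rule prod.mono_neutral_cong_right)
     (auto simp: same_vertex_def split: if_splits intro: finite_subset[of _ "vars \<gamma> \<times> vars \<gamma>"])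

text \<open>
  \<open>G\<close>, the product of the symmetric sum with the Vandermonde determinants, is an antisymmetric Laurent polynomial.
  Hence it is divisible by the determinants, and the sum itself is a Laurent polynomial.
\<close>

lemma to_fract_kha_mult:
  assumes f: "f \<in> kha_comp \<mu>" "g \<in> kha_comp \<nu>" and nonneg: "nonneg \<mu>" "nonneg \<nu>"
  shows "to_fract (kha_mult a \<mu> \<nu> f g) = kha_sum a \<mu> \<nu> f g generic_point"
proof -
  define \<gamma> where "\<gamma> = \<mu> + \<nu>"
  let ?Q = "kha_sum a \<mu> \<nu> f g generic_point"
  let ?\<Delta> = "pair_prod same_vertex \<gamma>"
  obtain G where G: "to_fract G = ?\<Delta> generic_point * ?Q"
    using integral_vandermonde_mult_kha_sum[OF nonneg, of a f g] unfolding \<gamma>_def by (metis imageE)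
  have dvd: "laurent_var v - laurent_var w dvd G"
    if vw: "v \<in> vars \<gamma>" "w \<in> vars \<gamma>" "fst v = fst w" "v \<noteq> w" for v w
  proof (rule antisymmetric_vanishes[OF vw(4)])
    let ?\<tau> = "transpose v w"
    have \<tau>: "?\<tau> \<in> sym_group \<gamma>" by (rule transpose_sym_group[OF vw(1-3)])
    then have bij: "bij ?\<tau>" by (rule sym_groupD)
    obtain F where F: "field_hom F" "\<And>f. F (to_fract f) = to_fract (laurent_rename ?\<tau> f)"
      using laurent_permutation_hom[OF bij] by blast
    have var: "F (generic_point x) = generic_point (?\<tau> x)" for x
      using laurent_eval_rename[OF bij, of generic_point "laurent_var x"]
      by (simp add: F(2) laurent_eval_generic laurent_eval_var)
    have "to_fract (laurent_rename ?\<tau> G) = F (?\<Delta> generic_point) * F ?Q"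
      by (simp add: F(2)[symmetric] G field_hom_mult[OF F(1)])
    also have "F (?\<Delta> generic_point) = ?\<Delta> (\<lambda>x. generic_point (?\<tau> x))"
      by (simp add: pair_prod_def field_hom_simps[OF F(1)] case_prod_beta var)
    also have "\<dots> = - ?\<Delta> generic_point"
      by (rule vandermonde_transpose[OF vw])
    also have "F ?Q = ?Q"
      using kha_sum_permute[OF f nonneg \<tau>[unfolded \<gamma>_def], of a generic_point]
      by (simp add: field_hom_kha_sum[OF F(1)] var)
    also have "- ?\<Delta> generic_point * ?Q = to_fract (- G)"
      by (simp add: G)
    finally show "laurent_rename ?\<tau> G = - G" by (simp only: to_fract_eq_iff)
  qed
  let ?I = "{(v, w). v \<in> vars \<gamma> \<and> w \<in> vars \<gamma> \<and> v < w \<and> fst v = fst w}"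
  have "(\<Prod>r\<in>?I. laurent_var (snd r) - laurent_var (fst r)) dvd G"
  proof (rule prod_primes_dvd)
    show "finite ?I" by (rule finite_subset[of _ "vars \<gamma> \<times> vars \<gamma>"]) auto
  next
    fix r assume "r \<in> ?I"
    then show "prime_elem (laurent_var (snd r) - laurent_var (fst r))"
      and "laurent_var (snd r) - laurent_var (fst r) dvd G"
      by (auto intro!: prime_elem_laurent_var_diff dvd)
  next
    fix r r' assume r: "r \<in> ?I" "r' \<in> ?I" "r \<noteq> r'"
    then have lt: "fst r < snd r" "fst r' < snd r'" by auto
    then have "{snd r', fst r'} \<noteq> {snd r, fst r}"
      using r(3) by (metis doubleton_eq_iff order_less_asym prod_eqI)
    with lt show "\<not> laurent_var (snd r) - laurent_var (fst r) dvd laurent_var (snd r') - laurent_var (fst r')"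
      using same_value_iff[of "snd r" "fst r" "snd r'" "fst r'"]
      unfolding laurent_var_diff_dvd_iff laurent_eval_diff laurent_eval_var by auto
  qed
  then obtain l where l: "G = (\<Prod>r\<in>?I. laurent_var (snd r) - laurent_var (fst r)) * l" by blast
  have "to_fract (\<Prod>r\<in>?I. laurent_var (snd r) - laurent_var (fst r)) = ?\<Delta> generic_point"
    by (simp add: pair_prod_same_vertex case_prod_beta)
  then have "to_fract G = ?\<Delta> generic_point * to_fract l"
    unfolding l to_fract_mult by (simp only:)
  then have "?\<Delta> generic_point * to_fract l = ?\<Delta> generic_point * ?Q"
    unfolding G by (rule sym)
  moreover have "?\<Delta> generic_point \<noteq> 0"
    unfolding pair_prod_same_vertex
    by (subst prod_zero_iff) (auto intro: finite_subset[of _ "vars \<gamma> \<times> vars \<gamma>"])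
  ultimately have "?Q = to_fract l" by simp
  then show ?thesis by (simp add: kha_mult_eq)
qed

lemma to_fract_chern_kha_mult:
  assumes f: "f \<in> kha_comp \<mu>" "g \<in> kha_comp \<nu>" and nonneg: "nonneg \<mu>" "nonneg \<nu>"
  shows "to_fract (chern (kha_mult a \<mu> \<nu> f g)) = kha_sum a \<mu> \<nu> f g exp_point"
proof -
  have nz: "exp_point v \<noteq> 0" for v :: "'a var" by simp
  obtain F where F: "field_hom F" "\<And>f :: 'a var laurent. F (to_fract f) = laurent_eval exp_point f"
    by (rule fract_extension[of "laurent_eval exp_point :: 'a var laurent \<Rightarrow> _"])
       (auto simp: laurent_eval_add laurent_eval_mult[OF nz] laurent_eval_1 laurent_eval_exp_point_eq_0)
  show ?thesis
    using arg_cong[OF to_fract_kha_mult[OF assms], of F, of a]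
    by (simp add: F(2) field_hom_kha_sum[OF F(1)] laurent_eval_var to_fract_chern)
qed

section \<open>The twisting series\<close>

text \<open>
  Both twists are treated at once: in \<open>signed_exp\<close> and \<open>twist_series\<close>, \<open>c = 1\<close> belongs to \<open>\<eta>\<close> and \<open>c = -1\<close> to
  \<open>\<eta>\<close> with tilde.
\<close>

definition signed_exp :: "int \<Rightarrow> 'v \<Rightarrow> ('v, rat) mfps" where
  "signed_exp c v = mfps_exp (of_int c * mfps_var v)"

definition twist_series ::
  "int \<Rightarrow> ('i :: {finite, linorder} \<Rightarrow> 'i \<Rightarrow> nat) \<Rightarrow> 'i dimvec \<Rightarrow> 'i series" where
  "twist_series c a \<gamma> = from_fract (
     k_expr a \<gamma> (\<lambda>v. to_fract (mfps_var v)) / k_expr a \<gamma> (\<lambda>v. to_fract (signed_exp c v)))"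

lemma eta_eq: "eta = twist_series 1" and eta_tilde_eq: "eta_tilde = twist_series (-1)"
  by (simp_all add: fun_eq_iff eta_def eta_tilde_def twist_series_def signed_exp_def)

lemma signed_exp_diff:
  assumes "c * c = 1"
  obtains u where "signed_exp c v - signed_exp c w = (mfps_var v - mfps_var w) * u" "u dvd 1"
proof -
  obtain u where u: "signed_exp c v - signed_exp c w = (of_int c * mfps_var v - of_int c * mfps_var w) * u"
    "mcoeff u 0 = 1"
    unfolding signed_exp_def
    by (rule mfps_exp_diff[of "of_int c * mfps_var v" "of_int c * mfps_var w"])
       (simp_all add: mcoeff_of_int_mult that)
  have "(of_int c :: ('a, rat) mfps) * of_int c = 1"
    using assms by (metis of_int_1 of_int_mult)
  then have "(of_int c :: ('a, rat) mfps) dvd 1" by (intro dvdI) (rule sym)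
  then have "of_int c * u dvd 1"
    using mult_dvd_mono[OF _ mfps_unit[OF u(2)], of "of_int c" 1] by simp
  then show ?thesis
    by (intro that[of "of_int c * u"]) (simp_all add: u(1) algebra_simps)
qed

lemma inj_signed_exp:
  fixes v w :: "'v :: linorder"
  assumes "c * c = 1" "signed_exp c v = signed_exp c w"
  shows "v = w"
proof -
  obtain u :: "('v, rat) mfps" where u: "signed_exp c v - signed_exp c w = (mfps_var v - mfps_var w) * u" "u dvd 1"
    by (rule signed_exp_diff[OF assms(1)])
  then have "u \<noteq> 0" by auto
  with u(1) assms(2) show ?thesis by simp
qed

lemma pair_prod_nonzero:
  fixes x :: "'i :: {finite, linorder} var \<Rightarrow> 'k :: idom"
  assumes "inj_on x (vars \<gamma>)"
  shows "pair_prod e \<gamma> x \<noteq> 0"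
proof -
  have "finite {(v, w). v \<in> vars \<gamma> \<and> w \<in> vars \<gamma> \<and> v < w}"
    by (rule finite_subset[of _ "vars \<gamma> \<times> vars \<gamma>"]) auto
  then show ?thesis
    unfolding pair_prod_def using assms by (subst prod_zero_iff) (auto simp: inj_on_eq_iff)
qed

lemma pair_prod_signed_exp:
  fixes e :: "'i :: {finite, linorder} \<Rightarrow> 'i \<Rightarrow> nat"
  assumes "c * c = 1"
  obtains u where "pair_prod e \<gamma> (signed_exp c) = pair_prod e \<gamma> mfps_var * u" "u dvd 1"
proof -
  have "\<forall>(v :: 'i var) w. \<exists>u. signed_exp c v - signed_exp c w = (mfps_var v - mfps_var w) * u \<and> u dvd 1"
    using signed_exp_diff[OF assms] by metis
  then obtain U where U: "\<And>(v :: 'i var) w. signed_exp c v - signed_exp c w = (mfps_var v - mfps_var w) * U v w"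
    "\<And>v w. U v w dvd 1" by metis
  show ?thesis
  proof
    let ?I = "{(v, w). v \<in> vars \<gamma> \<and> w \<in> vars \<gamma> \<and> v < w}"
    show "pair_prod e \<gamma> (signed_exp c)
        = pair_prod e \<gamma> mfps_var * (\<Prod>(v, w)\<in>?I. U w v ^ e (fst v) (fst w))"
      by (simp add: pair_prod_def U(1) power_mult_distrib prod.distrib case_prod_beta)
    show "(\<Prod>(v, w)\<in>?I. U w v ^ e (fst v) (fst w)) dvd 1"
    proof -
      have "U w v ^ k dvd 1" for v w k
        using dvd_power_same[OF U(2), of w v k] by simp
      then have "(\<Prod>(v, w)\<in>?I. U w v ^ e (fst v) (fst w)) dvd (\<Prod>_\<in>?I. 1)"
        by (intro prod_dvd_prod) (simp add: split_def)
      then show ?thesis by simp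
    qed
  qed
qed

lemma to_fract_pair_prod: "pair_prod e \<gamma> (\<lambda>v. to_fract (x v)) = to_fract (pair_prod e \<gamma> x)"
  by (simp add: pair_prod_def case_prod_beta)

text \<open>
  Numerator and denominator of \<open>k\<close> each change by a unit when \<open>x\<close> is replaced by the exponentials,
  so the quotient is a power series.
\<close>

lemma to_fract_twist_series:
  assumes "c * c = 1"
  shows "to_fract (twist_series c a \<gamma>)
    = k_expr a \<gamma> (\<lambda>v. to_fract (mfps_var v)) / k_expr a \<gamma> (\<lambda>v. to_fract (signed_exp c v))"
proof -
  let ?N = "pair_prod a \<gamma> mfps_var :: 'a series" and ?D = "pair_prod same_vertex \<gamma> mfps_var :: 'a series"
  obtain u where u: "pair_prod a \<gamma> (signed_exp c) = ?N * u" "u dvd 1"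
    by (rule pair_prod_signed_exp[OF assms])
  obtain u' where u': "pair_prod same_vertex \<gamma> (signed_exp c) = ?D * u'" "u' dvd 1"
    by (rule pair_prod_signed_exp[OF assms])
  obtain w where w: "1 = u * w" using u(2) by blast
  have nz: "?N \<noteq> 0" "?D \<noteq> 0" "u \<noteq> 0" "u' \<noteq> 0"
    using u(2) u'(2) by (auto intro!: pair_prod_nonzero inj_onI)
  have "to_fract u * to_fract w = 1" by (simp flip: to_fract_mult w)
  then have "to_fract w = inverse (to_fract u)" by (metis inverse_unique)
  then have "k_expr a \<gamma> (\<lambda>v. to_fract (mfps_var v)) / k_expr a \<gamma> (\<lambda>v. to_fract (signed_exp c v))
      = to_fract (u' * w)"
    using nz by (simp add: k_expr_eq to_fract_pair_prod u(1) u'(1) field_simps)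
  then show ?thesis unfolding twist_series_def by (simp only: from_fract_to_fract)
qed

lemma k_expr_nonzero:
  assumes "inj_on u (vars \<gamma>)"
  shows "k_expr a \<gamma> u \<noteq> 0"
  using assms by (simp add: k_expr_eq pair_prod_nonzero)

lemma twist_series_nonzero:
  assumes "c * c = 1"
  shows "twist_series c a \<gamma> \<noteq> 0"
proof -
  have "to_fract (twist_series c a \<gamma>) \<noteq> 0"
    unfolding to_fract_twist_series[OF assms]
    by (auto intro!: k_expr_nonzero inj_onI dest: inj_signed_exp[OF assms])
  then show ?thesis by simp
qed

text \<open>
  Denominators are cleared before \<open>r\<close> is applied: the restriction to a set of variables is not
  injective and does not extend to the fraction field.
\<close>

lemma exp_hom_twist_series:
  fixes r :: "'i :: {finite, linorder} series \<Rightarrow> 'i series"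
  assumes c: "c * c = 1" and r: "exp_hom r"
    and var: "\<And>v. v \<in> vars \<gamma> \<Longrightarrow> r (mfps_var v) = mfps_var (\<phi> v)" and inj: "inj_on \<phi> (vars \<gamma>)"
  shows "to_fract (r (twist_series c a \<gamma>))
    = k_expr a \<gamma> (\<lambda>v. to_fract (mfps_var (\<phi> v))) / k_expr a \<gamma> (\<lambda>v. to_fract (signed_exp c (\<phi> v)))"
proof -
  let ?P = "pair_prod :: ('i \<Rightarrow> 'i \<Rightarrow> nat) \<Rightarrow> 'i dimvec \<Rightarrow> ('i var \<Rightarrow> 'i series) \<Rightarrow> 'i series"
  let ?\<eta> = "twist_series c a \<gamma>"
  have nz: "?P e \<gamma> mfps_var \<noteq> 0" "?P e \<gamma> (signed_exp c) \<noteq> 0"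
    "?P e \<gamma> (\<lambda>v. mfps_var (\<phi> v)) \<noteq> 0" "?P e \<gamma> (\<lambda>v. signed_exp c (\<phi> v)) \<noteq> 0" for e
    using inj by (auto intro!: pair_prod_nonzero inj_onI dest!: inj_signed_exp[OF c] simp: inj_on_eq_iff)
  have exp: "r (signed_exp c v) = signed_exp c (\<phi> v)" if "v \<in> vars \<gamma>" for v
    by (simp add: signed_exp_def exp_hom_simps[OF r] var that)
  have rP: "r (?P e \<gamma> x) = ?P e \<gamma> (\<lambda>v. r (x v))" for e x
    by (simp add: pair_prod_def exp_hom_simps[OF r] case_prod_beta)
  have P_cong: "?P e \<gamma> x = ?P e \<gamma> y" if "\<And>v. v \<in> vars \<gamma> \<Longrightarrow> x v = y v" for e x y
    unfolding pair_prod_def by (rule prod.cong) (auto simp: that)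
  have "to_fract (?\<eta> * (?P a \<gamma> (signed_exp c) * ?P same_vertex \<gamma> mfps_var))
      = to_fract (?P a \<gamma> mfps_var * ?P same_vertex \<gamma> (signed_exp c))"
    using nz(1,2)[of a] nz(1,2)[of same_vertex]
    by (simp add: to_fract_twist_series[OF c] k_expr_eq to_fract_pair_prod field_simps)
  then have "?\<eta> * (?P a \<gamma> (signed_exp c) * ?P same_vertex \<gamma> mfps_var)
      = ?P a \<gamma> mfps_var * ?P same_vertex \<gamma> (signed_exp c)"
    by (simp only: to_fract_eq_iff)
  then have "r ?\<eta> * (r (?P a \<gamma> (signed_exp c)) * r (?P same_vertex \<gamma> mfps_var))
      = r (?P a \<gamma> mfps_var) * r (?P same_vertex \<gamma> (signed_exp c))"
    by (metis exp_hom_mult[OF r])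
  moreover have "r (?P e \<gamma> (signed_exp c)) = ?P e \<gamma> (\<lambda>v. signed_exp c (\<phi> v))"
    "r (?P e \<gamma> mfps_var) = ?P e \<gamma> (\<lambda>v. mfps_var (\<phi> v))" for e
    unfolding rP by (rule P_cong, simp add: exp var)+
  ultimately have "r ?\<eta> * (?P a \<gamma> (\<lambda>v. signed_exp c (\<phi> v)) * ?P same_vertex \<gamma> (\<lambda>v. mfps_var (\<phi> v)))
      = ?P a \<gamma> (\<lambda>v. mfps_var (\<phi> v)) * ?P same_vertex \<gamma> (\<lambda>v. signed_exp c (\<phi> v))"
    by simp
  then have "to_fract (r ?\<eta>) * (to_fract (?P a \<gamma> (\<lambda>v. signed_exp c (\<phi> v))) * to_fract (?P same_vertex \<gamma> (\<lambda>v. mfps_var (\<phi> v))))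
      = to_fract (?P a \<gamma> (\<lambda>v. mfps_var (\<phi> v))) * to_fract (?P same_vertex \<gamma> (\<lambda>v. signed_exp c (\<phi> v)))"
    by (simp only: to_fract_mult[symmetric])
  then show ?thesis
    using nz(3,4)[of a] nz(3,4)[of same_vertex]
    by (simp add: k_expr_eq to_fract_pair_prod field_simps)
qed

lemma k_expr_permute:
  fixes a :: "'i :: {finite, linorder} \<Rightarrow> 'i \<Rightarrow> nat"
  assumes a: "\<And>i j. a i j = a j i" and \<pi>: "\<pi> \<in> sym_group \<gamma>"
  obtains s where "s \<noteq> 0" "\<And>x :: 'i var \<Rightarrow> 'k :: field. k_expr a \<gamma> (\<lambda>v. x (\<pi> v)) = s * k_expr a \<gamma> x"
proof -
  obtain s :: 'k where s: "s * s = 1" "\<And>x. pair_prod a \<gamma> (\<lambda>v. x (\<pi> v)) = s * pair_prod a \<gamma> x"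
    by (rule pair_prod_permute[of a, OF a \<pi>]) (rule that)
  obtain t :: 'k where t: "t * t = 1" "\<And>x. pair_prod same_vertex \<gamma> (\<lambda>v. x (\<pi> v)) = t * pair_prod same_vertex \<gamma> x"
    by (rule pair_prod_permute[of same_vertex, OF same_vertex_sym \<pi>]) (rule that)
  have "s \<noteq> 0" "t \<noteq> 0" using s(1) t(1) by auto
  then show ?thesis
    by (intro that[of "s / t"]) (simp_all add: k_expr_eq s(2) t(2))
qed

lemma twisted_chern_mem_coha_comp:
  fixes a :: "'i :: {finite, linorder} \<Rightarrow> 'i \<Rightarrow> nat"
  assumes c: "c * c = 1" and a: "\<And>i j. a i j = a j i" and f: "f \<in> kha_comp \<gamma>"
  shows "twist_series c a \<gamma> * chern f \<in> coha_comp \<gamma>"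
proof (cases "nonneg \<gamma>")
  case True
  let ?\<eta> = "twist_series c a \<gamma>"
  have keys: "Poly_Mapping.keys m \<subseteq> vars \<gamma>" if "m \<in> Poly_Mapping.keys f" for m
    using f True that by (simp add: kha_comp_def)
  have "to_fract (mfps_restrict (vars \<gamma>) ?\<eta>) = to_fract ?\<eta>"
    using exp_hom_twist_series[OF c exp_hom_restrict, of \<gamma> "vars \<gamma>" "\<lambda>v. v" a]
    by (simp add: mfps_restrict_var to_fract_twist_series[OF c])
  moreover have "to_fract (mfps_restrict (vars \<gamma>) (chern f)) = to_fract (chern f)"
    unfolding to_fract_chern
    by (rule exp_hom_chern[OF exp_hom_restrict]) (rule mfps_restrict_var, use keys in blast)
  ultimately have "mfps_restrict (vars \<gamma>) (?\<eta> * chern f) = ?\<eta> * chern f"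
    by (simp add: exp_hom_mult[OF exp_hom_restrict])
  moreover have "mfps_rename \<pi> (?\<eta> * chern f) = ?\<eta> * chern f" if \<pi>: "\<pi> \<in> sym_group \<gamma>" for \<pi>
  proof -
    have inj: "inj \<pi>" by (rule sym_groupD(4)[OF \<pi>])
    obtain s :: "'i series fract" where s: "s \<noteq> 0" "\<And>x. k_expr a \<gamma> (\<lambda>v. x (\<pi> v)) = s * k_expr a \<gamma> x"
      by (rule k_expr_permute[of a, OF a \<pi>]) (rule that)
    have "to_fract (mfps_rename \<pi> ?\<eta>)
        = k_expr a \<gamma> (\<lambda>v. to_fract (mfps_var (\<pi> v))) / k_expr a \<gamma> (\<lambda>v. to_fract (signed_exp c (\<pi> v)))"
      by (rule exp_hom_twist_series[OF c exp_hom_rename[OF inj]])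
         (use inj in \<open>auto simp: mfps_rename_var intro: inj_on_subset\<close>)
    also have "\<dots> = to_fract ?\<eta>"
      using s(1) s(2)[of "\<lambda>v. to_fract (mfps_var v)"] s(2)[of "\<lambda>v. to_fract (signed_exp c v)"]
      by (simp add: to_fract_twist_series[OF c])
    finally have 1: "mfps_rename \<pi> ?\<eta> = ?\<eta>" by simp
    have "to_fract (mfps_rename \<pi> (chern f)) = laurent_eval (\<lambda>v. exp_point (\<pi> v)) f"
      by (rule exp_hom_chern[OF exp_hom_rename[OF inj]]) (simp add: mfps_rename_var[OF inj])
    also have "\<dots> = to_fract (chern f)"
      unfolding to_fract_chern by (rule kha_comp_invariant[OF f True \<pi>])
    finally have 2: "mfps_rename \<pi> (chern f) = chern f" by simp
    show ?thesis by (simp add: exp_hom_mult[OF exp_hom_rename[OF inj]] 1 2)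
  qed
  ultimately show ?thesis
    using True by (simp add: coha_comp_def mfps_restrict_eq_iff)
next
  case False
  then have "f = 0" using f unfolding kha_comp_def by (simp only: if_False singleton_iff)
  with False show ?thesis unfolding coha_comp_def by (simp only: if_False) simp
qed

section \<open>Comparison of the products\<close>

lemma coha_mult_eq:
  "coha_mult a \<mu> \<nu> g\<^sub>1 g\<^sub>2 = from_fract (\<Sum>\<pi>\<in>shuffle_perms \<mu> \<nu>.
     to_fract (mfps_rename \<pi> g\<^sub>1) * to_fract (mfps_rename (\<pi> \<circ> shift \<mu>) g\<^sub>2)
     * coha_kernel a \<mu> \<nu> (\<lambda>v. to_fract (mfps_var (\<pi> v))) (\<lambda>v. to_fract (mfps_var (\<pi> (shift \<mu> v)))))"
  by (simp add: coha_mult_def Let_def comp_def)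

text \<open>
  The quotient of two instances of \<open>pair_prod_split\<close>. The constant \<open>s\<close> is a sign, but as it is going to cancel
  it only matters that it is nonzero and independent of \<open>x\<close>.
\<close>

lemma k_expr_split:
  fixes a :: "'i :: {finite, linorder} \<Rightarrow> 'i \<Rightarrow> nat"
  assumes a: "\<And>i j. a i j = a j i" and nonneg: "nonneg \<mu>" "nonneg \<nu>" and \<pi>: "\<pi> \<in> sym_group (\<mu> + \<nu>)"
  obtains s where "s \<noteq> 0"
    "\<And>x :: 'i var \<Rightarrow> 'k :: field. k_expr a \<mu> (\<lambda>v. x (\<pi> v)) * k_expr a \<nu> (\<lambda>v. x (\<pi> (shift \<mu> v)))
      * coha_kernel a \<mu> \<nu> (\<lambda>v. x (\<pi> v)) (\<lambda>v. x (\<pi> (shift \<mu> v))) = s * k_expr a (\<mu> + \<nu>) x"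
proof -
  let ?L = "\<lambda>e x. pair_prod e \<mu> (\<lambda>v. x (\<pi> v)) * pair_prod e \<nu> (\<lambda>v. x (\<pi> (shift \<mu> v)))
        * cross_prod e \<mu> \<nu> (\<lambda>v. x (\<pi> v)) (\<lambda>v. x (\<pi> (shift \<mu> v))) :: 'k"
  obtain s :: 'k where s: "s * s = 1" "\<And>x. ?L a x = s * pair_prod a (\<mu> + \<nu>) x"
    by (rule pair_prod_split[of a, OF a nonneg \<pi>]) (rule that)
  obtain t :: 'k where t: "t * t = 1" "\<And>x. ?L same_vertex x = t * pair_prod same_vertex (\<mu> + \<nu>) x"
    by (rule pair_prod_split[of same_vertex, OF same_vertex_sym nonneg \<pi>]) (rule that)
  have nz: "s \<noteq> 0" "t \<noteq> 0" using s(1) t(1) by auto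
  show ?thesis
  proof (rule that[of "s / t"])
    show "s / t \<noteq> 0" using nz by simp
    fix x :: "'i var \<Rightarrow> 'k"
    have "k_expr a \<mu> (\<lambda>v. x (\<pi> v)) * k_expr a \<nu> (\<lambda>v. x (\<pi> (shift \<mu> v)))
        * coha_kernel a \<mu> \<nu> (\<lambda>v. x (\<pi> v)) (\<lambda>v. x (\<pi> (shift \<mu> v))) = ?L a x / ?L same_vertex x"
      by (simp add: k_expr_eq coha_kernel_eq)
    then show "k_expr a \<mu> (\<lambda>v. x (\<pi> v)) * k_expr a \<nu> (\<lambda>v. x (\<pi> (shift \<mu> v)))
        * coha_kernel a \<mu> \<nu> (\<lambda>v. x (\<pi> v)) (\<lambda>v. x (\<pi> (shift \<mu> v))) = s / t * k_expr a (\<mu> + \<nu>) x"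
      by (simp add: s(2) t(2) k_expr_eq)
  qed
qed

text \<open>
  The series \<open>t\<^sub>1\<close> and \<open>t\<^sub>2\<close> stand for the twist on the left and on the right; they have to account for the
  difference between the two kernels. The constant in \<open>k_expr_split\<close> cancels because the lemma is used at
  the variables and at their exponentials with the same \<open>s\<close>.
\<close>

lemma coha_mult_twisted:
  fixes a :: "'i :: {finite, linorder} \<Rightarrow> 'i \<Rightarrow> nat" and t\<^sub>1 t\<^sub>2 :: "'i series"
  assumes c: "c * c = 1" and a: "\<And>i j. a i j = a j i" and nonneg: "nonneg \<mu>" "nonneg \<nu>"
    and f: "f \<in> kha_comp \<mu>" "g \<in> kha_comp \<nu>"
    and t: "\<And>\<phi> \<psi>. inj \<phi> \<Longrightarrow> inj \<psi> \<Longrightarrow>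
      to_fract (mfps_rename \<phi> t\<^sub>1) * to_fract (mfps_rename \<psi> t\<^sub>2)
        * coha_kernel a \<mu> \<nu> (\<lambda>v. to_fract (signed_exp c (\<phi> v))) (\<lambda>v. to_fract (signed_exp c (\<psi> v)))
      = kha_kernel a \<mu> \<nu> (\<lambda>v. exp_point (\<phi> v)) (\<lambda>v. exp_point (\<psi> v))"
  shows "coha_mult a \<mu> \<nu> (t\<^sub>1 * (twist_series c a \<mu> * chern f)) (t\<^sub>2 * (twist_series c a \<nu> * chern g))
    = twist_series c a (\<mu> + \<nu>) * chern (kha_mult a \<mu> \<nu> f g)"
proof -
  let ?X = "\<lambda>v. to_fract (mfps_var v) :: 'i series fract" and ?E = "\<lambda>v. to_fract (signed_exp c v) :: 'i series fract"
  let ?\<eta> = "twist_series c a"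
  have summand: "to_fract (mfps_rename \<pi> (t\<^sub>1 * (?\<eta> \<mu> * chern f)))
      * to_fract (mfps_rename (\<pi> \<circ> shift \<mu>) (t\<^sub>2 * (?\<eta> \<nu> * chern g)))
      * coha_kernel a \<mu> \<nu> (\<lambda>v. ?X (\<pi> v)) (\<lambda>v. ?X (\<pi> (shift \<mu> v)))
      = to_fract (?\<eta> (\<mu> + \<nu>)) * kha_term a \<mu> \<nu> f g (\<lambda>v. exp_point (\<pi> v)) (\<lambda>v. exp_point (\<pi> (shift \<mu> v)))"
    if "\<pi> \<in> shuffle_perms \<mu> \<nu>" for \<pi>
  proof -
    define \<psi> where "\<psi> = \<pi> \<circ> shift \<mu>"
    have \<pi>: "\<pi> \<in> sym_group (\<mu> + \<nu>)" using that by (simp add: shuffle_perms_def)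
    have inj: "inj \<pi>" "inj \<psi>"
      using sym_groupD(4)[OF \<pi>] shift_props(2)[of \<mu>] by (auto simp: \<psi>_def intro: inj_compose)
    obtain s :: "'i series fract" where s: "s \<noteq> 0"
      "\<And>x. k_expr a \<mu> (\<lambda>v. x (\<pi> v)) * k_expr a \<nu> (\<lambda>v. x (\<pi> (shift \<mu> v)))
      * coha_kernel a \<mu> \<nu> (\<lambda>v. x (\<pi> v)) (\<lambda>v. x (\<pi> (shift \<mu> v))) = s * k_expr a (\<mu> + \<nu>) x"
      by (rule k_expr_split[of a, OF a nonneg \<pi>]) (rule that)
    have inj_on: "inj_on \<phi> V" if "inj \<phi>" for \<phi> :: "'i var \<Rightarrow> 'i var" and V
      using that by (rule inj_on_subset) simp
    have \<eta>: "to_fract (mfps_rename \<phi> (?\<eta> \<gamma>)) = k_expr a \<gamma> (\<lambda>v. ?X (\<phi> v)) / k_expr a \<gamma> (\<lambda>v. ?E (\<phi> v))"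
      if "inj \<phi>" for \<phi> \<gamma>
      by (rule exp_hom_twist_series[OF c exp_hom_rename[OF that] _ inj_on[OF that]]) (simp add: mfps_rename_var[OF that])
    have ch: "to_fract (mfps_rename \<phi> (chern g)) = laurent_eval (\<lambda>v. exp_point (\<phi> v)) g"
      if "inj \<phi>" for \<phi> and g :: "'i var laurent"
      by (rule exp_hom_chern[OF exp_hom_rename[OF that]]) (simp add: mfps_rename_var[OF that])
    have nz: "k_expr a \<gamma> (\<lambda>v. ?E (\<phi> v)) \<noteq> 0" if "inj \<phi>" for \<phi> \<gamma>
      by (rule k_expr_nonzero, rule inj_onI) (use that in \<open>auto dest!: inj_signed_exp[OF c] simp: inj_eq\<close>)
    have nz': "k_expr a (\<mu> + \<nu>) ?E \<noteq> 0" using nz[of "\<lambda>v. v"] by simp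
    let ?k1 = "k_expr a \<mu> (\<lambda>v. ?E (\<pi> v))" and ?k2 = "k_expr a \<nu> (\<lambda>v. ?E (\<psi> v))"
      and ?K = "coha_kernel a \<mu> \<nu> (\<lambda>v. ?E (\<pi> v)) (\<lambda>v. ?E (\<psi> v))"
    let ?T = "to_fract (mfps_rename \<pi> t\<^sub>1) * to_fract (mfps_rename \<psi> t\<^sub>2)"
      and ?F = "laurent_eval (\<lambda>v. exp_point (\<pi> v)) f * laurent_eval (\<lambda>v. exp_point (\<psi> v)) g"
    have sX: "k_expr a \<mu> (\<lambda>v. ?X (\<pi> v)) * k_expr a \<nu> (\<lambda>v. ?X (\<psi> v))
      * coha_kernel a \<mu> \<nu> (\<lambda>v. ?X (\<pi> v)) (\<lambda>v. ?X (\<psi> v)) = s * k_expr a (\<mu> + \<nu>) ?X"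
      using s(2)[of ?X] by (simp add: \<psi>_def)
    have sE: "?k1 * ?k2 * ?K = s * k_expr a (\<mu> + \<nu>) ?E"
      using s(2)[of ?E] by (simp add: \<psi>_def)
    have "to_fract (mfps_rename \<pi> (t\<^sub>1 * (?\<eta> \<mu> * chern f)))
      * to_fract (mfps_rename \<psi> (t\<^sub>2 * (?\<eta> \<nu> * chern g)))
      * coha_kernel a \<mu> \<nu> (\<lambda>v. ?X (\<pi> v)) (\<lambda>v. ?X (\<psi> v))
      = ?T * ?F * (k_expr a \<mu> (\<lambda>v. ?X (\<pi> v)) * k_expr a \<nu> (\<lambda>v. ?X (\<psi> v))
          * coha_kernel a \<mu> \<nu> (\<lambda>v. ?X (\<pi> v)) (\<lambda>v. ?X (\<psi> v))) / (?k1 * ?k2)"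
      by (simp add: exp_hom_mult[OF exp_hom_rename[OF inj(1)]] exp_hom_mult[OF exp_hom_rename[OF inj(2)]]
          \<eta>[OF inj(1)] \<eta>[OF inj(2)] ch[OF inj(1)] ch[OF inj(2)])
    also have "\<dots> = ?F * (k_expr a (\<mu> + \<nu>) ?X / k_expr a (\<mu> + \<nu>) ?E)
        * (?T * (s * k_expr a (\<mu> + \<nu>) ?E) / (?k1 * ?k2))"
      unfolding sX using nz' by (simp add: field_simps)
    also have "?T * (s * k_expr a (\<mu> + \<nu>) ?E) / (?k1 * ?k2) = ?T * ?K"
      unfolding sE[symmetric] using nz[OF inj(1), of \<mu>] nz[OF inj(2), of \<nu>] by simp
    also have "?T * ?K = kha_kernel a \<mu> \<nu> (\<lambda>v. exp_point (\<pi> v)) (\<lambda>v. exp_point (\<psi> v))"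
      by (rule t[OF inj])
    finally have product: "to_fract (mfps_rename \<pi> (t\<^sub>1 * (?\<eta> \<mu> * chern f)))
      * to_fract (mfps_rename \<psi> (t\<^sub>2 * (?\<eta> \<nu> * chern g)))
      * coha_kernel a \<mu> \<nu> (\<lambda>v. ?X (\<pi> v)) (\<lambda>v. ?X (\<psi> v))
      = to_fract (?\<eta> (\<mu> + \<nu>)) * kha_term a \<mu> \<nu> f g (\<lambda>v. exp_point (\<pi> v)) (\<lambda>v. exp_point (\<psi> v))"
      by (simp only: kha_term_def to_fract_twist_series[OF c] mult_ac)
    have "\<pi> (shift \<mu> v) = \<psi> v" for v by (simp add: \<psi>_def)
    then show ?thesis using product by (simp only: \<psi>_def[symmetric])
  qed
  have "(\<Sum>\<pi>\<in>shuffle_perms \<mu> \<nu>. to_fract (mfps_rename \<pi> (t\<^sub>1 * (?\<eta> \<mu> * chern f)))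
      * to_fract (mfps_rename (\<pi> \<circ> shift \<mu>) (t\<^sub>2 * (?\<eta> \<nu> * chern g)))
      * coha_kernel a \<mu> \<nu> (\<lambda>v. ?X (\<pi> v)) (\<lambda>v. ?X (\<pi> (shift \<mu> v))))
      = to_fract (?\<eta> (\<mu> + \<nu>)) * kha_sum a \<mu> \<nu> f g exp_point"
    unfolding kha_sum_def sum_distrib_left by (rule sum.cong[OF refl summand])
  also have "\<dots> = to_fract (?\<eta> (\<mu> + \<nu>) * chern (kha_mult a \<mu> \<nu> f g))"
    by (simp add: to_fract_chern_kha_mult[OF f nonneg])
  finally show ?thesis unfolding coha_mult_eq by (simp only: from_fract_to_fract)
qed

section \<open>The twisting automorphisms compare the two kernels\<close>

text \<open>
  The exponent in \<open>a_series\<close>. The product of powers there is itself the exponential of a linear form and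
  thus lies in the ring of series.
\<close>

definition twist_exponent :: "('i :: finite \<Rightarrow> 'i \<Rightarrow> nat) \<Rightarrow> 'i dimvec \<Rightarrow> 'i \<Rightarrow> int" where
  "twist_exponent a \<tau> i = \<tau> $ i - (\<Sum>j\<in>UNIV. int (a i j) * \<tau> $ j)"

lemma prod_power_int: "(\<Prod>a\<in>A. f a) powi k = (\<Prod>a\<in>A. f a powi k)" for f :: "'b \<Rightarrow> 'k :: field"
  by (induction A rule: infinite_finite_induct) (simp_all add: power_int_mult_distrib)

lemma a_series_eq:
  "a_series a \<tau> \<gamma> = mfps_exp (\<Sum>v\<in>vars \<gamma>. of_int (twist_exponent a \<tau> (fst v)) * mfps_var v)"
proof -
  have exp: "to_fract (mfps_exp (\<Sum>\<alpha>=1..n. mfps_var (i, \<alpha>))) powi k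
      = (\<Prod>\<alpha>=1..n. to_fract (mfps_exp (of_int k * mfps_var (i, \<alpha>))))" for n k and i :: 'a
    by (simp add: mfps_exp_sum prod_power_int to_fract_exp_of_int_mult)
  have "(\<Prod>i\<in>UNIV. to_fract (mfps_exp (\<Sum>\<alpha>=1..nat (\<gamma> $ i). mfps_var (i, \<alpha>))) powi twist_exponent a \<tau> i)
      = to_fract (mfps_exp (\<Sum>v\<in>vars \<gamma>. of_int (twist_exponent a \<tau> (fst v)) * mfps_var v) :: 'a series)"
    unfolding exp prod_vars
    by (subst mfps_exp_sum) (simp_all add: mcoeff_of_int_mult)
  then show ?thesis
    unfolding a_series_def twist_exponent_def[symmetric] by (simp only: from_fract_to_fract)
qed

lemma to_fract_rename_a_series:
  assumes "inj \<phi>"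
  shows "to_fract (mfps_rename \<phi> (a_series a \<tau> \<gamma>))
    = (\<Prod>v\<in>vars \<gamma>. exp_point (\<phi> v) powi twist_exponent a \<tau> (fst v))"
  unfolding a_series_eq exp_hom_simps[OF exp_hom_rename[OF assms]] mfps_rename_var[OF assms]
  by (subst mfps_exp_sum) (simp_all add: mcoeff_of_int_mult to_fract_exp_of_int_mult)

definition parity_sign :: "int \<Rightarrow> int" where
  "parity_sign k = (if even k then 1 else - 1)"

lemma minus_one_powi: "(- 1 :: 'k :: field) powi k = of_int (parity_sign k)"
  by (simp add: power_int_minus_left parity_sign_def)

definition b_exponent :: "('i :: finite \<Rightarrow> 'i \<Rightarrow> nat) \<Rightarrow> 'i dimvec \<Rightarrow> 'i dimvec \<Rightarrow> int" where
  "b_exponent a \<tau> \<gamma> = (\<Sum>i\<in>UNIV. \<gamma> $ i * \<tau> $ i) + (\<Sum>i\<in>UNIV. \<Sum>j\<in>UNIV. int (a i j) * \<gamma> $ i * \<tau> $ j)"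

lemma to_fract_rename_b_series:
  assumes "inj \<phi>"
  shows "to_fract (mfps_rename \<phi> (b_series a \<tau> \<gamma>))
    = (- 1) powi b_exponent a \<tau> \<gamma> * inverse (\<Prod>v\<in>vars \<gamma>. exp_point (\<phi> v) powi twist_exponent a \<tau> (fst v))"
proof -
  let ?l = "(\<Sum>v\<in>vars \<gamma>. of_int (twist_exponent a \<tau> (fst v)) * mfps_var v) :: 'a series"
  have l0: "mcoeff ?l 0 = 0" by (simp add: mcoeff_sum mcoeff_of_int_mult)
  have "(- 1) powi b_exponent a \<tau> \<gamma> * inverse (to_fract (a_series a \<tau> \<gamma>))
      = to_fract (of_int (parity_sign (b_exponent a \<tau> \<gamma>)) * mfps_exp (- ?l))"
    by (simp add: a_series_eq minus_one_powi inverse_to_fract_exp[OF l0])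
  then have b: "b_series a \<tau> \<gamma> = of_int (parity_sign (b_exponent a \<tau> \<gamma>)) * mfps_exp (- ?l)"
    unfolding b_series_def b_exponent_def[symmetric] by (simp only: from_fract_to_fract)
  let ?r = "mfps_rename \<phi>"
  have "?r (mfps_exp ?l * mfps_exp (- ?l)) = 1"
    unfolding mfps_exp_minus[OF l0] by (rule exp_hom_1[OF exp_hom_rename[OF assms]])
  then have "to_fract (?r (mfps_exp ?l) * ?r (mfps_exp (- ?l))) = 1"
    unfolding exp_hom_mult[OF exp_hom_rename[OF assms]] by (simp only: to_fract_1)
  then have "to_fract (?r (mfps_exp (- ?l))) = inverse (to_fract (?r (a_series a \<tau> \<gamma>)))"
    unfolding a_series_eq to_fract_mult by (rule inverse_unique[symmetric])
  then show ?thesis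
    by (simp add: b exp_hom_mult[OF exp_hom_rename[OF assms]] exp_hom_of_int[OF exp_hom_rename[OF assms]]
        to_fract_rename_a_series[OF assms] minus_one_powi)
qed

lemma prod_pairs_power_first:
  fixes y :: "'i :: finite var \<Rightarrow> 'k :: field"
  assumes "nonneg \<nu>"
  shows "(\<Prod>(v, w)\<in>vars \<mu> \<times> vars \<nu>. y v ^ e (fst v) (fst w))
    = (\<Prod>v\<in>vars \<mu>. y v powi (\<Sum>j\<in>UNIV. int (e (fst v) j) * \<nu> $ j))"
proof -
  have "(\<Prod>(v, w)\<in>vars \<mu> \<times> vars \<nu>. y v ^ e (fst v) (fst w))
      = (\<Prod>v\<in>vars \<mu>. y v ^ (\<Sum>w\<in>vars \<nu>. e (fst v) (fst w)))"
    by (simp add: power_sum prod.cartesian_product)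
  also have "\<dots> = (\<Prod>v\<in>vars \<mu>. y v powi (\<Sum>j\<in>UNIV. int (e (fst v) j) * \<nu> $ j))"
  proof (rule prod.cong[OF refl])
    fix v :: "'i var"
    have "(\<Sum>j\<in>UNIV. int (e (fst v) j) * \<nu> $ j) = int (\<Sum>w\<in>vars \<nu>. e (fst v) (fst w))"
      using assms by (simp add: sum_vars_fst mult.commute)
    then show "y v ^ (\<Sum>w\<in>vars \<nu>. e (fst v) (fst w)) = y v powi (\<Sum>j\<in>UNIV. int (e (fst v) j) * \<nu> $ j)"
      by (simp only: power_int_of_nat)
  qed
  finally show ?thesis .
qed

lemma prod_pairs_power_second:
  fixes y :: "'i :: finite var \<Rightarrow> 'k :: field"
  assumes "nonneg \<mu>"
  shows "(\<Prod>(v, w)\<in>vars \<mu> \<times> vars \<nu>. y w ^ e (fst v) (fst w))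
    = (\<Prod>w\<in>vars \<nu>. y w powi (\<Sum>i\<in>UNIV. int (e i (fst w)) * \<mu> $ i))"
proof -
  have "(\<Prod>(v, w)\<in>vars \<mu> \<times> vars \<nu>. y w ^ e (fst v) (fst w))
      = (\<Prod>(v, w)\<in>vars \<nu> \<times> vars \<mu>. y v ^ e (fst w) (fst v))"
    by (rule prod.reindex_bij_witness[where i = prod.swap and j = prod.swap]) auto
  also have "\<dots> = (\<Prod>w\<in>vars \<nu>. y w powi (\<Sum>i\<in>UNIV. int (e i (fst w)) * \<mu> $ i))"
    by (rule prod_pairs_power_first[OF assms, where e = "\<lambda>i j. e j i"])
  finally show ?thesis .
qed

lemma sum_same_vertex: "(\<Sum>j\<in>UNIV. int (same_vertex i j) * \<gamma> $ j) = \<gamma> $ i"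
  by (simp add: same_vertex_def if_distrib[of int] if_distrib[of "\<lambda>k. k * _"] cong: if_cong)

text \<open>
  In \<open>z'' - z' = (1 - z' / z'') z''\<close> the extracted powers of \<open>z''\<^bsub>j,\<alpha>\<^esub>\<close> add up to
  \<open>\<Sum>i. a\<^sub>i\<^sub>j \<mu>\<^sup>i\<close> in the numerator and to \<open>\<mu>\<^sup>j\<close> in the denominator of the kernel. The twist carries the opposite
  exponent, by the symmetry of \<open>a\<close>.
\<close>

lemma right_kernel_identity:
  fixes z' z'' :: "'i :: finite var \<Rightarrow> 'k :: field"
  assumes a: "\<And>i j. a i j = a j i" and nonneg: "nonneg \<mu>" and nz: "\<And>w. z'' w \<noteq> 0"
  shows "(\<Prod>w\<in>vars \<nu>. z'' w powi twist_exponent a \<mu> (fst w)) * coha_kernel a \<mu> \<nu> z' z''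
    = kha_kernel a \<mu> \<nu> z' z''"
proof -
  let ?P = "\<lambda>e. (\<Prod>(v, w)\<in>vars \<mu> \<times> vars \<nu>. z'' w ^ e (fst v) (fst w)) :: 'k"
  have P: "?P e = (\<Prod>w\<in>vars \<nu>. z'' w powi (\<Sum>i\<in>UNIV. int (e (fst w) i) * \<mu> $ i))"
    if "\<And>i j. e i j = e j i" for e
    unfolding prod_pairs_power_second[OF nonneg] by (intro prod.cong refl arg_cong2[of _ _ _ _ "(powi)"] sum.cong) (simp add: that)
  have "(\<Prod>w\<in>vars \<nu>. z'' w powi twist_exponent a \<mu> (fst w)) * ?P a = ?P same_vertex"
    unfolding P[of a, OF a] P[of same_vertex, OF same_vertex_sym] prod.distrib[symmetric]
    by (rule prod.cong) (simp_all add: twist_exponent_def sum_same_vertex nz flip: power_int_add)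
  moreover have "?P same_vertex \<noteq> 0" using nz by (auto simp: prod_zero_iff)
  ultimately show ?thesis
    by (simp add: coha_kernel_eq kha_kernel_eq cross_prod_eq_ratio[OF nz] field_simps)
qed

lemma prod_power_int_exponent:
  assumes "x \<noteq> (0 :: 'k :: field)"
  shows "(\<Prod>a\<in>A. x powi n a) = x powi (\<Sum>a\<in>A. n a)"
  by (induction A rule: infinite_finite_induct) (auto simp: power_int_add assms)

text \<open>
  In \<open>1 / z'' - 1 / z' = (1 - z' / z'') (- 1 / z')\<close> the extracted powers of \<open>- 1 / z'\<close> give the monomial; their signs
  multiply to \<open>-1\<close> to the power \<open>\<Sum>i j. a\<^sub>i\<^sub>j \<mu>\<^sup>i \<nu>\<^sup>j - \<Sum>i. \<mu>\<^sup>i \<nu>\<^sup>i\<close>, which has the parity of \<open>b_exponent\<close>.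
\<close>

lemma left_kernel_identity:
  fixes z' z'' :: "'i :: finite var \<Rightarrow> 'k :: field"
  assumes nonneg: "nonneg \<mu>" "nonneg \<nu>" and nz: "\<And>v. z' v \<noteq> 0" "\<And>w. z'' w \<noteq> 0"
  shows "(- 1) powi b_exponent a \<nu> \<mu> * inverse (\<Prod>v\<in>vars \<mu>. z' v powi twist_exponent a \<nu> (fst v))
      * coha_kernel a \<mu> \<nu> (\<lambda>v. inverse (z' v)) (\<lambda>v. inverse (z'' v))
    = kha_kernel a \<mu> \<nu> z' z''"
proof -
  let ?y = "\<lambda>v. - inverse (z' v)"
  let ?P = "\<lambda>e. (\<Prod>(v, w)\<in>vars \<mu> \<times> vars \<nu>. ?y v ^ e (fst v) (fst w)) :: 'k"
  have "inverse (z'' w) - inverse (z' v) = (1 - z' v * inverse (z'' w)) * ?y v" for v w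
    using nz by (simp add: field_simps)
  then have "(inverse (z'' w) - inverse (z' v)) ^ k = (1 - z' v * inverse (z'' w)) ^ k * ?y v ^ k" for v w k
    by (simp only: power_mult_distrib)
  then have cross: "cross_prod e \<mu> \<nu> (\<lambda>v. inverse (z' v)) (\<lambda>v. inverse (z'' v))
      = ratio_cross_prod e \<mu> \<nu> z' z'' * ?P e" for e
    by (simp only: cross_prod_def ratio_cross_prod_def prod.distrib split_def)
  define n where "n v = twist_exponent a \<nu> (fst v)" for v :: "'i var"
  have "(\<Prod>v\<in>vars \<mu>. ?y v powi n v) * ?P a = ?P same_vertex"
    unfolding prod_pairs_power_first[OF nonneg(2), where y = ?y and e = a]
      prod_pairs_power_first[OF nonneg(2), where y = ?y and e = same_vertex] prod.distrib[symmetric]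
    by (rule prod.cong) (simp_all add: n_def twist_exponent_def sum_same_vertex nz flip: power_int_add)
  moreover have "(\<Prod>v\<in>vars \<mu>. ?y v powi n v)
      = (- 1) powi b_exponent a \<nu> \<mu> * inverse (\<Prod>v\<in>vars \<mu>. z' v powi n v)"
  proof -
    have "?y v powi n v = (- 1) powi n v * inverse (z' v powi n v)" for v
      by (metis mult_minus1 power_int_inverse power_int_mult_distrib)
    then have "(\<Prod>v\<in>vars \<mu>. ?y v powi n v) = (\<Prod>v\<in>vars \<mu>. (- 1) powi n v) * inverse (\<Prod>v\<in>vars \<mu>. z' v powi n v)"
      by (simp add: prod.distrib prod_inversef[symmetric] comp_def)
    moreover have "(\<Prod>v\<in>vars \<mu>. (- 1 :: 'k) powi n v) = (- 1) powi (\<Sum>v\<in>vars \<mu>. n v)"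
      by (rule prod_power_int_exponent) simp
    moreover have "(\<Sum>v\<in>vars \<mu>. n v) = (\<Sum>i\<in>UNIV. \<mu> $ i * twist_exponent a \<nu> i)"
    proof -
      have "(\<Sum>v\<in>vars \<mu>. n v) = (\<Sum>i\<in>UNIV. \<Sum>\<alpha>=1..nat (\<mu> $ i). twist_exponent a \<nu> i)"
        unfolding n_def vars_eq_Sigma by (subst sum.Sigma) (auto simp: case_prod_beta)
      then show ?thesis using nonneg(1) by simp
    qed
    moreover have "\<dots> = b_exponent a \<nu> \<mu> - 2 * (\<Sum>i\<in>UNIV. \<Sum>j\<in>UNIV. int (a i j) * \<mu> $ i * \<nu> $ j)"
      by (simp add: twist_exponent_def b_exponent_def right_diff_distrib sum_subtractf sum_distrib_left mult_ac)
    ultimately show ?thesis by (simp add: minus_one_powi parity_sign_def)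
  qed
  ultimately have "(- 1) powi b_exponent a \<nu> \<mu> * inverse (\<Prod>v\<in>vars \<mu>. z' v powi n v) * ?P a = ?P same_vertex"
    by simp
  moreover have "?P same_vertex \<noteq> 0" using nz by (auto simp: split_def)
  moreover have "C * (x * p / (y * q)) = x / y" if "C * p = q" "q \<noteq> 0" for C x p y q :: 'k
  proof -
    have "C * (x * p / (y * q)) = (C * p) * x / (y * q)" by (simp add: mult_ac)
    then show ?thesis using that by simp
  qed
  ultimately show ?thesis
    unfolding coha_kernel_eq kha_kernel_eq cross n_def[symmetric] by blast
qed

lemma coha_mult_right_twist:
  assumes a: "\<And>i j. a i j = a j i" and nonneg: "nonneg \<mu>" "nonneg \<nu>"
    and f: "f \<in> kha_comp \<mu>" "g \<in> kha_comp \<nu>"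
  shows "coha_mult a \<mu> \<nu> (twist_series 1 a \<mu> * chern f)
      (a_series a \<mu> \<nu> * (twist_series 1 a \<nu> * chern g))
    = twist_series 1 a (\<mu> + \<nu>) * chern (kha_mult a \<mu> \<nu> f g)"
proof -
  have "to_fract (mfps_rename \<phi> 1) * to_fract (mfps_rename \<psi> (a_series a \<mu> \<nu>))
        * coha_kernel a \<mu> \<nu> (\<lambda>v. to_fract (signed_exp 1 (\<phi> v))) (\<lambda>v. to_fract (signed_exp 1 (\<psi> v)))
      = kha_kernel a \<mu> \<nu> (\<lambda>v. exp_point (\<phi> v)) (\<lambda>v. exp_point (\<psi> v))"
    if "inj \<phi>" "inj \<psi>" for \<phi> \<psi> :: "'a var \<Rightarrow> 'a var"
    using right_kernel_identity[of a, OF a nonneg(1), of "\<lambda>v. exp_point (\<psi> v)" \<nu> "\<lambda>v. exp_point (\<phi> v)"]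
    by (simp add: exp_hom_1[OF exp_hom_rename[OF that(1)]] to_fract_rename_a_series[OF that(2)] signed_exp_def)
  from coha_mult_twisted[of 1 a, OF _ a nonneg f this] show ?thesis by simp
qed

lemma coha_mult_left_twist:
  assumes a: "\<And>i j. a i j = a j i" and nonneg: "nonneg \<mu>" "nonneg \<nu>"
    and f: "f \<in> kha_comp \<mu>" "g \<in> kha_comp \<nu>"
  shows "coha_mult a \<mu> \<nu> (b_series a \<nu> \<mu> * (twist_series (-1) a \<mu> * chern f))
      (twist_series (-1) a \<nu> * chern g)
    = twist_series (-1) a (\<mu> + \<nu>) * chern (kha_mult a \<mu> \<nu> f g)"
proof -
  have inv: "to_fract (signed_exp (-1) v) = inverse (exp_point v)" for v :: "'a var"
    by (simp add: signed_exp_def inverse_to_fract_exp)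
  have "to_fract (mfps_rename \<phi> (b_series a \<nu> \<mu>)) * to_fract (mfps_rename \<psi> 1)
        * coha_kernel a \<mu> \<nu> (\<lambda>v. to_fract (signed_exp (-1) (\<phi> v))) (\<lambda>v. to_fract (signed_exp (-1) (\<psi> v)))
      = kha_kernel a \<mu> \<nu> (\<lambda>v. exp_point (\<phi> v)) (\<lambda>v. exp_point (\<psi> v))"
    if "inj \<phi>" "inj \<psi>" for \<phi> \<psi> :: "'a var \<Rightarrow> 'a var"
    using left_kernel_identity[OF nonneg, of "\<lambda>v. exp_point (\<phi> v)" "\<lambda>v. exp_point (\<psi> v)" a]
    by (simp add: exp_hom_1[OF exp_hom_rename[OF that(2)]] to_fract_rename_b_series[OF that(1)] inv)
  from coha_mult_twisted[of "-1" a, OF _ a nonneg f this] show ?thesis by simp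
qed

section \<open>Passage to the graded algebras\<close>

text \<open>
  The supports of \<open>f\<close> and of its image under a componentwise map need not agree a priori; sums over a common
  larger set avoid comparing them.
\<close>

lemma graded_mult_superset:
  assumes "finite S" "finite T" "Poly_Mapping.keys f \<subseteq> S" "Poly_Mapping.keys g \<subseteq> T"
    and "\<And>s t y. M s t 0 y = 0" "\<And>s t x. M s t x 0 = 0"
  shows "graded_mult M f g = (\<Sum>s\<in>S. \<Sum>t\<in>T.
    Poly_Mapping.single (s + t) (M s t (Poly_Mapping.lookup f s) (Poly_Mapping.lookup g t)))"
proof -
  have "(\<Sum>t\<in>Poly_Mapping.keys g. Poly_Mapping.single (s + t) (M s t (Poly_Mapping.lookup f s) (Poly_Mapping.lookup g t)))
      = (\<Sum>t\<in>T. Poly_Mapping.single (s + t) (M s t (Poly_Mapping.lookup f s) (Poly_Mapping.lookup g t)))" for s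
    by (rule sum.mono_neutral_left) (use assms in \<open>auto simp: in_keys_iff\<close>)
  then show ?thesis
    unfolding graded_mult_def
    by (simp, intro sum.mono_neutral_left) (use assms in \<open>auto simp: in_keys_iff\<close>)
qed

lemma mfps_rename_0 [simp]: "mfps_rename \<phi> 0 = 0"
  by (rule mfps_eqI) (simp add: mfps_rename_def Abs_mfps_inverse)

lemma from_fract_0 [simp]: "from_fract 0 = 0"
  by (metis from_fract_to_fract to_fract_0)

lemma coha_mult_0 [simp]: "coha_mult a s t 0 y = 0" "coha_mult a s t x 0 = 0"
  by (simp_all add: coha_mult_eq)

lemma kha_mult_0 [simp]: "kha_mult a s t 0 y = 0" "kha_mult a s t x 0 = 0"
  by (simp_all add: kha_mult_eq kha_sum_def kha_term_def)

text \<open>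
  The passage from homogeneous components to the whole algebra, for a structure \<open>B\<close> on the completed algebra
  whose product is given on components by \<open>M\<close>; it is used for the right and for the left twist.
\<close>

lemma twisted_chern_graded_hom:
  fixes a :: "'i :: {finite, linorder} \<Rightarrow> 'i \<Rightarrow> nat"
  assumes c: "c * c = 1" and a: "\<And>i j. a i j = a j i"
    and B: "carrier B = carrier (completed_coha a)" "one B = Poly_Mapping.single 0 1" "add B = (+)"
    and mult: "\<And>y z S T. finite S \<Longrightarrow> finite T \<Longrightarrow> Poly_Mapping.keys y \<subseteq> S \<Longrightarrow> Poly_Mapping.keys z \<subseteq> T \<Longrightarrow>
      mult B y z = (\<Sum>s\<in>S. \<Sum>t\<in>T. Poly_Mapping.single (s + t) (M s t (Poly_Mapping.lookup y s) (Poly_Mapping.lookup z t)))"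
    and M0: "\<And>s t y. M s t 0 y = 0" "\<And>s t x. M s t x 0 = 0"
    and M: "\<And>s t f g. nonneg s \<Longrightarrow> nonneg t \<Longrightarrow> f \<in> kha_comp s \<Longrightarrow> g \<in> kha_comp t \<Longrightarrow>
      M s t (twist_series c a s * chern f) (twist_series c a t * chern g)
      = twist_series c a (s + t) * chern (kha_mult a s t f g)"
  shows "\<exists>h \<in> graded_hom (kha a) B. inj_on h (carrier (kha a)) \<and>
    (\<forall>\<gamma>. \<forall>f \<in> kha_comp \<gamma>. h (Poly_Mapping.single \<gamma> f) = Poly_Mapping.single \<gamma> (twist_series c a \<gamma> * chern f))"
proof
  define h where "h = Poly_Mapping.mapp (\<lambda>\<gamma> f. twist_series c a \<gamma> * chern f)"
  have lookup: "Poly_Mapping.lookup (h f) \<gamma> = twist_series c a \<gamma> * chern (Poly_Mapping.lookup f \<gamma>)" for f \<gamma>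
    by (simp add: h_def lookup_mapp when_def in_keys_iff)
  have add: "h (f + g) = h f + h g" for f g
    by (rule poly_mapping_eqI) (simp add: lookup lookup_add chern_add distrib_left)
  have zero: "h 0 = 0" by (rule poly_mapping_eqI) (simp add: lookup)
  have sum: "h (sum F A) = (\<Sum>x\<in>A. h (F x))" for F and A :: "'i dimvec set"
    by (induction A rule: infinite_finite_induct) (simp_all add: zero add)
  have single: "h (Poly_Mapping.single \<gamma> f) = Poly_Mapping.single \<gamma> (twist_series c a \<gamma> * chern f)" for \<gamma> f
    by (rule poly_mapping_eqI) (simp add: lookup lookup_single when_def)
  have carrier: "carrier (kha a) = {f. \<forall>\<gamma>. Poly_Mapping.lookup f \<gamma> \<in> kha_comp \<gamma>}"
    "carrier B = {f. \<forall>\<gamma>. Poly_Mapping.lookup f \<gamma> \<in> coha_comp \<gamma>}"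
    unfolding B(1) by (simp_all add: kha_def completed_coha_def graded_ring_def)
  have keys: "Poly_Mapping.keys (h f) \<subseteq> Poly_Mapping.keys f" for f
    unfolding h_def by (rule keys_mapp_subset)
  have hom: "h \<in> ring_hom (kha a) B"
  proof (rule ring_hom_memI)
    fix f assume "f \<in> carrier (kha a)"
    then show "h f \<in> carrier B"
      unfolding carrier by (auto simp: lookup intro: twisted_chern_mem_coha_comp[OF c a])
  next
    fix f g assume fg: "f \<in> carrier (kha a)" "g \<in> carrier (kha a)"
    let ?S = "Poly_Mapping.keys f" and ?T = "Poly_Mapping.keys g"
    let ?f = "Poly_Mapping.lookup f" and ?g = "Poly_Mapping.lookup g"
    have comp: "M s t (twist_series c a s * chern (?f s)) (twist_series c a t * chern (?g t))
        = twist_series c a (s + t) * chern (kha_mult a s t (?f s) (?g t))" for s t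
    proof (cases "nonneg s \<and> nonneg t")
      case True
      then show ?thesis using fg by (intro M) (auto simp: carrier)
    next
      case False
      then have "?f s = 0 \<or> ?g t = 0"
        using fg unfolding carrier kha_comp_def by (metis (mono_tags, lifting) mem_Collect_eq singletonD)
      then show ?thesis by (auto simp: M0)
    qed
    have "h (mult (kha a) f g) = h (\<Sum>s\<in>?S. \<Sum>t\<in>?T. Poly_Mapping.single (s + t) (kha_mult a s t (?f s) (?g t)))"
      by (simp add: kha_def graded_ring_def graded_mult_def)
    also have "\<dots> = (\<Sum>s\<in>?S. \<Sum>t\<in>?T. Poly_Mapping.single (s + t)
        (twist_series c a (s + t) * chern (kha_mult a s t (?f s) (?g t))))"
      by (simp add: sum single)
    also have "\<dots> = mult B (h f) (h g)"
      unfolding mult[OF finite_keys finite_keys keys keys] by (simp add: lookup comp)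
    finally show "h (mult (kha a) f g) = mult B (h f) (h g)" .
    show "h (add (kha a) f g) = add B (h f) (h g)"
      by (simp add: B(3) kha_def graded_ring_def add)
  next
    have "vars (0 :: 'i dimvec) = {}" by (auto simp: vars_def)
    then have "to_fract (twist_series c a 0) = 1"
      by (simp add: to_fract_twist_series[OF c] k_expr_eq pair_prod_def)
    then have "twist_series c a 0 = 1" by (metis to_fract_1 to_fract_eq_iff)
    then show "h (one (kha a)) = one B"
      by (simp add: B(2) kha_def graded_ring_def single chern_1 del: single_one)
  qed
  moreover have "h ` homogeneous (kha a) \<gamma> \<subseteq> homogeneous B \<gamma>" for \<gamma>
    using ring_hom_closed[OF hom] keys unfolding homogeneous_def by blast
  ultimately show "h \<in> graded_hom (kha a) B" by (simp add: graded_hom_def)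
  have "inj h"
  proof (rule injI, rule poly_mapping_eqI)
    fix f g \<gamma> assume "h f = h g"
    then have "twist_series c a \<gamma> * chern (Poly_Mapping.lookup f \<gamma>) = twist_series c a \<gamma> * chern (Poly_Mapping.lookup g \<gamma>)"
      by (metis lookup)
    then have "chern (Poly_Mapping.lookup f \<gamma>) = chern (Poly_Mapping.lookup g \<gamma>)"
      using twist_series_nonzero[OF c, of a \<gamma>] by simp
    then show "Poly_Mapping.lookup f \<gamma> = Poly_Mapping.lookup g \<gamma>"
      by (rule injD[OF inj_chern])
  qed
  then show "inj_on h (carrier (kha a)) \<and> (\<forall>\<gamma>. \<forall>f \<in> kha_comp \<gamma>.
      h (Poly_Mapping.single \<gamma> f) = Poly_Mapping.single \<gamma> (twist_series c a \<gamma> * chern f))"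
    using single by (auto intro: inj_on_subset)
qed

lemma lookup_sigma: "Poly_Mapping.lookup (sigma a \<tau> f) \<gamma> = a_series a \<tau> \<gamma> * Poly_Mapping.lookup f \<gamma>"
  and lookup_sigma_tilde: "Poly_Mapping.lookup (sigma_tilde a \<tau> f) \<gamma> = b_series a \<tau> \<gamma> * Poly_Mapping.lookup f \<gamma>"
  by (simp_all add: sigma_def sigma_tilde_def lookup_mapp when_def in_keys_iff)

lemma keys_sigma: "Poly_Mapping.keys (sigma a \<tau> f) \<subseteq> Poly_Mapping.keys f"
  and keys_sigma_tilde: "Poly_Mapping.keys (sigma_tilde a \<tau> f) \<subseteq> Poly_Mapping.keys f"
  by (simp_all add: sigma_def sigma_tilde_def keys_mapp_subset)

lemma right_twist_mult:
  assumes S: "finite S" "Poly_Mapping.keys y \<subseteq> S" and T: "finite T" "Poly_Mapping.keys z \<subseteq> T"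
  shows "mult (right_twist (completed_coha a) (sigma a)) y z = (\<Sum>s\<in>S. \<Sum>t\<in>T. Poly_Mapping.single (s + t)
    (coha_mult a s t (Poly_Mapping.lookup y s) (a_series a s t * Poly_Mapping.lookup z t)))"
proof -
  have "mult (completed_coha a) (Poly_Mapping.single s (Poly_Mapping.lookup y s)) (sigma a s z)
      = (\<Sum>t\<in>T. Poly_Mapping.single (s + t)
          (coha_mult a s t (Poly_Mapping.lookup y s) (a_series a s t * Poly_Mapping.lookup z t)))" for s
    using graded_mult_superset[of "{s}" T "Poly_Mapping.single s (Poly_Mapping.lookup y s)" "sigma a s z" "coha_mult a"]
      T keys_sigma[of a s z]
    by (auto simp: completed_coha_def graded_ring_def lookup_sigma)
  then have "mult (right_twist (completed_coha a) (sigma a)) y z = (\<Sum>s\<in>Poly_Mapping.keys y. \<Sum>t\<in>T. Poly_Mapping.single (s + t)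
    (coha_mult a s t (Poly_Mapping.lookup y s) (a_series a s t * Poly_Mapping.lookup z t)))"
    by (simp add: right_twist_def)
  also have "\<dots> = (\<Sum>s\<in>S. \<Sum>t\<in>T. Poly_Mapping.single (s + t)
    (coha_mult a s t (Poly_Mapping.lookup y s) (a_series a s t * Poly_Mapping.lookup z t)))"
    by (rule sum.mono_neutral_left) (use S in \<open>auto simp: in_keys_iff\<close>)
  finally show ?thesis .
qed

lemma left_twist_mult:
  assumes S: "finite S" "Poly_Mapping.keys y \<subseteq> S" and T: "finite T" "Poly_Mapping.keys z \<subseteq> T"
  shows "mult (left_twist (completed_coha a) (sigma_tilde a)) y z = (\<Sum>s\<in>S. \<Sum>t\<in>T. Poly_Mapping.single (s + t)
    (coha_mult a s t (b_series a t s * Poly_Mapping.lookup y s) (Poly_Mapping.lookup z t)))"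
proof -
  have "mult (completed_coha a) (sigma_tilde a t y) (Poly_Mapping.single t (Poly_Mapping.lookup z t))
      = (\<Sum>s\<in>S. Poly_Mapping.single (s + t)
          (coha_mult a s t (b_series a t s * Poly_Mapping.lookup y s) (Poly_Mapping.lookup z t)))" for t
    using graded_mult_superset[of S "{t}" "sigma_tilde a t y" "Poly_Mapping.single t (Poly_Mapping.lookup z t)" "coha_mult a"]
      S keys_sigma_tilde[of a t y]
    by (auto simp: completed_coha_def graded_ring_def lookup_sigma_tilde)
  then have "mult (left_twist (completed_coha a) (sigma_tilde a)) y z = (\<Sum>t\<in>Poly_Mapping.keys z. \<Sum>s\<in>S. Poly_Mapping.single (s + t)
    (coha_mult a s t (b_series a t s * Poly_Mapping.lookup y s) (Poly_Mapping.lookup z t)))"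
    by (simp add: left_twist_def)
  also have "\<dots> = (\<Sum>t\<in>T. \<Sum>s\<in>S. Poly_Mapping.single (s + t)
    (coha_mult a s t (b_series a t s * Poly_Mapping.lookup y s) (Poly_Mapping.lookup z t)))"
    by (rule sum.mono_neutral_left) (use T in \<open>auto simp: in_keys_iff\<close>)
  also have "\<dots> = (\<Sum>s\<in>S. \<Sum>t\<in>T. Poly_Mapping.single (s + t)
    (coha_mult a s t (b_series a t s * Poly_Mapping.lookup y s) (Poly_Mapping.lookup z t)))"
    by (rule sum.swap)
  finally show ?thesis .
qed

theorem theorem1:
  fixes Q :: "('i :: {finite, linorder}, 'e) pre_digraph"
  defines "a \<equiv> arrow_count Q"
  assumes "fin_digraph Q"
    and "verts Q = UNIV"
    and "\<And>i j. a i j = a j i"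
  shows "(\<exists>h \<in> graded_hom (kha a) (right_twist (completed_coha a) (sigma a)).
            inj_on h (carrier (kha a)) \<and>
            (\<forall>\<gamma>. \<forall>f \<in> kha_comp \<gamma>.
               h (Poly_Mapping.single \<gamma> f) = Poly_Mapping.single \<gamma> (eta a \<gamma> * chern f))) \<and>
         (\<exists>h \<in> graded_hom (kha a) (left_twist (completed_coha a) (sigma_tilde a)).
            inj_on h (carrier (kha a)) \<and>
            (\<forall>\<gamma>. \<forall>f \<in> kha_comp \<gamma>.
               h (Poly_Mapping.single \<gamma> f) = Poly_Mapping.single \<gamma> (eta_tilde a \<gamma> * chern f)))"
proof
  show "\<exists>h \<in> graded_hom (kha a) (right_twist (completed_coha a) (sigma a)).
      inj_on h (carrier (kha a)) \<and>
      (\<forall>\<gamma>. \<forall>f \<in> kha_comp \<gamma>.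
         h (Poly_Mapping.single \<gamma> f) = Poly_Mapping.single \<gamma> (eta a \<gamma> * chern f))"
    unfolding eta_eq
    by (rule twisted_chern_graded_hom[of 1 a, where M = "\<lambda>s t y z. coha_mult a s t y (a_series a s t * z)"])
       (use assms(4) in \<open>simp_all add: right_twist_def completed_coha_def graded_ring_def
          right_twist_mult[unfolded right_twist_def completed_coha_def graded_ring_def, simplified] coha_mult_right_twist\<close>)
  show "\<exists>h \<in> graded_hom (kha a) (left_twist (completed_coha a) (sigma_tilde a)).
      inj_on h (carrier (kha a)) \<and>
      (\<forall>\<gamma>. \<forall>f \<in> kha_comp \<gamma>.
         h (Poly_Mapping.single \<gamma> f) = Poly_Mapping.single \<gamma> (eta_tilde a \<gamma> * chern f))"
    unfolding eta_tilde_eq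
    by (rule twisted_chern_graded_hom[of "-1" a, where M = "\<lambda>s t y z. coha_mult a s t (b_series a t s * y) z"])
       (use assms(4) in \<open>simp_all add: left_twist_def completed_coha_def graded_ring_def
          left_twist_mult[unfolded left_twist_def completed_coha_def graded_ring_def, simplified] coha_mult_left_twist\<close>)
qed

end
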